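(* Let $\tau\in(0,1)$ and consider the heterogeneous panel model with deterministic coefficients, the first-step estimators $\widehat\theta_{Ti}$ and the two-step estimator $\widehat\theta_\tau$ described in the context. Suppose: (1) $\varepsilon_{it}$ is i.i.d. across both $i$ and $t$; the regressors $\boldsymbol z_{it}$ are either i.i.d. across both $i$ and $t$, or common across units ($\boldsymbol z_{it}=\boldsymbol z_t$ with $\boldsymbol z_t$ i.i.d. over $t$); and $\{(\boldsymbol z_{it}^\top,\varepsilon_{it})\}$ is independent of $\{\theta_{i0}\}$. (2) $\{\theta_{i0}\}_i$ are deterministic elements of the compact set $\Theta$; $\theta_\tau^{\mathrm D}$ is the unique minimizer of $S(\theta)=\lim_{N\to\infty}\frac1N\sum_{i=1}^N\rho_\tau(\theta_{i0}-\theta)$; and $\theta_\tau^{\mathrm D}$ is an interior point of $\Theta$. (3) With $R_{T,2}$, $\kappa_{3,\theta}$, $\kappa_{4,\theta}$ as in the context: (i) $\sup_{i\le N}|\widehat\theta_{Ti}-\theta_{i0}|=o_P(1)$; (ii) $0<\inf_{i\le N}\sigma(\theta_{i0})^2\le\sup_{i\le N}\sigma(\theta_{i0})^2<\infty$; (iii) $\sigma(\theta)^2$ is continuously differentiable over $\Theta$; (iv) $\sup_{i\le N}\|\kappa_{3,\theta_{i0}}\|<\infty$, $\sup_{i\le N}\|\kappa_{4,\theta_{i0}}\|<\infty$, and $\sup_{i\le N}\sup_{x\in\mathbb R}|R_{T,2}(x,\theta_{i0})|=o(T^{-1})$. (4) There exists $\varepsilon>0$ such that, with $\mathcal N_\varepsilon(\theta_\tau^{\mathrm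 D})$ the $\varepsilon$-neighborhood of $\theta_\tau^{\mathrm D}$: (i) $F_{\mathrm D}=\lim_{N\to\infty}F_N$ is twice continuously differentiable on $\mathcal N_\varepsilon(\theta_\tau^{\mathrm D})$ with density $f_{\mathrm D}=F_{\mathrm D}'$, and $f_{\mathrm D}(\theta_\tau^{\mathrm D})\in(0,\infty)$; (ii) letting $\theta_{(1)}\le\cdots\le\theta_{(N)}$ denote the order statistics of $\{\theta_{i0}\}_{i=1}^N$ and $\Delta_i=\theta_{(i+1)}-\theta_{(i)}$, $$\max_{\theta_{(i)}\in\mathcal N_\varepsilon(\theta_\tau^{\mathrm D})}\big|\theta_{(i)}-F_{\mathrm D}^{-1}(i/N)\big|=O(N^{-1}),\qquad \max_{\theta_{(i)}\in\mathcal N_\varepsilon(\theta_\tau^{\mathrm D})}|\Delta_i-\Delta_{i+1}|=O(N^{-2}).$$ Then, as $N,T\to\infty$ with $T^{1/2}\ll N\ll T^{3/2}/(\log T)^2$, $$\sqrt{N\sqrt T}\,\big(\widehat\theta_\tau-\theta_\tau^{\mathrm D}\big)\xrightarrow{d}\mathcal N\Big(0,\frac{\sigma(\theta_\tau^{\mathrm D})}{\sqrt\pi\,f_{\mathrm D}(\theta_\tau^{\mathrm D})}\Big).$$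
   Context: Model: for $i=1,\dots,N$, $t=1,\dots,T$, $y_{it}=\boldsymbol Z_{it}^\top\boldsymbol\theta_{i0}+\varepsilon_{it}$, where $\boldsymbol Z_{it}=(1,\boldsymbol z_{it}^\top)^\top$ is a $K$-dimensional regressor vector, $\varepsilon_{it}$ is an unobserved innovation independent of $\boldsymbol Z_{it}$, and $\boldsymbol\theta_{i0}$ is a unit-specific coefficient vector in a compact parameter space $\Theta$. For notational simplicity the result is stated in scalar form ($K=1$): $\theta_{i0}\in\Theta\subset\mathbb R$ is the scalar coefficient of interest of unit $i$ (for $K>1$ the result is applied separately to each coordinate of $\boldsymbol\theta_{i0}$). Deterministic design: $\{\theta_{i0}\}_{i=1}^N$ is a fixed (nonrandom) array, whose entries may depend on $N$. Its empirical distribution function $F_N(x)=\frac1N\sum_{i=1}^N\mathbf 1\{\theta_{i0}\le x\}$ converges to a limiting distribution $F_{\mathrm D}(x)=\lim_{N\to\infty}F_N(x)$, and the target is $\theta_\tau^{\mathrm D}=\inf\{x:F_{\mathrm D}(x)\ge\tau\}$. Two-step estimator: write $\boldsymbol X_{it}=(y_{it},\boldsymbol Z_{it}^\top)^\top$. Step 1: for each $i$, $\widehat\theta_{Ti}=\widehat\theta_{Ti}(\{\boldsymbol X_{it}\}_{t=1}^T)$ is an estimator of $\theta_{i0}$, a measurable function of the data of unit $i$ only (the same function for all $i$). Step 2: $\widehat\theta_\tau=\arg\min_\theta\frac1N\sum_{i=1}^N\rho_\tau(\widehat\theta_{Ti}-\theta)$, where $\rho_\tau(u)=u(\tau-\mathbf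 1\{u\le0\})$. Notation: $\Phi,\phi$ are the standard normal CDF and PDF. $a\ll b$ means $a/b\to0$. $\sigma(\theta_{i0})^2=\lim_{T\to\infty}\mathrm{Var}(\sqrt T\,\widehat\theta_{Ti}\mid\theta_{i0})$ (the same function $\sigma(\cdot)^2$ for all $i$), $\sigma>0$. $W_T(\theta_{i0})=\sigma(\theta_{i0})^{-1}\sqrt T(\widehat\theta_{Ti}-\theta_{i0})$ and $R_{T,2}(x,\theta_{i0})=P(W_T(\theta_{i0})\le x\mid\theta_{i0})-\big[\Phi(x)+T^{-1/2}p_{1,\theta_{i0}}(x)\phi(x)+T^{-1}p_{2,\theta_{i0}}(x)\phi(x)\big]$ (conditioning on $\theta_{i0}$ just means that the true coefficient of unit $i$ is $\theta_{i0}$). Here $p_{1,\theta}(x)=b_1(x)'\kappa_{3,\theta}$ and $p_{2,\theta}(x)=b_2(x)'\kappa_{4,\theta}+b_3(x)'(\kappa_{3,\theta}\otimes\kappa_{3,\theta})$ are Edgeworth correction polynomials, where $b_1(x),b_2(x),b_3(x)$ are known finite vectors of polynomials in $x$, and the finite-dimensional vectors $\kappa_{3,\theta},\kappa_{4,\theta}$ collect the relevant cumulant terms and are continuously differentiable in $\theta$ in a neighborhood of $\theta_\tau^{\mathrm D}$.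
   Formalization: For K>1 with common, non-i.i.d. regressors the claim fails (y_it=a_i+z_t+ε_it, estimator mean of y_it), so it is also assumed there that the conditional cdf of W_T given the regressors is within O_P(T^{-1/2}) of the unconditional one, uniformly in x and i≤N. *)

theory Defs
  imports "HOL-Probability.Probability"
begin

section \<open>Deterministic coefficient arrays\<close>

text \<open>
  Units and time periods are numbered from \<open>0\<close>: for a panel of size \<open>(N, T)\<close> they range over
  \<open>i < N\<close> and \<open>t < T\<close>.  A function \<open>a :: nat \<Rightarrow> real\<close> stands for the coefficients of one
  cross section; only \<open>a 0, \<dots>, a (N - 1)\<close> matter.
\<close>

definition check_loss :: "real \<Rightarrow> real \<Rightarrow> real" where
  "check_loss \<tau> u = u * (\<tau> - (if u \<le> 0 then 1 else 0))"

definition check_objective :: "real \<Rightarrow> nat \<Rightarrow> (nat \<Rightarrow> real) \<Rightarrow> real \<Rightarrow> real" where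
  "check_objective \<tau> N a \<theta> = (\<Sum>i<N. check_loss \<tau> (a i - \<theta>)) / real N"

definition empirical_cdf :: "nat \<Rightarrow> (nat \<Rightarrow> real) \<Rightarrow> real \<Rightarrow> real" where
  "empirical_cdf N a x = (\<Sum>i<N. if a i \<le> x then 1 else 0) / real N"

definition quantile :: "(real \<Rightarrow> real) \<Rightarrow> real \<Rightarrow> real" where
  "quantile F p = Inf {x. p \<le> F x}"

text \<open>Order statistics keep the usual numbering \<open>j = 1, \<dots>, N\<close>.\<close>

definition order_stat :: "nat \<Rightarrow> (nat \<Rightarrow> real) \<Rightarrow> nat \<Rightarrow> real" where
  "order_stat N a j = sort (map a [0..<N]) ! (j - 1)"

definition spacing :: "nat \<Rightarrow> (nat \<Rightarrow> real) \<Rightarrow> nat \<Rightarrow> real" where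
  "spacing N a j = order_stat N a (j + 1) - order_stat N a j"

definition continuously_differentiable_within :: "(real \<Rightarrow> real) \<Rightarrow> real set \<Rightarrow> bool" where
  "continuously_differentiable_within g S \<longleftrightarrow>
     (\<exists>D. (\<forall>x\<in>S. (g has_real_derivative D x) (at x within S)) \<and> continuous_on S D)"

section \<open>The panel model and the first-step estimator\<close>

text \<open>
  The type \<open>'k\<close> indexes the coordinates of the \<open>K\<close>-dimensional regressor vector, including the
  intercept; \<open>K = CARD('k)\<close>, and \<open>K = 1\<close> is the model that only has an intercept.  The data of
  one unit with coefficient vector \<open>b\<close>, regressors \<open>z t\<close> and innovations \<open>e t\<close> are the pairs
  \<open>(y t, z t)\<close> for \<open>t < T\<close>.
\<close>

definition unit_data ::
  "nat \<Rightarrow> real^'k \<Rightarrow> (nat \<Rightarrow> real^'k) \<Rightarrow> (nat \<Rightarrow> real) \<Rightarrow> nat \<Rightarrow> real \<times> (real^'k)" where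
  "unit_data T b z e = (\<lambda>t\<in>{..<T}. (z t \<bullet> b + e t, z t))"

text \<open>\<open>W\<^sub>T\<close> for the coordinate \<open>k\<close>, with first-step estimator \<open>h T\<close>.\<close>

definition standardized ::
  "(nat \<Rightarrow> (nat \<Rightarrow> real \<times> (real^'k)) \<Rightarrow> real) \<Rightarrow> 'k \<Rightarrow> (real \<Rightarrow> real) \<Rightarrow>
   nat \<Rightarrow> real^'k \<Rightarrow> (nat \<Rightarrow> real^'k) \<Rightarrow> (nat \<Rightarrow> real) \<Rightarrow> real" where
  "standardized h k \<sigma> T b z e = sqrt (real T) * (h T (unit_data T b z e) - b $ k) / \<sigma> (b $ k)"

definition iid_family :: "'w measure \<Rightarrow> 'b measure \<Rightarrow> ('i \<Rightarrow> 'w \<Rightarrow> 'b) \<Rightarrow> 'i set \<Rightarrow> bool" where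
  "iid_family M S X I \<longleftrightarrow>
     prob_space.indep_vars M (\<lambda>_. S) X I \<and> (\<forall>i\<in>I. \<forall>j\<in>I. distr M S (X i) = distr M S (X j))"

definition iid_innovations :: "'w measure \<Rightarrow> (nat \<Rightarrow> nat \<Rightarrow> 'w \<Rightarrow> real) \<Rightarrow> bool" where
  "iid_innovations M e \<longleftrightarrow> iid_family M borel (\<lambda>(i, t). e i t) UNIV"

definition iid_regressors :: "'w measure \<Rightarrow> (nat \<Rightarrow> nat \<Rightarrow> 'w \<Rightarrow> real^'k) \<Rightarrow> bool" where
  "iid_regressors M Z \<longleftrightarrow> iid_family M borel (\<lambda>(i, t). Z i t) UNIV"

definition common_regressors :: "'w measure \<Rightarrow> (nat \<Rightarrow> nat \<Rightarrow> 'w \<Rightarrow> real^'k) \<Rightarrow> bool" where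
  "common_regressors M Z \<longleftrightarrow>
     (\<forall>i t. \<forall>\<omega>\<in>space M. Z i t \<omega> = Z 0 t \<omega>) \<and> iid_family M borel (\<lambda>t. Z 0 t) UNIV"

text \<open>Independence of the innovations and the regressors as whole families.\<close>

definition innovations_indep_regressors ::
  "'w measure \<Rightarrow> (nat \<Rightarrow> nat \<Rightarrow> 'w \<Rightarrow> real) \<Rightarrow> (nat \<Rightarrow> nat \<Rightarrow> 'w \<Rightarrow> real^'k) \<Rightarrow> bool" where
  "innovations_indep_regressors M e Z \<longleftrightarrow>
     prob_space.indep_set M
       (sets (vimage_algebra (space M) (\<lambda>\<omega>. \<lambda>(i, t). e i t \<omega>) (Pi\<^sub>M UNIV (\<lambda>_. borel))))
       (sets (vimage_algebra (space M) (\<lambda>\<omega>. \<lambda>(i, t). Z i t \<omega>) (Pi\<^sub>M UNIV (\<lambda>_. borel))))"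

section \<open>Edgeworth expansion\<close>

text \<open>\<open>b(x)' v\<close> for a vector \<open>b\<close> of polynomials and a vector \<open>v\<close> of cumulant terms.\<close>

definition poly_comb :: "real poly ^ 'm \<Rightarrow> real^'m \<Rightarrow> real \<Rightarrow> real" where
  "poly_comb b v x = (\<Sum>j\<in>UNIV. poly (b $ j) x * v $ j)"

definition kronecker :: "real^'m \<Rightarrow> real^'n \<Rightarrow> real^('m \<times> 'n)" where
  "kronecker u v = (\<chi> p. u $ fst p * v $ snd p)"

definition edgeworth ::
  "real poly ^ 'm \<Rightarrow> real poly ^ 'q \<Rightarrow> real poly ^ ('m \<times> 'm) \<Rightarrow> real^'m \<Rightarrow> real^'q \<Rightarrow>
   nat \<Rightarrow> real \<Rightarrow> real" where
  "edgeworth b1 b2 b3 c3 c4 T x =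
     cdf std_normal_distribution x
     + poly_comb b1 c3 x * std_normal_density x / sqrt (real T)
     + (poly_comb b2 c4 x + poly_comb b3 (kronecker c3 c3) x) * std_normal_density x / real T"

section \<open>Conditioning on common regressors\<close>

text \<open>
  Conditionally on the regressors being \<open>z\<close>, and since the innovations are independent of them,
  \<open>W\<^sub>T\<close> has distribution function \<open>x \<mapsto> P(standardized h k \<sigma> T b z (\<lambda>t. e t) \<le> x)\<close>.
  The next definition says that, uniformly over the units, this random distribution function
  deviates from the unconditional one by \<open>O\<^sub>P(T\<^sup>-\<^sup>1\<^sup>/\<^sup>2)\<close>.

  Some condition of this kind is indispensable when random regressors are shared by all units.
  Take \<open>y\<^sub>i\<^sub>t = a\<^sub>i + z\<^sub>t + e\<^sub>i\<^sub>t\<close> with standard normal \<open>z\<^sub>t\<close> and \<open>e\<^sub>i\<^sub>t\<close>, and estimate the intercept \<open>a\<^sub>i\<close>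
  by the mean of \<open>y\<^sub>i\<^sub>t\<close> over \<open>t\<close>.  Then \<open>W\<^sub>T\<close> is exactly standard normal for every unit, but all
  estimates contain the same error, the mean of \<open>z\<^sub>t\<close>, which is of order \<open>T\<^sup>-\<^sup>1\<^sup>/\<^sup>2\<close> and does not
  average out over the units.
\<close>

definition conditional_cdf_close ::
  "'w measure \<Rightarrow> (nat \<Rightarrow> nat \<Rightarrow> 'w \<Rightarrow> real) \<Rightarrow> (nat \<Rightarrow> nat \<Rightarrow> 'w \<Rightarrow> real^'k) \<Rightarrow>
   (nat \<Rightarrow> nat \<Rightarrow> real^'k) \<Rightarrow> (nat \<Rightarrow> (nat \<Rightarrow> real \<times> (real^'k)) \<Rightarrow> real) \<Rightarrow> 'k \<Rightarrow>
   (real \<Rightarrow> real) \<Rightarrow> (nat \<Rightarrow> nat) \<Rightarrow> (nat \<Rightarrow> nat) \<Rightarrow> bool" where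
  "conditional_cdf_close M e Z \<theta> h k \<sigma> Ns Ts \<longleftrightarrow>
     (\<forall>\<delta>>0. \<exists>C. \<forall>\<^sub>F n in sequentially. \<exists>A\<in>sets M. measure M A \<ge> 1 - \<delta> \<and>
       (\<forall>\<omega>\<in>A. \<forall>i<Ns n. \<forall>x.
         \<bar>measure M {\<omega>'\<in>space M.
             standardized h k \<sigma> (Ts n) (\<theta> (Ns n) i) (\<lambda>t. Z i t \<omega>) (\<lambda>t. e i t \<omega>') \<le> x}
          - measure M {\<omega>'\<in>space M.
             standardized h k \<sigma> (Ts n) (\<theta> (Ns n) i) (\<lambda>t. Z i t \<omega>') (\<lambda>t. e i t \<omega>') \<le> x}\<bar>
         \<le> C / sqrt (real (Ts n))))"

end

theory Submission
  imports Defs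
begin

text \<open>
  Since \<open>\<theta>hat\<tau>\<close> is an empirical \<open>\<tau>\<close>-quantile, the event \<open>\<theta>hat\<tau> \<le> x\<close> lies between \<open>\<tau> N < S\<close> and \<open>\<tau> N \<le> S\<close>, where \<open>S\<close> is
  the number of first-step estimates that are at most \<open>x = \<theta>\<tau> + v / sqrt (N sqrt T)\<close>. Given the regressors, \<open>S\<close> is a sum of
  independent indicators with success probabilities \<open>p\<^sub>i\<close>, so a central limit theorem that is uniform over such
  sums applies once \<open>\<Sum>\<^sub>i p\<^sub>i\<close> and \<open>\<Sum>\<^sub>i p\<^sub>i (1 - p\<^sub>i)\<close> are known up to \<open>o(L)\<close> and \<open>o(L\<^sup>2)\<close>, with \<open>L = sqrt (N / sqrt T)\<close>.

  Up to a total error \<open>O(N log T / T) = o(L)\<close> one may replace \<open>p\<^sub>i\<close> by \<open>\<Phi> (sqrt T (x - a\<^sub>i) / \<sigma>(\<theta>\<tau>))\<close>: only the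
  \<open>O(N log T / sqrt T)\<close> units with \<open>\<bar>x - a\<^sub>i\<bar>\<close> of order at most \<open>log T / sqrt T\<close> matter, and each of them is off by
  \<open>O(1 / sqrt T)\<close>. The order statistics condition gives
  \<open>\<bar>F\<^sub>N y - \<tau> - f (y - \<theta>\<tau>)\<bar> \<le> C ((y - \<theta>\<tau>)\<^sup>2 + 1 / N)\<close> for all \<open>y\<close>, and averaging it over \<open>y = x - \<sigma>(\<theta>\<tau>) V / sqrt T\<close> with \<open>V\<close>
  standard normal yields \<open>\<Sum>\<^sub>i p\<^sub>i = \<tau> N + L f v + o(L)\<close> and \<open>\<Sum>\<^sub>i p\<^sub>i (1 - p\<^sub>i) = L\<^sup>2 (f \<sigma>(\<theta>\<tau>) / sqrt \<pi> + o(1))\<close>; the constant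
  \<open>1 / sqrt \<pi>\<close> is the integral of \<open>\<Phi> (1 - \<Phi>)\<close>.
\<close>

section \<open>Empirical quantiles and distribution functions\<close>

text \<open>Up to logarithms, only units within \<open>1 / sqrt T\<close> of the quantile have a
  nondegenerate indicator, so the count \<open>S\<close> has variance of order
  \<open>N / sqrt T\<close>. This fixes \<open>L\<close> and the slow normalization
  \<open>sqrt (N sqrt T)\<close>, under which a shift \<open>v\<close> moves the mean of the count
  by \<open>L f v\<close>. The lower rate says exactly that \<open>L\<close> diverges, as the
  central limit theorem requires; the upper rate says exactly that
  \<open>N log T / T = o(L)\<close>, because the square of the quotient is
  \<open>N (log T)\<^sup>2 / T powr (3/2)\<close>. Pointwise convergence of \<open>F\<^sub>N\<close>
  would be too weak: its error is multiplied by \<open>N\<close> and must still be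
  \<open>o(L)\<close>, so the order statistics condition is used to make it \<open>O(1 / N)\<close>.
  With common regressors the estimates are dependent and the \<open>p\<^sub>i\<close> are random.
  Uniformity of the central limit theorem allows applying it at each realization of the regressors
  outside an event of small probability and averaging afterwards. The Edgeworth terms are never
  evaluated: only their order \<open>1 / sqrt T\<close> and their Gaussian decay away from the
  threshold enter.\<close>

lemma empirical_cdf_card:
  "empirical_cdf N a x = real (card {i\<in>{..<N}. a i \<le> x}) / real N"
  by (simp add: empirical_cdf_def sum.If_cases Int_def)

lemma empirical_cdf_nonneg: "0 \<le> empirical_cdf N a x"
  by (simp add: empirical_cdf_card)

lemma empirical_cdf_le_1: "empirical_cdf N a x \<le> 1"
proof -
  have "card {i\<in>{..<N}. a i \<le> x} \<le> card {..<N}"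
    by (intro card_mono) auto
  then show ?thesis by (simp add: empirical_cdf_card divide_le_eq)
qed

lemma empirical_cdf_mono: "x \<le> y \<Longrightarrow> empirical_cdf N a x \<le> empirical_cdf N a y"
  unfolding empirical_cdf_card by (intro divide_right_mono of_nat_mono card_mono) auto

text \<open>\<open>check_loss \<tau> (a - \<theta>)\<close> is convex in \<open>\<theta>\<close>, so
  the chord between \<open>q\<close> and \<open>x\<close> is controlled by the slope at the end
  \<open>x\<close>: here the left slope, hence the strict \<open>a < x\<close>; in the companion
  bound the right slope, hence \<open>a \<le> x\<close>.\<close>

lemma check_loss_diff_le:
  assumes "0 < \<tau>" "\<tau> < 1" "q \<le> x"
  shows "check_loss \<tau> (a - x) - check_loss \<tau> (a - q) \<le> (x - q) * ((if a < x then 1 else 0) - \<tau>)"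
proof -
  have "\<tau> * a \<le> \<tau> * x" if "a \<le> x" using that assms by (simp add: mult_left_mono)
  then show ?thesis
    using assms by (auto simp: check_loss_def algebra_simps)
qed

lemma check_loss_diff_le':
  assumes "0 < \<tau>" "\<tau> < 1" "x \<le> q"
  shows "check_loss \<tau> (a - x) - check_loss \<tau> (a - q) \<le> (q - x) * (\<tau> - (if a \<le> x then 1 else 0))"
  using assms by (auto simp: check_loss_def algebra_simps)

lemma check_objective_arg_min_le:
  assumes "is_arg_min (check_objective \<tau> N a) (\<lambda>_. True) q"
  shows "0 \<le> (\<Sum>i<N. check_loss \<tau> (a i - x) - check_loss \<tau> (a i - q))"
proof (cases "N = 0")
  case False
  have "check_objective \<tau> N a q \<le> check_objective \<tau> N a x"
    using assms by (auto simp: is_arg_min_linorder)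
  then show ?thesis
    using False by (simp add: check_objective_def sum_subtractf divide_right_mono field_simps)
qed simp

text \<open>Moving away from a minimizer cannot lower the objective, and summing the slope bounds
  leaves a count. Together the two parts enclose the event \<open>q \<le> x\<close> whichever
  minimizer is selected when the objective is flat at its minimum.\<close>

lemma check_objective_arg_min_count:
  assumes tau: "0 < \<tau>" "\<tau> < 1"
    and q: "is_arg_min (check_objective \<tau> N a) (\<lambda>_. True) q"
  shows "q \<le> x \<Longrightarrow> \<tau> * real N \<le> real (card {i\<in>{..<N}. a i \<le> x})"
    and "x < q \<Longrightarrow> real (card {i\<in>{..<N}. a i \<le> x}) \<le> \<tau> * real N"
proof -
  assume "q \<le> x"
  \<comment> \<open>The left slope at \<open>x\<close> counts \<open>a i < x\<close>, and for
    \<open>q = x\<close> the step length would vanish. A point \<open>x'\<close> to the right of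
    \<open>x\<close>, with no sample value strictly in between, cures both.\<close>
  obtain x' where x': "x < x'" "\<And>i. i < N \<Longrightarrow> a i < x' \<longleftrightarrow> a i \<le> x"
  proof (cases "\<exists>i<N. x < a i")
    case True
    then have ne: "{a i |i. i < N \<and> x < a i} \<noteq> {}" by auto
    show ?thesis
    proof (rule that[of "Min {a i |i. i < N \<and> x < a i}"])
      show "x < Min {a i |i. i < N \<and> x < a i}" using ne by (subst Min_gr_iff) auto
      show "a i < Min {a i |i. i < N \<and> x < a i} \<longleftrightarrow> a i \<le> x" if "i < N" for i
        using ne that by (subst Min_gr_iff) (auto simp: not_less[symmetric])
    qed
  next
    case False
    then show ?thesis by (intro that[of "x + 1"]) (simp, metis not_less less_add_one order.strict_trans1)
  qed
  have "0 \<le> (\<Sum>i<N. (x' - q) * ((if a i < x' then 1 else 0) - \<tau>))"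
    using check_objective_arg_min_le[OF q, of x'] check_loss_diff_le[OF tau, of q x'] x' \<open>q \<le> x\<close>
    by (smt (verit) sum_mono)
  also have "\<dots> = (x' - q) * ((\<Sum>i<N. if a i \<le> x then 1 else 0) - \<tau> * real N)"
    using x' by (simp add: sum_distrib_left[symmetric] sum_subtractf mult.commute)
  finally have "0 \<le> (\<Sum>i<N. if a i \<le> x then 1 else 0) - \<tau> * real N"
    using x' \<open>q \<le> x\<close> by (smt (verit) mult_pos_neg)
  then show "\<tau> * real N \<le> real (card {i\<in>{..<N}. a i \<le> x})"
    by (simp add: sum.If_cases Int_def)
next
  assume "x < q"
  have "0 \<le> (\<Sum>i<N. (q - x) * (\<tau> - (if a i \<le> x then 1 else 0)))"
    using check_objective_arg_min_le[OF q, of x] check_loss_diff_le'[OF tau, of x q] \<open>x < q\<close>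
    by (smt (verit) sum_mono)
  also have "\<dots> = (q - x) * (\<tau> * real N - (\<Sum>i<N. if a i \<le> x then 1 else 0))"
    by (simp add: sum_distrib_left[symmetric] sum_subtractf mult.commute)
  finally have "0 \<le> \<tau> * real N - (\<Sum>i<N. if a i \<le> x then 1 else 0)"
    using \<open>x < q\<close> by (smt (verit) mult_pos_neg)
  then show "real (card {i\<in>{..<N}. a i \<le> x}) \<le> \<tau> * real N"
    by (simp add: sum.If_cases Int_def)
qed

section \<open>Order statistics and the local expansion of the empirical distribution
  function\<close>

lemma sorted_nth_le_iff:
  fixes xs :: "'a::linorder list"
  assumes "sorted xs" "j < length xs"
  shows "xs ! j \<le> y \<longleftrightarrow> j < length (filter (\<lambda>x. x \<le> y) xs)"
  using assms
proof (induction xs arbitrary: j)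
  case (Cons x xs)
  show ?case
  proof (cases "x \<le> y")
    case True
    then show ?thesis using Cons by (cases j) auto
  next
    case False
    then have "filter (\<lambda>x. x \<le> y) (x # xs) = []"
      using Cons.prems(1) by (force simp: filter_empty_conv)
    moreover have "\<not> (x # xs) ! j \<le> y"
      using False Cons.prems by (cases j) (auto dest!: nth_mem)
    ultimately show ?thesis by simp
  qed
qed simp

lemma order_stat_le_iff:
  assumes "1 \<le> j" "j \<le> N"
  shows "order_stat N a j \<le> y \<longleftrightarrow> j \<le> card {i\<in>{..<N}. a i \<le> y}"
proof -
  have "length (filter (\<lambda>x. x \<le> y) (sort (map a [0..<N]))) = length (filter (\<lambda>i. a i \<le> y) [0..<N])"
    by (simp add: filter_sort filter_map comp_def)
  also have "\<dots> = card {i\<in>{..<N}. a i \<le> y}"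
    by (subst distinct_card[symmetric]) (auto intro: arg_cong[of _ _ card])
  finally show ?thesis
    using sorted_nth_le_iff[of "sort (map a [0..<N])" "j - 1" y] assms
    by (auto simp: order_stat_def)
qed

text \<open>\<open>y\<close> lies between the order statistics number \<open>j = G y\<close> and
  \<open>j + 1\<close>, which are within \<open>O(1 / N)\<close> of the quantiles of
  \<open>F\<close> at \<open>j / N\<close> and \<open>(j + 1) / N\<close>; the Lipschitz bound turns
  these horizontal errors into vertical ones. Shrinking \<open>r\<close> to \<open>r / 4\<close>
  leaves room for both order statistics to stay in the ball where \<open>os\<close> applies.\<close>

lemma empirical_cdf_near_limit:
  fixes a :: "nat \<Rightarrow> nat \<Rightarrow> real"
  assumes lim: "\<And>x. (\<lambda>N. empirical_cdf N (a N) x) \<longlonglongrightarrow> F x"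
    and lo: "\<And>x. x < A \<Longrightarrow> F x = 0" and hi: "\<And>x. B \<le> x \<Longrightarrow> F x = 1"
    and r: "0 < r"
    and lip: "\<And>x y. x \<in> ball m r \<Longrightarrow> y \<in> ball m r \<Longrightarrow> \<bar>F x - F y\<bar> \<le> L * \<bar>x - y\<bar>"
    and inc: "\<And>x y. x \<in> ball m r \<Longrightarrow> y \<in> ball m r \<Longrightarrow> x < y \<Longrightarrow> F x < F y"
    and os: "\<forall>\<^sub>F N in sequentially. \<forall>j\<in>{1..N}. order_stat N (a N) j \<in> ball m r \<longrightarrow>
             \<bar>order_stat N (a N) j - quantile F (real j / real N)\<bar> \<le> C / real N"
  shows "\<exists>C'. \<forall>\<^sub>F N in sequentially. \<forall>y. \<bar>y - m\<bar> \<le> r/4 \<longrightarrow>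
           \<bar>empirical_cdf N (a N) y - F y\<bar> \<le> C' / real N"
proof -
  \<comment> \<open>Strictly more than \<open>C\<close>, so that the bounds on quantiles are strict
    and can be read through the infimum: a strict upper bound produces a point of the set, a strict
    lower bound excludes one.\<close>
  define D where "D = \<bar>C\<bar> + 1"
  have D: "D > 0" "C < D" by (auto simp: D_def)
  have L: "0 \<le> L"
    using lip[of m "m + r/2"] r by (simp add: dist_real_def) (smt (verit) zero_le_mult_iff)
  have mono: "F x \<le> F y" if "x \<le> y" for x y
    by (rule LIMSEQ_le[OF lim lim]) (auto intro: empirical_cdf_mono that)
  have bdd: "bdd_below {x. p \<le> F x}" if "p > 0" for p
  proof (rule bdd_belowI[of _ A])
    show "A \<le> x" if "x \<in> {x. p \<le> F x}" for x
      using lo[of x] that \<open>p > 0\<close> by force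
  qed
  have ev1: "\<forall>\<^sub>F N in sequentially. empirical_cdf N (a N) x < empirical_cdf N (a N) y"
    if xy: "x \<in> ball m r" "y \<in> ball m r" "x < y" for x y
  proof -
    obtain z where z: "F x < z" "z < F y" using dense[OF inc[OF xy]] by blast
    show ?thesis
      using order_tendstoD(2)[OF lim z(1)] order_tendstoD(1)[OF lim z(2)]
      by eventually_elim simp
  qed
  \<comment> \<open>Strict growth of \<open>F\<close> eventually puts a coefficient into each of the
    two intervals at distance between \<open>r / 4\<close> and \<open>3 * r / 4\<close> from
    \<open>m\<close>, so the order statistics next to \<open>y\<close> cannot leave the
    ball.\<close>
  have e1: "\<forall>\<^sub>F N in sequentially. empirical_cdf N (a N) (m - 3*r/4) < empirical_cdf N (a N) (m - r/4)"
    using r by (intro ev1) (auto simp: dist_real_def)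
  have e2: "\<forall>\<^sub>F N in sequentially. empirical_cdf N (a N) (m + r/4) < empirical_cdf N (a N) (m + 3*r/4)"
    using r by (intro ev1) (auto simp: dist_real_def)
  have e3: "\<forall>\<^sub>F N in sequentially. D / real N < r / 4"
    using r by real_asymp
  have "\<forall>\<^sub>F N in sequentially. \<forall>y. \<bar>y - m\<bar> \<le> r/4 \<longrightarrow>
           \<bar>empirical_cdf N (a N) y - F y\<bar> \<le> (L * D + 1) / real N"
    using e1 e2 e3 os eventually_gt_at_top[of 0]
  proof eventually_elim
    case (elim N)
    define G where "G y = card {i\<in>{..<N}. a N i \<le> y}" for y
    have G: "empirical_cdf N (a N) y = real (G y) / real N" for y
      by (simp add: empirical_cdf_card G_def)
    have Gmono: "G x \<le> G y" if "x \<le> y" for x y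
      unfolding G_def by (rule card_mono) (use that in auto)
    have GN: "G y \<le> N" for y
      unfolding G_def using card_mono[of "{..<N}" "{i\<in>{..<N}. a N i \<le> y}"] by auto
    have g1: "G (m - 3*r/4) < G (m - r/4)" and g2: "G (m + r/4) < G (m + 3*r/4)"
      using elim by (auto simp: G divide_less_cancel)
    have q: "\<bar>order_stat N (a N) j - quantile F (real j / real N)\<bar> < D / real N"
      if "1 \<le> j" "j \<le> N" "\<bar>order_stat N (a N) j - m\<bar> < r" for j
    proof -
      have "\<bar>order_stat N (a N) j - quantile F (real j / real N)\<bar> \<le> C / real N"
        using elim(4) that by (auto simp: dist_real_def abs_minus_commute)
      also have "\<dots> < D / real N" using D elim by (intro divide_strict_right_mono) auto
      finally show ?thesis .
    qed
    show ?case
    proof (intro allI impI)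
      fix y assume y: "\<bar>y - m\<bar> \<le> r/4"
      have ym: "m - r/4 \<le> y" "y \<le> m + r/4" using y unfolding abs_le_iff by linarith+
      have DN: "0 \<le> D / real N" using D by simp
      have near: "y \<in> ball m r" "y + D / real N \<in> ball m r" "y - D / real N \<in> ball m r"
        unfolding mem_ball dist_real_def using ym elim(3) DN r by linarith+
      define j where "j = G y"
      have j1: "1 \<le> j" using g1 Gmono[of "m - r/4" y] y unfolding j_def by linarith
      have jN: "Suc j \<le> N" using g2 Gmono[of y "m + r/4"] y GN[of "m + 3*r/4"] unfolding j_def by linarith
      have le: "order_stat N (a N) i \<le> z \<longleftrightarrow> i \<le> G z" if "1 \<le> i" "i \<le> N" for i z
        using order_stat_le_iff[OF that] by (simp add: G_def)
      have o1: "order_stat N (a N) j \<le> y" "\<not> order_stat N (a N) j \<le> m - 3*r/4"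
        using le[of j] j1 jN g1 Gmono[OF ym(1)] by (auto simp: j_def)
      have o2: "\<not> order_stat N (a N) (Suc j) \<le> y" "order_stat N (a N) (Suc j) \<le> m + 3*r/4"
        using le[of "Suc j"] jN g2 Gmono[OF ym(2)] by (auto simp: j_def)
      have qj: "quantile F (real j / real N) < y + D / real N"
      proof -
        have "\<bar>order_stat N (a N) j - m\<bar> < r" using o1 ym r by linarith
        then show ?thesis using q[of j] o1 j1 jN by linarith
      qed
      have "\<exists>x\<in>{x. real j / real N \<le> F x}. x < y + D / real N"
      proof (rule cInf_lessD)
        show "{x. real j / real N \<le> F x} \<noteq> {}"
          using hi[of B] jN by (auto intro!: exI[of _ B] simp: divide_le_eq)
        show "Inf {x. real j / real N \<le> F x} < y + D / real N"
          using qj by (simp add: quantile_def)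
      qed
      then have "real j / real N \<le> F (y + D / real N)"
        using mono by (smt (verit) mem_Collect_eq)
      also have "\<dots> \<le> F y + L * \<bar>D / real N\<bar>"
        using lip[OF near(2,1)] by simp
      finally have u: "empirical_cdf N (a N) y - F y \<le> L * (D / real N)"
        using D by (simp add: G j_def)
      \<comment> \<open>The lower estimate uses the first order statistic above \<open>y\<close>,
        number \<open>j + 1\<close>; this is the source of the extra \<open>1 / N\<close>.\<close>
      have "y - D / real N < quantile F (real (Suc j) / real N)"
      proof -
        have "\<bar>order_stat N (a N) (Suc j) - m\<bar> < r" using o2 ym r by linarith
        then show ?thesis using q[of "Suc j"] o2 jN by linarith
      qed
      then have "\<not> real (Suc j) / real N \<le> F (y - D / real N)"
        using cInf_lower[OF CollectI bdd, of "real (Suc j) / real N" "y - D / real N"] elim(5)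
        by (auto simp: quantile_def)
      then have "real (Suc j) / real N > F (y - D / real N)" by simp
      moreover have "F (y - D / real N) \<ge> F y - L * \<bar>D / real N\<bar>"
        using lip[OF near(3,1)] by simp
      ultimately have l: "F y - empirical_cdf N (a N) y \<le> L * (D / real N) + 1 / real N"
        using D by (simp add: G j_def add_divide_distrib)
      show "\<bar>empirical_cdf N (a N) y - F y\<bar> \<le> (L * D + 1) / real N"
        using u l L D by (simp add: add_divide_distrib) (smt (verit) divide_nonneg_nonneg of_nat_0_le_iff)
    qed
  qed
  then show ?thesis by blast
qed

text \<open>Differentiability of \<open>f\<close> at \<open>m\<close> gives a Lipschitz bound for
  \<open>f\<close> around that one point, and the mean value theorem multiplies it by
  \<open>\<bar>y - m\<bar>\<close>.\<close>

lemma quadratic_expansion: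
  fixes F f :: "real \<Rightarrow> real"
  assumes r: "0 < r" and F: "\<And>x. x \<in> ball m r \<Longrightarrow> (F has_real_derivative f x) (at x)"
    and f: "f differentiable (at m)"
  shows "\<exists>\<delta>>0. \<exists>C. \<forall>y. \<bar>y - m\<bar> \<le> \<delta> \<longrightarrow> \<bar>F y - F m - f m * (y - m)\<bar> \<le> C * (y - m)\<^sup>2"
proof -
  obtain D where D: "(f has_real_derivative D) (at m)"
    using f by (auto simp: real_differentiable_def)
  then have "(\<lambda>y. (f y - f m) / (y - m)) \<midarrow>m\<rightarrow> D" by (simp add: has_field_derivative_iff)
  from tendstoD[OF this, of 1] obtain d where d: "d > 0"
    and dd: "\<And>y. y \<noteq> m \<Longrightarrow> \<bar>y - m\<bar> < d \<Longrightarrow> \<bar>(f y - f m) / (y - m) - D\<bar> < 1"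
    by (auto simp: eventually_at dist_real_def)
  define \<delta> where "\<delta> = min d r / 2"
  have \<delta>: "\<delta> > 0" "\<delta> < d" "\<delta> < r" using d r by (auto simp: \<delta>_def)
  have lip: "\<bar>f y - f m\<bar> \<le> (\<bar>D\<bar> + 1) * \<bar>y - m\<bar>" if "\<bar>y - m\<bar> \<le> \<delta>" for y
  proof (cases "y = m")
    case False
    then have "\<bar>(f y - f m) / (y - m)\<bar> \<le> \<bar>D\<bar> + 1" using dd[of y] that \<delta> by linarith
    then show ?thesis using False by (simp add: abs_divide divide_le_eq)
  qed simp
  have "\<bar>F y - F m - f m * (y - m)\<bar> \<le> (\<bar>D\<bar> + 1) * (y - m)\<^sup>2" if y: "\<bar>y - m\<bar> \<le> \<delta>" for y
  proof (cases "y = m")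
    case False
    have "\<exists>z. \<bar>z - m\<bar> \<le> \<bar>y - m\<bar> \<and> F y - F m = (y - m) * f z"
    proof (cases "m < y")
      case True
      have "\<exists>z>m. z < y \<and> F y - F m = (y - m) * f z"
        by (rule MVT2[OF True]) (use y \<delta> F in \<open>auto simp: dist_real_def\<close>)
      then obtain z where "m < z" "z < y" "F y - F m = (y - m) * f z" by blast
      then show ?thesis by (intro exI[of _ z]) auto
    next
      case False
      then have ym: "y < m" using \<open>y \<noteq> m\<close> by simp
      have "\<exists>z>y. z < m \<and> F m - F y = (m - y) * f z"
        by (rule MVT2[OF ym]) (use y \<delta> F in \<open>auto simp: dist_real_def\<close>)
      then obtain z where "y < z" "z < m" "F m - F y = (m - y) * f z" by blast
      then show ?thesis by (intro exI[of _ z]) (auto simp: algebra_simps)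
    qed
    then obtain z where z: "\<bar>z - m\<bar> \<le> \<bar>y - m\<bar>" "F y - F m = (y - m) * f z" by blast
    have "\<bar>F y - F m - f m * (y - m)\<bar> = \<bar>y - m\<bar> * \<bar>f z - f m\<bar>"
      unfolding z(2) abs_mult[symmetric] by (simp add: algebra_simps)
    also have "\<dots> \<le> \<bar>y - m\<bar> * ((\<bar>D\<bar> + 1) * \<bar>y - m\<bar>)"
      using order_trans[OF lip mult_left_mono[OF z(1)]] z y by (intro mult_left_mono) auto
    also have "\<dots> = (\<bar>D\<bar> + 1) * (y - m)\<^sup>2" by (simp add: power2_eq_square)
    finally show ?thesis .
  qed simp
  with \<delta> show ?thesis by blast
qed

text \<open>The local bound extends to every \<open>y\<close>, because away from \<open>m\<close>
  the left side is at most \<open>1 + f m * \<bar>y - m\<bar>\<close>, which a multiple of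
  \<open>(y - m)\<^sup>2\<close> dominates. A global bound can be averaged over a Gaussian shift
  without truncation.\<close>

lemma empirical_cdf_expansion:
  fixes a :: "nat \<Rightarrow> nat \<Rightarrow> real" and F f :: "real \<Rightarrow> real"
  assumes lim: "\<And>x. (\<lambda>N. empirical_cdf N (a N) x) \<longlonglongrightarrow> F x"
    and S: "compact S" "\<And>N i. i < N \<Longrightarrow> a N i \<in> S"
    and p: "0 < p" "p < 1" and m: "m = quantile F p"
    and r: "0 < r" and F: "\<And>x. x \<in> ball m r \<Longrightarrow> (F has_real_derivative f x) (at x)"
    and f: "f C1_differentiable_on ball m r" "0 < f m"
    and os: "\<forall>\<^sub>F N in sequentially. \<forall>j\<in>{1..N}. order_stat N (a N) j \<in> ball m r \<longrightarrow>
             \<bar>order_stat N (a N) j - quantile F (real j / real N)\<bar> \<le> C / real N"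
  shows "\<exists>C'\<ge>0. \<forall>\<^sub>F N in sequentially. \<forall>y.
           \<bar>empirical_cdf N (a N) y - p - f m * (y - m)\<bar> \<le> C' * ((y - m)\<^sup>2 + 1 / real N)"
proof -
  obtain A B where AB: "\<And>x. x \<in> S \<Longrightarrow> A \<le> x \<and> x \<le> B"
    using compact_imp_bounded[OF S(1)] by (meson abs_le_iff bounded_real minus_le_iff)
  have lo: "F x = 0" if "x < A" for x
  proof -
    have "empirical_cdf N (a N) x = 0" for N
      unfolding empirical_cdf_def using S(2) AB that by (force intro!: sum.neutral)
    then show ?thesis using lim[of x] by (simp add: LIMSEQ_const_iff)
  qed
  have hi: "F x = 1" if "B \<le> x" for x
  proof -
    have "(\<Sum>i<N. if a N i \<le> x then 1 else 0 :: real) = (\<Sum>i<N. 1)" for N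
      using S(2) AB that by (intro sum.cong refl) force
    then have "empirical_cdf N (a N) x = 1" if "N > 0" for N
      using that unfolding empirical_cdf_def by simp
    then have "\<forall>\<^sub>F N in sequentially. empirical_cdf N (a N) x = 1"
      by (intro eventually_mono[OF eventually_gt_at_top[of 0]])
    then have "(\<lambda>N. empirical_cdf N (a N) x) \<longlonglongrightarrow> 1" by (simp add: tendsto_eventually)
    then show ?thesis using lim[of x] LIMSEQ_unique by blast
  qed
  have mono: "F x \<le> F y" if "x \<le> y" for x y
    by (rule LIMSEQ_le[OF lim lim]) (auto intro: empirical_cdf_mono that)
  have ne: "{x. p \<le> F x} \<noteq> {}" using hi[of B] p by (auto intro!: exI[of _ B])
  have bdd: "bdd_below {x. p \<le> F x}"
  proof (rule bdd_belowI[of _ A])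
    show "A \<le> x" if "x \<in> {x. p \<le> F x}" for x
      using lo[of x] that p by force
  qed
  have contF: "isCont F m" using F[of m] r DERIV_isCont by auto
  \<comment> \<open>\<open>F\<close> is below \<open>p\<close> to the left of \<open>m\<close> and
    at least \<open>p\<close> to the right; continuity at \<open>m\<close> forces equality.\<close>
  have Fm: "F m = p"
  proof (rule antisym)
    have lt: "F y < p" if "y < m" for y
      using that bdd unfolding m quantile_def by (metis cInf_lower leD mem_Collect_eq not_le)
    have "(F \<longlongrightarrow> F m) (at_left m)" using contF by (simp add: isCont_def filterlim_at_split)
    then show "F m \<le> p"
      by (rule tendsto_upperbound) (auto simp: eventually_at_filter intro!: always_eventually less_imp_le lt)
    have gt: "p \<le> F y" if "m < y" for y
    proof -
      have "\<exists>x\<in>{x. p \<le> F x}. x < y"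
        by (rule cInf_lessD[OF ne]) (use that m in \<open>simp add: quantile_def\<close>)
      then show ?thesis using mono by (smt (verit) mem_Collect_eq)
    qed
    have "(F \<longlongrightarrow> F m) (at_right m)" using contF by (simp add: isCont_def filterlim_at_split)
    then show "p \<le> F m"
      by (rule tendsto_lowerbound) (auto simp: eventually_at_filter intro!: always_eventually gt)
  qed
  have fdiff: "f differentiable (at m)"
    using f(1) r by (auto simp: C1_differentiable_on_eq)
  have "isCont f m" using fdiff by (simp add: differentiable_imp_continuous_within)
  then have "\<forall>\<^sub>F x in nhds m. dist (f x) (f m) < f m / 2"
    using f(2) by (intro tendstoD) (simp_all add: continuous_at tendsto_nhds_iff)
  then obtain d where d: "d > 0" "\<And>x. \<bar>x - m\<bar> < d \<Longrightarrow> \<bar>f x - f m\<bar> < f m / 2"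
    by (auto simp: eventually_nhds_metric dist_real_def)
  \<comment> \<open>On the smaller ball \<open>f\<close> stays between \<open>f m / 2\<close> and
    \<open>3 * f m / 2\<close>, which yields both strict growth of \<open>F\<close> and the
    Lipschitz constant \<open>2 * f m\<close>.\<close>
  define r' where "r' = min r d"
  have r': "r' > 0" "r' \<le> r" "r' \<le> d" using r d by (auto simp: r'_def)
  have mvt: "\<exists>z. F y - F x = (y - x) * f z \<and> \<bar>f z - f m\<bar> < f m / 2"
    if xy: "x \<in> ball m r'" "y \<in> ball m r'" "x < y" for x y
  proof -
    have "\<exists>z>x. z < y \<and> F y - F x = (y - x) * f z"
      by (rule MVT2[OF xy(3)], rule F) (use xy r' in \<open>auto simp: dist_real_def\<close>)
    then show ?thesis using d xy r' by (auto simp: dist_real_def)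
  qed
  have inc: "F x < F y" if xy: "x \<in> ball m r'" "y \<in> ball m r'" "x < y" for x y
  proof -
    obtain z where z: "F y - F x = (y - x) * f z" "\<bar>f z - f m\<bar> < f m / 2"
      using mvt[OF xy] by blast
    have "(y - x) * f z > 0" using z xy f(2) by (intro mult_pos_pos) (auto simp: abs_if split: if_splits)
    then show ?thesis using z by simp
  qed
  have lip0: "\<bar>F x - F y\<bar> \<le> (2 * f m) * \<bar>x - y\<bar>" if xy: "x \<in> ball m r'" "y \<in> ball m r'" "x < y" for x y
  proof -
    obtain z where z: "F y - F x = (y - x) * f z" "\<bar>f z - f m\<bar> < f m / 2"
      using mvt[OF xy] by blast
    have "\<bar>F x - F y\<bar> = \<bar>(y - x) * f z\<bar>" unfolding z(1)[symmetric] by (rule abs_minus_commute)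
    also have "\<dots> = (y - x) * \<bar>f z\<bar>" using xy by (simp add: abs_mult)
    finally have "\<bar>F x - F y\<bar> = (y - x) * \<bar>f z\<bar>" .
    also have "(y - x) * \<bar>f z\<bar> \<le> (y - x) * (2 * f m)" using z(2) xy(3) f(2) by (intro mult_left_mono) linarith+
    finally show ?thesis using xy by (simp add: mult.commute)
  qed
  have lip: "\<bar>F x - F y\<bar> \<le> (2 * f m) * \<bar>x - y\<bar>" if "x \<in> ball m r'" "y \<in> ball m r'" for x y
    using lip0[of x y] lip0[of y x] that by (cases x y rule: linorder_cases) (auto simp: abs_minus_commute)
  have "\<exists>C'. \<forall>\<^sub>F N in sequentially. \<forall>y. \<bar>y - m\<bar> \<le> r'/4 \<longrightarrow>
           \<bar>empirical_cdf N (a N) y - F y\<bar> \<le> C' / real N"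
  proof (rule empirical_cdf_near_limit[OF lim lo hi r'(1) lip inc])
    show "\<forall>\<^sub>F N in sequentially. \<forall>j\<in>{1..N}. order_stat N (a N) j \<in> ball m r' \<longrightarrow>
             \<bar>order_stat N (a N) j - quantile F (real j / real N)\<bar> \<le> C / real N"
      using os subset_ball[OF r'(2), of m] by (auto elim!: eventually_mono)
  qed
  then obtain C1 where C1: "\<forall>\<^sub>F N in sequentially. \<forall>y. \<bar>y - m\<bar> \<le> r'/4 \<longrightarrow>
           \<bar>empirical_cdf N (a N) y - F y\<bar> \<le> C1 / real N" by blast
  obtain \<delta> C2 where \<delta>: "\<delta> > 0" and C2: "\<And>y. \<bar>y - m\<bar> \<le> \<delta> \<Longrightarrow> \<bar>F y - F m - f m * (y - m)\<bar> \<le> C2 * (y - m)\<^sup>2"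
    using quadratic_expansion[OF r F fdiff] by blast
  define \<rho> where "\<rho> = min \<delta> (r'/4)"
  have \<rho>: "\<rho> > 0" "\<rho> \<le> \<delta>" "\<rho> \<le> r'/4" using \<delta> r' by (auto simp: \<rho>_def)
  \<comment> \<open>Once \<open>\<bar>y - m\<bar> > \<rho>\<close>, the summand
    \<open>1 / \<rho>\<^sup>2\<close> pays for the bounded part and \<open>f m / \<rho>\<close> for
    the linear part.\<close>
  define C3 where "C3 = max (max \<bar>C1\<bar> \<bar>C2\<bar>) (1 / \<rho>\<^sup>2 + f m / \<rho>)"
  have C3: "C3 \<ge> 0" "C1 \<le> C3" "C2 \<le> C3" "1 / \<rho>\<^sup>2 + f m / \<rho> \<le> C3" by (auto simp: C3_def)
  have "\<forall>\<^sub>F N in sequentially. \<forall>y.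
           \<bar>empirical_cdf N (a N) y - p - f m * (y - m)\<bar> \<le> C3 * ((y - m)\<^sup>2 + 1 / real N)"
    using C1
  proof (eventually_elim, intro allI)
    fix N y assume N: "\<forall>y. \<bar>y - m\<bar> \<le> r'/4 \<longrightarrow> \<bar>empirical_cdf N (a N) y - F y\<bar> \<le> C1 / real N"
    show "\<bar>empirical_cdf N (a N) y - p - f m * (y - m)\<bar> \<le> C3 * ((y - m)\<^sup>2 + 1 / real N)"
    proof (cases "\<bar>y - m\<bar> \<le> \<rho>")
      case True
      have "\<bar>empirical_cdf N (a N) y - F y\<bar> \<le> C1 / real N" using N True \<rho> by auto
      also have "\<dots> \<le> C3 / real N" using C3 by (intro divide_right_mono) auto
      finally have 1: "\<bar>empirical_cdf N (a N) y - F y\<bar> \<le> C3 / real N" .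
      have "\<bar>F y - F m - f m * (y - m)\<bar> \<le> C2 * (y - m)\<^sup>2" using C2 True \<rho> by auto
      also have "\<dots> \<le> C3 * (y - m)\<^sup>2" using C3 by (intro mult_right_mono) auto
      finally show ?thesis using 1 Fm by (simp add: algebra_simps)
    next
      case False
      then have y: "\<rho> < \<bar>y - m\<bar>" by simp
      have y1: "1 \<le> (1 / \<rho>\<^sup>2) * (y - m)\<^sup>2"
        using power_mono[of \<rho> "\<bar>y - m\<bar>" 2] \<rho> y by (simp add: le_divide_eq)
      have "f m * \<bar>y - m\<bar> * \<rho> \<le> f m * \<bar>y - m\<bar> * \<bar>y - m\<bar>"
        using y f(2) by (intro mult_left_mono) auto
      then have y2: "f m * \<bar>y - m\<bar> \<le> (f m / \<rho>) * (y - m)\<^sup>2"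
        using \<rho> by (simp add: field_simps power2_eq_square abs_mult_self_eq)
      have "\<bar>empirical_cdf N (a N) y - p - f m * (y - m)\<bar> \<le> 1 + f m * \<bar>y - m\<bar>"
      proof -
        have "\<bar>empirical_cdf N (a N) y - p\<bar> \<le> 1"
          using empirical_cdf_nonneg[of N "a N" y] empirical_cdf_le_1[of N "a N" y] p by auto
        moreover have "\<bar>f m * (y - m)\<bar> = f m * \<bar>y - m\<bar>" using f(2) by (simp add: abs_mult)
        ultimately show ?thesis by linarith
      qed
      also have "\<dots> \<le> (1 / \<rho>\<^sup>2 + f m / \<rho>) * (y - m)\<^sup>2"
        using y1 y2 by (simp add: distrib_right)
      also have "\<dots> \<le> C3 * (y - m)\<^sup>2" using C3 by (intro mult_right_mono) auto
      also have "\<dots> \<le> C3 * ((y - m)\<^sup>2 + 1 / real N)" using C3 by (intro mult_left_mono) auto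
      finally show ?thesis .
    qed
  qed
  with C3 show ?thesis by blast
qed

section \<open>Gaussian integrals and Edgeworth terms\<close>

abbreviation std_normal_cdf :: "real \<Rightarrow> real" where
  "std_normal_cdf \<equiv> cdf std_normal_distribution"

interpretation std_normal: real_distribution std_normal_distribution
  by (rule real_dist_normal_dist)

lemma integral_std_normal:
  "g \<in> borel_measurable borel \<Longrightarrow>
    (\<integral>v. g v \<partial>std_normal_distribution) = (\<integral>v. std_normal_density v * g v \<partial>lborel)" for g :: "real \<Rightarrow> real"
  by (subst integral_density) auto

lemma isCont_std_normal_density: "isCont std_normal_density x"
  unfolding std_normal_density_def by (intro continuous_intros) auto

section \<open>Calculus of the standard normal distribution function\<close>

lemma std_normal_cdf_diff:
  assumes "a \<le> b"
  shows "std_normal_cdf b - std_normal_cdf a = integral {a..b} std_normal_density"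
proof (cases "a = b")
  case False
  then have "a < b" using assms by simp
  have "std_normal_cdf b - std_normal_cdf a = measure std_normal_distribution {a<..b}"
    using \<open>a < b\<close> by (rule std_normal.cdf_diff_eq)
  also have "\<dots> = (\<integral>v. indicator {a<..b} v \<partial>std_normal_distribution)"
    by simp
  also have "\<dots> = (\<integral>v. std_normal_density v * indicator {a<..b} v \<partial>lborel)"
    by (rule integral_std_normal) simp
  also have "\<dots> = (\<integral>v. indicator {a..b} v * std_normal_density v \<partial>lborel)"
    using AE_lborel_singleton[of a]
    by (intro integral_cong_AE) (auto simp: indicator_def elim!: eventually_mono)
  also have "\<dots> = integral {a..b} std_normal_density"
    using set_borel_integral_eq_integral(2)[of "{a..b}" std_normal_density]
    unfolding set_lebesgue_integral_def set_integrable_def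
    using integrable_mult_indicator[OF _ integrable_normal_density, of "{a..b}"] by auto
  finally show ?thesis .
qed simp

lemma DERIV_std_normal_cdf: "(std_normal_cdf has_real_derivative std_normal_density x) (at x)"
proof -
  have "((\<lambda>u. integral {x-1..u} std_normal_density) has_real_derivative std_normal_density x)
          (at x within {x-1..x+1})"
    by (intro integral_has_real_derivative continuous_at_imp_continuous_on ballI isCont_std_normal_density) auto
  then have "((\<lambda>u. std_normal_cdf (x-1) + integral {x-1..u} std_normal_density) has_real_derivative std_normal_density x)
          (at x)"
    by (subst (asm) at_within_interior) (auto intro!: derivative_eq_intros)
  then show ?thesis
  proof (rule has_field_derivative_transform_within[where d=1])
    fix y assume "dist y x < 1"
    then have "x - 1 \<le> y" by (auto simp: dist_real_def)
    then show "std_normal_cdf (x-1) + integral {x-1..y} std_normal_density = std_normal_cdf y"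
      using std_normal_cdf_diff[of "x-1" y] by simp
  qed auto
qed

lemma isCont_std_normal_cdf: "isCont std_normal_cdf x"
  using DERIV_std_normal_cdf by (rule DERIV_isCont)

lemma std_normal_cdf_measurable [measurable]: "std_normal_cdf \<in> borel_measurable borel"
  by (intro borel_measurable_continuous_onI continuous_at_imp_continuous_on ballI isCont_std_normal_cdf)

lemma DERIV_std_normal_density: "(std_normal_density has_real_derivative - x * std_normal_density x) (at x)"
proof -
  have "((\<lambda>x. c * exp (- x\<^sup>2 / 2)) has_real_derivative - x * (c * exp (- x\<^sup>2 / 2))) (at x)" for c
    by (auto intro!: derivative_eq_intros)
  then show ?thesis unfolding std_normal_density_def[abs_def] .
qed

lemma std_normal_density_at_top: "(std_normal_density \<longlongrightarrow> 0) at_top"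
  and std_normal_density_at_bot: "(std_normal_density \<longlongrightarrow> 0) at_bot"
  unfolding std_normal_density_def[abs_def] by real_asymp+

lemma std_normal_cdf_minus: "std_normal_cdf (- x) = 1 - std_normal_cdf x"
proof -
  have "((\<lambda>x. std_normal_cdf x + std_normal_cdf (- x)) has_real_derivative 0) (at x)" for x
  proof -
    have "((\<lambda>x. std_normal_cdf (- x)) has_real_derivative std_normal_density (- x) * (- 1)) (at x)"
      by (rule DERIV_chain2[OF DERIV_std_normal_cdf]) (auto intro!: derivative_eq_intros)
    from DERIV_add[OF DERIV_std_normal_cdf this] show ?thesis
      by (simp add: std_normal_density_def)
  qed
  then have const: "std_normal_cdf y + std_normal_cdf (- y) = std_normal_cdf x + std_normal_cdf (- x)" for y
    by (intro DERIV_isconst_all allI)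
  have "((\<lambda>y. std_normal_cdf y + std_normal_cdf (- y)) \<longlongrightarrow> 1 + 0) at_top"
    by (intro tendsto_add std_normal.cdf_lim_at_top_prob
        filterlim_compose[OF std_normal.cdf_lim_at_bot filterlim_uminus_at_bot_at_top])
  moreover have "((\<lambda>y. std_normal_cdf y + std_normal_cdf (- y)) \<longlongrightarrow> std_normal_cdf x + std_normal_cdf (- x)) at_top"
    by (intro tendsto_eventually always_eventually allI const)
  ultimately have "1 + 0 = std_normal_cdf x + std_normal_cdf (- x)"
    by (rule tendsto_unique[rotated]) simp
  then show ?thesis by linarith
qed

text \<open>Serves two antiderivatives with explicit limits at both ends:
  \<open>\<Phi> (1 - \<Phi>)\<close>, and \<open>- \<phi>\<close> times
  \<open>bernoulli_weight\<close>.\<close>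

lemma std_normal_FTC:
  fixes F f :: "real \<Rightarrow> real"
  assumes F: "\<And>x. (F has_real_derivative f x) (at x)" and f: "\<And>x. isCont f x" "integrable lborel f"
    and A: "(F \<longlongrightarrow> A) at_bot"
  shows "(\<integral>v. indicator {..y} v * f v \<partial>lborel) = F y - A"
    and "(F \<longlongrightarrow> B) at_top \<Longrightarrow> (\<integral>v. f v \<partial>lborel) = B - A"
proof -
  have bot: "((F \<circ> real_of_ereal) \<longlongrightarrow> A) (at_right (-\<infinity>))"
    using A by (simp add: ereal_tendsto_simps)
  have "(LBINT x=-\<infinity>..ereal y. f x) = F y - A"
  proof (rule interval_integral_FTC_integrable)
    show "set_integrable lborel (einterval (- \<infinity>) (ereal y)) f"
      unfolding set_integrable_def using f(2) by (intro integrable_mult_indicator) auto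
    have "(F \<longlongrightarrow> F y) (at_left y)"
      using DERIV_isCont[OF F] by (simp add: isCont_def filterlim_at_split)
    then show "((F \<circ> real_of_ereal) \<longlongrightarrow> F y) (at_left (ereal y))"
      by (simp add: ereal_tendsto_simps)
  qed (use F f bot in \<open>auto simp: has_real_derivative_iff_has_vector_derivative\<close>)
  moreover have "(LBINT x=-\<infinity>..ereal y. f x) = (\<integral>v. indicator {..<y} v * f v \<partial>lborel)"
    by (simp add: interval_lebesgue_integral_le_eq set_lebesgue_integral_def)
  moreover have "\<dots> = (\<integral>v. indicator {..y} v * f v \<partial>lborel)"
    using AE_lborel_singleton[of y] f
    by (intro integral_cong_AE) (auto simp: indicator_def elim!: eventually_mono)
  ultimately show "(\<integral>v. indicator {..y} v * f v \<partial>lborel) = F y - A" by simp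
  assume B: "(F \<longlongrightarrow> B) at_top"
  have "(LBINT x=-\<infinity>..\<infinity>. f x) = B - A"
  proof (rule interval_integral_FTC_integrable)
    show "set_integrable lborel (einterval (- \<infinity>) \<infinity>) f"
      using f(2) by (simp add: set_integrable_def)
    show "((F \<circ> real_of_ereal) \<longlongrightarrow> B) (at_left \<infinity>)"
      using B by (simp add: ereal_tendsto_simps)
  qed (use F f bot in \<open>auto simp: has_real_derivative_iff_has_vector_derivative\<close>)
  then show "(\<integral>v. f v \<partial>lborel) = B - A"
    by (simp add: interval_lebesgue_integral_le_eq set_lebesgue_integral_def)
qed

lemma std_normal_cdf_bounds: "0 \<le> std_normal_cdf x" "std_normal_cdf x \<le> 1"
  by (rule std_normal.cdf_nonneg std_normal.cdf_bounded_prob)+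

lemma integral_std_normal_indicator: "(\<integral>v. indicator {..y} v \<partial>std_normal_distribution) = std_normal_cdf y"
  by (simp add: cdf_def)

text \<open>The derivative of \<open>\<Phi> (1 - \<Phi>)\<close> is \<open>(1 - 2 \<Phi>) \<phi>\<close>. With this weight the variance of a Bernoulli variable with
  parameter \<open>\<Phi> y\<close> becomes the integral of a function of \<open>v \<le> y\<close>, exactly like its mean.\<close>

definition bernoulli_weight :: "real \<Rightarrow> real" where
  "bernoulli_weight v = 1 - 2 * std_normal_cdf v"

lemma bernoulli_weight_measurable [measurable]: "bernoulli_weight \<in> borel_measurable borel"
  unfolding bernoulli_weight_def[abs_def] by measurable

lemma abs_bernoulli_weight_le: "\<bar>bernoulli_weight v\<bar> \<le> 1"
  using std_normal_cdf_bounds[of v] by (auto simp: bernoulli_weight_def abs_if)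

lemma isCont_bernoulli_weight: "isCont bernoulli_weight x"
  unfolding bernoulli_weight_def[abs_def] by (intro continuous_intros isCont_std_normal_cdf)

lemma integrable_density_bernoulli_weight: "integrable lborel (\<lambda>v. std_normal_density v * bernoulli_weight v)"
  by (rule Bochner_Integration.integrable_bound[of _ std_normal_density])
     (auto simp: abs_mult intro!: mult_left_le abs_bernoulli_weight_le)

lemma
  shows integral_bernoulli_weight_indicator:
    "(\<integral>v. bernoulli_weight v * indicator {..y} v \<partial>std_normal_distribution)
      = std_normal_cdf y * (1 - std_normal_cdf y)"
    and integral_bernoulli_weight: "(\<integral>v. bernoulli_weight v \<partial>std_normal_distribution) = 0"
proof -
  let ?F = "\<lambda>v. std_normal_cdf v * (1 - std_normal_cdf v)"
  have D: "(?F has_real_derivative std_normal_density v * bernoulli_weight v) (at v)" for v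
    by (auto intro!: derivative_eq_intros DERIV_std_normal_cdf simp: bernoulli_weight_def algebra_simps)
  have c: "isCont (\<lambda>v. std_normal_density v * bernoulli_weight v) v" for v
    by (intro continuous_intros isCont_std_normal_density isCont_bernoulli_weight)
  have A: "(?F \<longlongrightarrow> 0 * (1 - 0)) at_bot"
    by (intro tendsto_intros std_normal.cdf_lim_at_bot)
  have B: "(?F \<longlongrightarrow> 1 * (1 - 1)) at_top"
    by (intro tendsto_intros std_normal.cdf_lim_at_top_prob)
  note FTC = std_normal_FTC[OF D c integrable_density_bernoulli_weight A]
  show "(\<integral>v. bernoulli_weight v * indicator {..y} v \<partial>std_normal_distribution) = ?F y"
    using FTC(1)[of y] by (subst integral_std_normal) (auto simp: ac_simps)
  show "(\<integral>v. bernoulli_weight v \<partial>std_normal_distribution) = 0"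
    using FTC(2)[OF B] by (subst integral_std_normal) auto
qed

text \<open>The square of the density is a multiple of the normal density with variance
  \<open>1/2\<close>; the factor is the source of \<open>1 / sqrt pi\<close> in the limit
  variance.\<close>

lemma integral_std_normal_density_squared:
  "integrable lborel (\<lambda>v. (std_normal_density v)\<^sup>2)"
  "(\<integral>v. (std_normal_density v)\<^sup>2 \<partial>lborel) = 1 / (2 * sqrt pi)"
proof -
  have *: "(std_normal_density v)\<^sup>2 = (1 / (2 * sqrt pi)) * normal_density 0 (1 / sqrt 2) v" for v
    by (simp add: normal_density_def power_divide power_mult_distrib real_sqrt_divide power2_eq_square
        exp_add[symmetric] real_sqrt_mult)
  show "integrable lborel (\<lambda>v. (std_normal_density v)\<^sup>2)"
    unfolding * by (intro integrable_mult_right integrable_normal_density) simp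
  show "(\<integral>v. (std_normal_density v)\<^sup>2 \<partial>lborel) = 1 / (2 * sqrt pi)"
    unfolding * by (subst integral_mult_right_zero, subst integral_normal_density) auto
qed

text \<open>Integration by parts: \<open>- \<phi>\<close> times the weight vanishes at both ends,
  and its derivative is the integrand plus \<open>2 \<phi>\<^sup>2\<close>, since the weight has
  derivative \<open>- 2 \<phi>\<close>.\<close>

lemma integral_bernoulli_weight_times:
  "(\<integral>v. v * bernoulli_weight v \<partial>std_normal_distribution) = - 1 / sqrt pi"
proof -
  let ?F = "\<lambda>v. - std_normal_density v * bernoulli_weight v"
  let ?f = "\<lambda>v. std_normal_density v * (v * bernoulli_weight v) + 2 * (std_normal_density v)\<^sup>2"
  have i1: "integrable lborel (\<lambda>v. std_normal_density v * (v * bernoulli_weight v))"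
  proof (rule Bochner_Integration.integrable_bound)
    show "integrable lborel (\<lambda>v. std_normal_density v * \<bar>v\<bar>)"
      using integrable_std_normal_moment_abs[of 1] by simp
    show "AE v in lborel. norm (std_normal_density v * (v * bernoulli_weight v)) \<le> norm (std_normal_density v * \<bar>v\<bar>)"
      by (auto simp: abs_mult intro!: mult_left_mono mult_left_le abs_bernoulli_weight_le)
  qed simp
  have D: "(?F has_real_derivative ?f v) (at v)" for v
    unfolding bernoulli_weight_def
    by (auto intro!: derivative_eq_intros DERIV_std_normal_cdf DERIV_std_normal_density
        simp: algebra_simps power2_eq_square)
  have c: "isCont ?f v" for v
    by (intro continuous_intros isCont_std_normal_density isCont_bernoulli_weight)
  have A: "(?F \<longlongrightarrow> - 0 * (1 - 2 * 0)) at_bot"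
    unfolding bernoulli_weight_def
    by (intro tendsto_intros std_normal.cdf_lim_at_bot std_normal_density_at_bot)
  have B: "(?F \<longlongrightarrow> - 0 * (1 - 2 * 1)) at_top"
    unfolding bernoulli_weight_def
    by (intro tendsto_intros std_normal.cdf_lim_at_top_prob std_normal_density_at_top)
  have "(\<integral>v. ?f v \<partial>lborel) = 0"
    using std_normal_FTC(2)[OF D c _ A B] i1 integral_std_normal_density_squared(1) by simp
  then have "(\<integral>v. std_normal_density v * (v * bernoulli_weight v) \<partial>lborel) = - 2 * (1 / (2 * sqrt pi))"
    using i1 integral_std_normal_density_squared by simp
  then show ?thesis by (subst integral_std_normal) auto
qed

text \<open>For \<open>v \<le> x \<le> 0\<close> split \<open>exp (- v\<^sup>2 / 2)\<close> into two
  factors \<open>exp (- v\<^sup>2 / 4)\<close>: one is at most its value at \<open>x\<close>, the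
  other is an unnormalized density of variance 2, whence \<open>sqrt 2\<close>. Positive
  \<open>x\<close> follow by symmetry.\<close>

lemma std_normal_cdf_tail: "\<bar>std_normal_cdf x - (if 0 \<le> x then 1 else 0)\<bar> \<le> sqrt 2 * exp (- x\<^sup>2 / 4)"
proof -
  have neg: "std_normal_cdf x \<le> sqrt 2 * exp (- x\<^sup>2 / 4)" if "x \<le> 0" for x
  proof -
    have *: "std_normal_density v * indicator {..x} v \<le> sqrt 2 * exp (- x\<^sup>2 / 4) * normal_density 0 (sqrt 2) v" for v
    proof (cases "v \<le> x")
      case True
      then have "x\<^sup>2 \<le> v\<^sup>2" using that by (simp add: abs_le_square_iff[symmetric])
      have nd: "sqrt 2 * normal_density 0 (sqrt 2) v = exp (- v\<^sup>2 / 4) / sqrt (2 * pi)"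
        by (simp add: normal_density_def real_sqrt_mult field_simps)
      have "exp (- v\<^sup>2 / 2) = exp (- v\<^sup>2 / 4) * exp (- v\<^sup>2 / 4)" by (simp flip: exp_add)
      also have "\<dots> \<le> exp (- x\<^sup>2 / 4) * exp (- v\<^sup>2 / 4)"
        using \<open>x\<^sup>2 \<le> v\<^sup>2\<close> by (intro mult_right_mono) auto
      finally have "exp (- v\<^sup>2 / 2) / sqrt (2 * pi) \<le> exp (- x\<^sup>2 / 4) * exp (- v\<^sup>2 / 4) / sqrt (2 * pi)"
        by (rule divide_right_mono) simp
      also have "\<dots> = sqrt 2 * exp (- x\<^sup>2 / 4) * normal_density 0 (sqrt 2) v"
        unfolding nd[symmetric] times_divide_eq_right[symmetric] by (simp only: ac_simps)
      finally show ?thesis using True by (simp add: std_normal_density_def)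
    qed simp
    have "std_normal_cdf x = (\<integral>v. std_normal_density v * indicator {..x} v \<partial>lborel)"
      unfolding integral_std_normal_indicator[symmetric] by (subst integral_std_normal) auto
    also have "\<dots> \<le> (\<integral>v. sqrt 2 * exp (- x\<^sup>2 / 4) * normal_density 0 (sqrt 2) v \<partial>lborel)"
      by (intro integral_mono * integrable_mult_right integrable_normal_density)
         (auto intro!: integrable_real_mult_indicator)
    also have "\<dots> = sqrt 2 * exp (- x\<^sup>2 / 4)"
      by (subst integral_mult_right_zero, subst integral_normal_density) auto
    finally show ?thesis .
  qed
  show ?thesis
  proof (cases "0 \<le> x")
    case True
    then show ?thesis using neg[of "-x"] std_normal_cdf_bounds[of x] by (simp add: std_normal_cdf_minus)
  next
    case False
    then show ?thesis using neg[of x] std_normal_cdf_bounds[of x] by simp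
  qed
qed

text \<open>Induction on the coefficients with \<open>c\<close> arbitrary: half of the exponent
  absorbs the new factor \<open>x\<close>, the other half goes to the shorter polynomial.\<close>

lemma poly_times_gaussian_bounded:
  fixes p :: "real poly"
  assumes "0 < c"
  shows "\<exists>C\<ge>0. \<forall>x. \<bar>poly p x\<bar> * exp (- c * x\<^sup>2) \<le> C"
  using assms
proof (induction p arbitrary: c)
  case 0
  then show ?case by auto
next
  case (pCons a p)
  from pCons.IH[of "c/2"] pCons.prems obtain C where C: "C \<ge> 0"
    "\<And>x. \<bar>poly p x\<bar> * exp (- (c/2) * x\<^sup>2) \<le> C" by auto
  have b: "\<bar>x\<bar> * exp (- (c/2) * x\<^sup>2) \<le> 1 + 2 / c" for x
  proof -
    have "\<bar>x\<bar> \<le> 1 + x\<^sup>2" using zero_le_power2[of "\<bar>x\<bar> - 1"] by (simp add: power2_diff)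
    also have "\<dots> \<le> (1 + 2 / c) * (1 + (c/2) * x\<^sup>2)"
      using pCons.prems by (simp add: field_simps)
    also have "\<dots> \<le> (1 + 2 / c) * exp ((c/2) * x\<^sup>2)"
      using pCons.prems by (intro mult_left_mono exp_ge_add_one_self) auto
    finally show ?thesis by (simp add: exp_minus field_simps)
  qed
  have "\<bar>poly (pCons a p) x\<bar> * exp (- c * x\<^sup>2) \<le> \<bar>a\<bar> + (1 + 2 / c) * C" for x
  proof -
    have e: "exp (- c * x\<^sup>2) = exp (- (c/2) * x\<^sup>2) * exp (- (c/2) * x\<^sup>2)" by (simp flip: exp_add)
    have "\<bar>poly (pCons a p) x\<bar> * exp (- c * x\<^sup>2) \<le> (\<bar>a\<bar> + \<bar>x\<bar> * \<bar>poly p x\<bar>) * exp (- c * x\<^sup>2)"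
      by (intro mult_right_mono) (auto simp: abs_mult intro: order_trans[OF abs_triangle_ineq])
    also have "\<dots> = \<bar>a\<bar> * exp (- c * x\<^sup>2) + (\<bar>x\<bar> * exp (- (c/2) * x\<^sup>2)) * (\<bar>poly p x\<bar> * exp (- (c/2) * x\<^sup>2))"
      unfolding e by (simp add: algebra_simps)
    also have "\<dots> \<le> \<bar>a\<bar> * 1 + (1 + 2 / c) * C"
      using pCons.prems C by (intro add_mono mult_mono b mult_left_mono) auto
    finally show ?thesis by simp
  qed
  then show ?case using C pCons.prems by (intro exI[of _ "\<bar>a\<bar> + (1 + 2 / c) * C"]) auto
qed

text \<open>The density is at most a product of two copies of \<open>exp (- x\<^sup>2 / 4)\<close>.
  One absorbs the polynomials; the other survives and later makes the corrections negligible far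
  from the threshold.\<close>

lemma poly_comb_gaussian_bounded:
  fixes b :: "real poly ^ 'm"
  shows "\<exists>C\<ge>0. \<forall>v x. \<bar>poly_comb b v x * std_normal_density x\<bar> \<le> C * norm v * exp (- x\<^sup>2 / 4)"
proof -
  have "\<forall>j. \<exists>C\<ge>0. \<forall>x. \<bar>poly (b $ j) x\<bar> * exp (- (1/4) * x\<^sup>2) \<le> C"
    using poly_times_gaussian_bounded[of "1/4"] by auto
  then obtain C where C: "\<And>j. C j \<ge> 0" "\<And>j x. \<bar>poly (b $ j) x\<bar> * exp (- (1/4) * x\<^sup>2) \<le> C j"
    by metis
  have d: "std_normal_density x \<le> exp (- (1/4) * x\<^sup>2) * exp (- x\<^sup>2 / 4)" for x
  proof -
    have "1 \<le> sqrt (2 * pi)" using pi_gt3 by (simp add: real_le_rsqrt)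
    then have "std_normal_density x \<le> exp (- x\<^sup>2 / 2)"
      by (simp add: std_normal_density_def divide_le_eq)
    also have "\<dots> = exp (- (1/4) * x\<^sup>2) * exp (- x\<^sup>2 / 4)" by (simp flip: exp_add)
    finally show ?thesis .
  qed
  have "\<bar>poly_comb b v x * std_normal_density x\<bar> \<le> (\<Sum>j\<in>UNIV. C j) * norm v * exp (- x\<^sup>2 / 4)" for v x
  proof -
    have "\<bar>poly_comb b v x * std_normal_density x\<bar> \<le> (\<Sum>j\<in>UNIV. \<bar>poly (b $ j) x * v $ j\<bar>) * std_normal_density x"
      unfolding abs_mult[of "poly_comb b v x"] unfolding poly_comb_def
      by (intro mult_mono) auto
    also have "\<dots> \<le> (\<Sum>j\<in>UNIV. \<bar>poly (b $ j) x * v $ j\<bar>) * (exp (- (1/4) * x\<^sup>2) * exp (- x\<^sup>2 / 4))"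
      by (intro mult_left_mono d sum_nonneg) auto
    also have "\<dots> = (\<Sum>j\<in>UNIV. (\<bar>poly (b $ j) x\<bar> * exp (- (1/4) * x\<^sup>2)) * \<bar>v $ j\<bar>) * exp (- x\<^sup>2 / 4)"
      by (simp add: sum_distrib_left abs_mult ac_simps)
    also have "\<dots> \<le> (\<Sum>j\<in>UNIV. C j * norm v) * exp (- x\<^sup>2 / 4)"
      by (intro mult_right_mono sum_mono mult_mono C component_le_norm_cart) auto
    finally show ?thesis by (simp add: sum_distrib_right)
  qed
  then show ?thesis using C(1) by (intro exI[of _ "\<Sum>j\<in>UNIV. C j"]) (auto intro: sum_nonneg)
qed

lemma norm_kronecker_le: "norm (kronecker u v) \<le> real (CARD('m) * CARD('n)) * norm u * norm v"
  for u :: "real^'m" and v :: "real^'n"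
proof -
  have "norm (kronecker u v) \<le> (\<Sum>p\<in>UNIV. \<bar>kronecker u v $ p\<bar>)" by (rule norm_le_l1_cart)
  also have "\<dots> \<le> (\<Sum>p\<in>(UNIV::('m\<times>'n) set). norm u * norm v)"
    by (intro sum_mono) (auto simp: kronecker_def abs_mult intro!: mult_mono component_le_norm_cart)
  finally show ?thesis by (simp add: ac_simps)
qed

text \<open>The terms of order \<open>1 / T\<close> are merged into those of order
  \<open>1 / sqrt T\<close>. Keeping the Gaussian factor is essential: a correction of order
  \<open>1 / sqrt T\<close> for each of the \<open>N\<close> units would add up to
  \<open>L\<^sup>2\<close>, far more than \<open>L\<close>.\<close>

lemma edgeworth_minus_normal:
  fixes b1 :: "real poly ^ 'm" and b2 :: "real poly ^ 'q" and b3 :: "real poly ^ ('m \<times> 'm)"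
  assumes "0 \<le> B"
  shows "\<exists>C\<ge>0. \<forall>c3 c4 T x. norm c3 \<le> B \<longrightarrow> norm c4 \<le> B \<longrightarrow> 1 \<le> T \<longrightarrow>
           \<bar>edgeworth b1 b2 b3 c3 c4 T x - std_normal_cdf x\<bar> \<le> C * exp (- x\<^sup>2 / 4) / sqrt (real T)"
proof -
  obtain C1 C2 C3 where C: "C1 \<ge> 0" "C2 \<ge> 0" "C3 \<ge> 0"
    "\<And>v x. \<bar>poly_comb b1 v x * std_normal_density x\<bar> \<le> C1 * norm v * exp (- x\<^sup>2 / 4)"
    "\<And>v x. \<bar>poly_comb b2 v x * std_normal_density x\<bar> \<le> C2 * norm v * exp (- x\<^sup>2 / 4)"
    "\<And>v x. \<bar>poly_comb b3 v x * std_normal_density x\<bar> \<le> C3 * norm v * exp (- x\<^sup>2 / 4)"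
    using poly_comb_gaussian_bounded[of b1] poly_comb_gaussian_bounded[of b2] poly_comb_gaussian_bounded[of b3]
    by blast
  define K where "K = real (CARD('m) * CARD('m)) * B * B"
  have "\<bar>edgeworth b1 b2 b3 c3 c4 T x - std_normal_cdf x\<bar>
          \<le> (C1 * B + C2 * B + C3 * K) * exp (- x\<^sup>2 / 4) / sqrt (real T)"
    if n: "norm c3 \<le> B" "norm c4 \<le> B" and T: "1 \<le> T" for c3 :: "real^'m" and c4 :: "real^'q" and T x
  proof -
    have k: "norm (kronecker c3 c3) \<le> K"
      unfolding K_def using n assms
      by (intro order_trans[OF norm_kronecker_le] mult_mono) auto
    have sT: "0 < sqrt (real T)" "sqrt (real T) \<le> real T"
      using T by (auto intro!: real_le_lsqrt simp: power2_eq_square)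
    let ?E = "exp (- x\<^sup>2 / 4)"
    have t1: "\<bar>poly_comb b1 c3 x * std_normal_density x / sqrt (real T)\<bar> \<le> C1 * B * ?E / sqrt (real T)"
      unfolding abs_divide abs_of_pos[OF sT(1)] using C n
      by (intro divide_right_mono order_trans[OF C(4)] mult_right_mono mult_left_mono) auto
    have t2: "\<bar>poly_comb b2 c4 x * std_normal_density x\<bar> \<le> C2 * B * ?E"
      using C n by (intro order_trans[OF C(5)] mult_right_mono mult_left_mono) auto
    have t3: "\<bar>poly_comb b3 (kronecker c3 c3) x * std_normal_density x\<bar> \<le> C3 * K * ?E"
      using C k by (intro order_trans[OF C(6)] mult_right_mono mult_left_mono) auto
    have nn: "0 \<le> C2 * B * ?E + C3 * K * ?E"
      using C assms by (auto simp: K_def)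
    have "\<bar>(poly_comb b2 c4 x + poly_comb b3 (kronecker c3 c3) x) * std_normal_density x / real T\<bar>
            \<le> (C2 * B * ?E + C3 * K * ?E) / real T"
      unfolding abs_divide using t2 t3 by (simp add: distrib_right divide_right_mono)
    also have "\<dots> \<le> (C2 * B * ?E + C3 * K * ?E) / sqrt (real T)"
      using nn sT by (intro divide_left_mono) auto
    finally have t23: "\<bar>(poly_comb b2 c4 x + poly_comb b3 (kronecker c3 c3) x) * std_normal_density x / real T\<bar>
      \<le> (C2 * B * ?E + C3 * K * ?E) / sqrt (real T)" .
    have "\<bar>edgeworth b1 b2 b3 c3 c4 T x - std_normal_cdf x\<bar>
        \<le> C1 * B * ?E / sqrt (real T) + (C2 * B * ?E + C3 * K * ?E) / sqrt (real T)"
      using t1 t23 unfolding edgeworth_def by linarith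
    also have "\<dots> = (C1 * B + C2 * B + C3 * K) * ?E / sqrt (real T)"
      by (simp add: distrib_right add_divide_distrib)
    finally show ?thesis .
  qed
  moreover have "0 \<le> C1 * B + C2 * B + C3 * K" using C assms by (auto simp: K_def)
  ultimately show ?thesis by blast
qed

text \<open>By \<open>sqrt (2 * pi) \<ge> 2\<close> and
  \<open>exp (z\<^sup>2 / 2) \<ge> 1 + z\<^sup>2 / 2\<close>, the reciprocal of the density is at
  least \<open>2 + z\<^sup>2\<close>.\<close>

lemma std_normal_density_moment_bounds:
  "std_normal_density z * z\<^sup>2 \<le> 1" "std_normal_density z * \<bar>z\<bar> \<le> 1"
proof -
  have s: "2 \<le> sqrt (2 * pi)" using pi_gt3 by (intro real_le_rsqrt) simp
  have e: "1 + z\<^sup>2 / 2 \<le> exp (z\<^sup>2 / 2)" by (rule exp_ge_add_one_self)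
  have "2 * exp (z\<^sup>2 / 2) \<le> sqrt (2 * pi) * exp (z\<^sup>2 / 2)" using s by (intro mult_right_mono) auto
  then have g: "2 + z\<^sup>2 \<le> sqrt (2 * pi) * exp (z\<^sup>2 / 2)" using e by linarith
  have d: "std_normal_density z = 1 / (sqrt (2 * pi) * exp (z\<^sup>2 / 2))"
    by (simp add: std_normal_density_def exp_minus field_simps)
  have p: "0 < sqrt (2 * pi) * exp (z\<^sup>2 / 2)" by simp
  show "std_normal_density z * z\<^sup>2 \<le> 1" using g p unfolding d by (simp add: divide_le_eq del: real_sqrt_mult)
  have "\<bar>z\<bar> \<le> 2 + z\<^sup>2" using zero_le_power2[of "\<bar>z\<bar> - 1"] by (simp add: power2_diff)
  then show "std_normal_density z * \<bar>z\<bar> \<le> 1" using g p unfolding d by (simp add: divide_le_eq)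
qed

text \<open>The scales may differ by an amount that grows with \<open>\<bar>d\<bar>\<close>, yet the
  bound is uniform in \<open>d\<close>: both arguments have the same sign and modulus at least
  \<open>t * \<bar>d\<bar> / B\<close>, so the intermediate point \<open>z\<close> has that modulus
  too, and the density at \<open>z\<close> absorbs the quadratic growth of the difference of the
  arguments.\<close>

lemma std_normal_cdf_rescale:
  assumes s: "0 < c" "c \<le> s1" "s1 \<le> B" "c \<le> s2" "s2 \<le> B" and t: "0 < t"
    and L: "0 \<le> L" "0 \<le> \<rho>" "\<bar>s1 - s2\<bar> \<le> L * (\<bar>d\<bar> + \<rho> / t)"
  shows "\<bar>std_normal_cdf (t * d / s1) - std_normal_cdf (t * d / s2)\<bar> \<le> L * (B\<^sup>2 + \<rho> * B) / c\<^sup>2 / t"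
proof -
  define w where "w = t * \<bar>d\<bar>"
  have w: "0 \<le> w" using t by (simp add: w_def)
  have mvt: "\<exists>z. \<bar>std_normal_cdf y1 - std_normal_cdf y2\<bar> = std_normal_density z * \<bar>y1 - y2\<bar>
          \<and> w / B \<le> \<bar>z\<bar>"
    if y: "w / B \<le> \<bar>y1\<bar>" "w / B \<le> \<bar>y2\<bar>" "0 \<le> y1 * y2" for y1 y2
  proof -
    have *: "\<exists>z. \<bar>std_normal_cdf y1 - std_normal_cdf y2\<bar> = std_normal_density z * \<bar>y1 - y2\<bar> \<and> w / B \<le> \<bar>z\<bar>"
      if y: "w / B \<le> \<bar>y1\<bar>" "w / B \<le> \<bar>y2\<bar>" "0 \<le> y1 * y2" and less: "y1 < y2" for y1 y2
    proof -
      obtain z where z: "y1 < z" "z < y2" "std_normal_cdf y2 - std_normal_cdf y1 = (y2 - y1) * std_normal_density z"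
        using MVT2[OF less, of std_normal_cdf std_normal_density] DERIV_std_normal_cdf by blast
      have "\<bar>std_normal_cdf y1 - std_normal_cdf y2\<bar> = \<bar>(y2 - y1) * std_normal_density z\<bar>"
        unfolding z(3)[symmetric] by (rule abs_minus_commute)
      also have "\<dots> = std_normal_density z * \<bar>y1 - y2\<bar>" using less by (simp add: abs_mult)
      finally have 1: "\<bar>std_normal_cdf y1 - std_normal_cdf y2\<bar> = std_normal_density z * \<bar>y1 - y2\<bar>" .
      have "0 \<le> y1 \<or> y2 \<le> 0" using y(3) less by (auto simp: zero_le_mult_iff)
      then have "w / B \<le> \<bar>z\<bar>" using y(1,2) z(1,2) by linarith
      with 1 show ?thesis by blast
    qed
    show ?thesis
    proof (cases y1 y2 rule: linorder_cases)
      case equal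
      then show ?thesis using y by (intro exI[of _ y1]) auto
    next
      case less
      then show ?thesis using *[OF y less] by simp
    next
      case greater
      then show ?thesis using *[OF y(2,1) _ greater] y(3) by (simp add: abs_minus_commute mult.commute)
    qed
  qed
  have pos: "0 < s1" "0 < s2" "0 < B" using s by linarith+
  have "w / B \<le> \<bar>t * d / s1\<bar>" "w / B \<le> \<bar>t * d / s2\<bar>" "0 \<le> (t * d / s1) * (t * d / s2)"
    using s t pos by (auto simp: w_def abs_mult abs_divide zero_le_mult_iff zero_le_divide_iff intro!: divide_left_mono)
  from mvt[OF this] obtain z where
    z: "\<bar>std_normal_cdf (t * d / s1) - std_normal_cdf (t * d / s2)\<bar> = std_normal_density z * \<bar>t * d / s1 - t * d / s2\<bar>"
      "w / B \<le> \<bar>z\<bar>" by blast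
  have wz: "w \<le> B * \<bar>z\<bar>" using z(2) pos by (simp add: divide_le_eq mult.commute)
  have "t * d / s1 - t * d / s2 = (t * d) * (s2 - s1) / (s1 * s2)"
    using pos by (simp add: field_simps)
  then have "\<bar>t * d / s1 - t * d / s2\<bar> = w * \<bar>s1 - s2\<bar> / (s1 * s2)"
    using pos t by (simp add: abs_mult abs_divide w_def abs_minus_commute)
  also have "\<dots> \<le> w * (L * (\<bar>d\<bar> + \<rho> / t)) / c\<^sup>2"
    using s pos L w unfolding power2_eq_square
    by (intro frac_le mult_left_mono mult_mono mult_nonneg_nonneg) (use t in auto)
  also have "w * (L * (\<bar>d\<bar> + \<rho> / t)) / c\<^sup>2 = L / c\<^sup>2 / t * (w * w + \<rho> * w)"
    using t s by (simp add: w_def field_simps)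
  also have "\<dots> \<le> L / c\<^sup>2 / t * (B\<^sup>2 * z\<^sup>2 + \<rho> * (B * \<bar>z\<bar>))"
  proof (intro mult_left_mono add_mono)
    have "w * w \<le> (B * \<bar>z\<bar>) * (B * \<bar>z\<bar>)" using wz w by (intro mult_mono) auto
    then show "w * w \<le> B\<^sup>2 * z\<^sup>2" by (simp add: power2_eq_square algebra_simps)
  qed (use wz L t s in auto)
  finally have "\<bar>t * d / s1 - t * d / s2\<bar> \<le> L / c\<^sup>2 / t * (B\<^sup>2 * z\<^sup>2 + \<rho> * (B * \<bar>z\<bar>))" .
  then have "\<bar>std_normal_cdf (t * d / s1) - std_normal_cdf (t * d / s2)\<bar>
     \<le> std_normal_density z * (L / c\<^sup>2 / t * (B\<^sup>2 * z\<^sup>2 + \<rho> * (B * \<bar>z\<bar>)))"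
    unfolding z(1) by (intro mult_left_mono) auto
  also have "\<dots> = L / c\<^sup>2 / t * (B\<^sup>2 * (std_normal_density z * z\<^sup>2) + \<rho> * B * (std_normal_density z * \<bar>z\<bar>))"
    by (simp add: algebra_simps)
  also have "\<dots> \<le> L / c\<^sup>2 / t * (B\<^sup>2 * 1 + \<rho> * B * 1)"
    using L t pos by (intro mult_left_mono add_mono std_normal_density_moment_bounds) auto
  finally show ?thesis by (simp add: ac_simps)
qed

text \<open>Interchanging sum and integral turns \<open>\<Sum>\<^sub>i 1{v \<le> s (x - a\<^sub>i)}\<close> into the empirical distribution function at
  \<open>x - v / s\<close>, whose quadratic expansion is then integrated.\<close>

lemma sum_smoothed_empirical_cdf:
  fixes a :: "nat \<Rightarrow> real" and g :: "real \<Rightarrow> real"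
  assumes N: "0 < N" and s: "0 < s" and g [measurable]: "g \<in> borel_measurable borel" "\<And>v. \<bar>g v\<bar> \<le> 1"
    and C: "0 \<le> C" and F: "\<And>y. \<bar>empirical_cdf N a y - p - f * (y - m)\<bar> \<le> C * ((y - m)\<^sup>2 + 1 / real N)"
  shows "\<bar>(\<Sum>i<N. \<integral>v. g v * indicator {..s * (x - a i)} v \<partial>std_normal_distribution)
           - real N * ((p + f * (x - m)) * (\<integral>v. g v \<partial>std_normal_distribution)
               - f / s * (\<integral>v. v * g v \<partial>std_normal_distribution))\<bar>
         \<le> C * (2 * real N * (x - m)\<^sup>2 + 2 * real N / s\<^sup>2 + 1)"
proof -
  let ?P = std_normal_distribution
  have ig [simp]: "integrable ?P g"
    by (rule std_normal.integrable_const_bound[of _ 1]) (use g in auto)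
  have iv: "integrable ?P (\<lambda>v. v)" "integrable ?P (\<lambda>v. v\<^sup>2)"
    using integrable_std_normal_distribution_moment[of 1] integrable_std_normal_distribution_moment[of 2] by auto
  have vg: "integrable ?P (\<lambda>v. v * g v)"
    by (rule Bochner_Integration.integrable_bound[OF iv(1)])
       (use g in \<open>auto simp: abs_mult intro!: mult_left_le\<close>)
  have v2: "(\<integral>v. v\<^sup>2 \<partial>?P) = 1"
    using std_normal_distribution_even_moments(1)[of 1] by simp
  have em [measurable]: "empirical_cdf N a \<in> borel_measurable borel"
    unfolding empirical_cdf_def by measurable
  have iind: "integrable ?P (\<lambda>v. g v * indicator {..y} v)" for y
    by (intro integrable_real_mult_indicator) auto
  have ie: "integrable ?P (\<lambda>v. g v * empirical_cdf N a (x - v / s))"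
    by (rule Bochner_Integration.integrable_bound[OF ig])
       (auto simp: abs_mult empirical_cdf_nonneg empirical_cdf_le_1 intro!: mult_left_le)
  have "(\<Sum>i<N. \<integral>v. g v * indicator {..s * (x - a i)} v \<partial>?P)
        = (\<integral>v. (\<Sum>i<N. g v * indicator {..s * (x - a i)} v) \<partial>?P)"
    by (rule Bochner_Integration.integral_sum[symmetric]) (rule iind)
  also have "\<dots> = (\<integral>v. real N * (g v * empirical_cdf N a (x - v / s)) \<partial>?P)"
  proof (rule Bochner_Integration.integral_cong)
    fix v
    have "indicator {..s * (x - a i)} v = (if a i \<le> x - v / s then 1 else 0 :: real)" for i
      using s by (auto simp: indicator_def field_simps)
    then show "(\<Sum>i<N. g v * indicator {..s * (x - a i)} v) = real N * (g v * empirical_cdf N a (x - v / s))"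
      using N by (simp add: empirical_cdf_def sum_distrib_left[symmetric])
  qed simp
  also have "\<dots> = real N * (\<integral>v. g v * empirical_cdf N a (x - v / s) \<partial>?P)" by simp
  finally have S: "(\<Sum>i<N. \<integral>v. g v * indicator {..s * (x - a i)} v \<partial>?P)
      = real N * (\<integral>v. g v * empirical_cdf N a (x - v / s) \<partial>?P)" .
  have L: "(p + f * (x - m)) * (\<integral>v. g v \<partial>?P) - f / s * (\<integral>v. v * g v \<partial>?P)
      = (\<integral>v. g v * (p + f * (x - v / s - m)) \<partial>?P)"
  proof -
    have "(\<integral>v. g v * (p + f * (x - v / s - m)) \<partial>?P)
        = (\<integral>v. (p + f * (x - m)) * g v - f / s * (v * g v) \<partial>?P)"
      by (intro Bochner_Integration.integral_cong) (auto simp: algebra_simps)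
    then show ?thesis using ig vg by simp
  qed
  have il: "integrable ?P (\<lambda>v. g v * (p + f * (x - v / s - m)))"
  proof -
    have "integrable ?P (\<lambda>v. (p + f * (x - m)) * g v - f / s * (v * g v))"
      using ig vg by simp
    then show ?thesis by (rule Bochner_Integration.integrable_cong[THEN iffD1, rotated -1]) (auto simp: algebra_simps)
  qed
  have ib: "integrable ?P (\<lambda>v. C * (2 * (x - m)\<^sup>2 + 2 / s\<^sup>2 * v\<^sup>2 + 1 / real N))"
    using iv by auto
  have "\<bar>(\<integral>v. g v * empirical_cdf N a (x - v / s) \<partial>?P) - (\<integral>v. g v * (p + f * (x - v / s - m)) \<partial>?P)\<bar>
      = \<bar>\<integral>v. g v * empirical_cdf N a (x - v / s) - g v * (p + f * (x - v / s - m)) \<partial>?P\<bar>"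
    using ie il by simp
  also have "\<dots> \<le> (\<integral>v. C * (2 * (x - m)\<^sup>2 + 2 / s\<^sup>2 * v\<^sup>2 + 1 / real N) \<partial>?P)"
  proof (rule order_trans[OF integral_abs_bound integral_mono])
    fix v
    have "\<bar>g v * empirical_cdf N a (x - v / s) - g v * (p + f * (x - v / s - m))\<bar>
        = \<bar>g v\<bar> * \<bar>empirical_cdf N a (x - v / s) - p - f * (x - v / s - m)\<bar>"
      unfolding abs_mult[symmetric] by (simp add: algebra_simps)
    also have "\<dots> \<le> 1 * \<bar>empirical_cdf N a (x - v / s) - p - f * (x - v / s - m)\<bar>"
      using g by (intro mult_right_mono) auto
    also have "\<dots> \<le> C * ((x - v / s - m)\<^sup>2 + 1 / real N)" using F by simp
    also have "\<dots> \<le> C * (2 * (x - m)\<^sup>2 + 2 / s\<^sup>2 * v\<^sup>2 + 1 / real N)"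
    proof -
      have "(A - B)\<^sup>2 \<le> 2 * A\<^sup>2 + 2 * B\<^sup>2" for A B :: real
        using zero_le_power2[of "A + B"] by (simp add: power2_eq_square algebra_simps)
      from this[of "x - m" "v / s"] have "(x - v / s - m)\<^sup>2 \<le> 2 * (x - m)\<^sup>2 + 2 * (v / s)\<^sup>2"
        by (simp add: algebra_simps)
      then show ?thesis using C by (intro mult_left_mono) (auto simp: power_divide)
    qed
    finally show "\<bar>g v * empirical_cdf N a (x - v / s) - g v * (p + f * (x - v / s - m))\<bar>
      \<le> C * (2 * (x - m)\<^sup>2 + 2 / s\<^sup>2 * v\<^sup>2 + 1 / real N)" .
  qed (use ie il ib in auto)
  also have "\<dots> = C * (2 * (x - m)\<^sup>2 + 2 / s\<^sup>2 + 1 / real N)"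
    using iv v2 std_normal.prob_space by simp
  finally have "real N * \<bar>(\<integral>v. g v * empirical_cdf N a (x - v / s) \<partial>?P) - (\<integral>v. g v * (p + f * (x - v / s - m)) \<partial>?P)\<bar>
     \<le> real N * (C * (2 * (x - m)\<^sup>2 + 2 / s\<^sup>2 + 1 / real N))"
    by (intro mult_left_mono) auto
  also have "\<dots> = C * (2 * real N * (x - m)\<^sup>2 + 2 * real N / s\<^sup>2 + 1)"
    using N by (simp add: field_simps)
  finally show ?thesis
    unfolding S L by (simp add: abs_mult right_diff_distrib[symmetric] del: abs_diff_le_iff)
qed

section \<open>A uniform central limit theorem for indicators\<close>

lemma exp_minus_linear_bound:
  assumes "0 \<le> (x::real)"
  shows "\<bar>exp (- x) - (1 - x)\<bar> \<le> x\<^sup>2"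
proof -
  have "1 - x \<le> exp (- x)" using exp_ge_add_one_self[of "- x"] by simp
  moreover have "exp (- x) \<le> 1 / (1 + x)"
    using exp_ge_add_one_self[of x] assms by (simp add: exp_minus inverse_eq_divide frac_le)
  moreover have "1 / (1 + x) \<le> 1 - x + x\<^sup>2"
  proof -
    have "1 \<le> (1 - x + x\<^sup>2) * (1 + x)" using assms by (simp add: power2_eq_square algebra_simps)
    then show ?thesis using assms by (simp add: pos_divide_le_eq)
  qed
  ultimately show ?thesis by linarith
qed

context prob_space
begin

definition indep_trials :: "nat \<Rightarrow> (nat \<Rightarrow> 'a \<Rightarrow> real) \<Rightarrow> bool" where
  "indep_trials N X \<longleftrightarrow> indep_vars (\<lambda>_. borel) X {..<N} \<and> (\<forall>i<N. \<forall>\<omega>\<in>space M. X i \<omega> = 0 \<or> X i \<omega> = 1)"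

definition trials_mean :: "nat \<Rightarrow> (nat \<Rightarrow> 'a \<Rightarrow> real) \<Rightarrow> real" where
  "trials_mean N X = (\<Sum>i<N. expectation (X i))"

definition trials_variance :: "nat \<Rightarrow> (nat \<Rightarrow> 'a \<Rightarrow> real) \<Rightarrow> real" where
  "trials_variance N X = (\<Sum>i<N. expectation (X i) * (1 - expectation (X i)))"

text \<open>Factor by factor comparison with Gaussian characteristic functions of variance
  \<open>s i\<close>. Since \<open>\<bar>Y i \<omega>\<bar> \<le> 1 / sqrt v\<close>, absolute third
  moments are at most \<open>s i / sqrt v\<close>, and the \<open>s i\<close> sum to 1. The bound
  thus depends on the trials only through their variance, which is what makes uniformity
  possible.\<close>

lemma char_standardized_trials:
  assumes X: "indep_trials N X" and v: "0 < trials_variance N X"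
  shows "cmod (char (distr M borel (\<lambda>\<omega>. ((\<Sum>i<N. X i \<omega>) - trials_mean N X) / sqrt (trials_variance N X))) t
            - exp (- t\<^sup>2 / 2))
         \<le> \<bar>t\<bar> ^ 3 / (6 * sqrt (trials_variance N X)) + t ^ 4 / (4 * trials_variance N X)"
proof -
  define v where "v = trials_variance N X"
  define p where "p i = expectation (X i)" for i
  define Y where "Y i \<omega> = (X i \<omega> - p i) / sqrt v" for i \<omega>
  define s where "s i = p i * (1 - p i) / v" for i
  have v0: "0 < v" "0 < sqrt v" using v by (auto simp: v_def)
  have ind: "indep_vars (\<lambda>_. borel) X {..<N}" and 01: "\<And>i \<omega>. i < N \<Longrightarrow> \<omega> \<in> space M \<Longrightarrow> X i \<omega> = 0 \<or> X i \<omega> = 1"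
    using X by (auto simp: indep_trials_def)
  have rv [measurable]: "random_variable borel (X i)" if "i < N" for i
    using ind that by (auto simp: indep_vars_def2)
  have int: "integrable M (X i)" if "i < N" for i
    by (rule integrable_const_bound[of _ 1]) (use 01 that rv in force)+
  have p01: "0 \<le> p i" "p i \<le> 1" if "i < N" for i
  proof -
    show "0 \<le> p i" unfolding p_def by (intro Bochner_Integration.integral_nonneg) (use 01[OF that] in force)
    have "p i \<le> expectation (\<lambda>_. 1)" unfolding p_def
      by (intro integral_mono int that) (use 01[OF that] in force)+
    then show "p i \<le> 1" by (simp add: prob_space)
  qed
  have var: "expectation (\<lambda>\<omega>. (X i \<omega> - p i)\<^sup>2) = p i * (1 - p i)" if "i < N" for i
  proof -
    have "expectation (\<lambda>\<omega>. (X i \<omega> - p i)\<^sup>2) = expectation (\<lambda>\<omega>. X i \<omega> * (1 - 2 * p i) + (p i)\<^sup>2)"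
      by (intro Bochner_Integration.integral_cong refl)
         (use 01[OF that] in \<open>force simp: power2_eq_square algebra_simps\<close>)
    also have "\<dots> = p i * (1 - 2 * p i) + (p i)\<^sup>2"
      using int[OF that] by (simp add: prob_space p_def)
    finally show ?thesis by (simp add: power2_eq_square algebra_simps)
  qed
  have Yrv [measurable]: "random_variable borel (Y i)" if "i < N" for i
    unfolding Y_def using rv[OF that] by measurable
  have Yb: "\<bar>Y i \<omega>\<bar> \<le> 1 / sqrt v" if "i < N" "\<omega> \<in> space M" for i \<omega>
  proof -
    have "\<bar>X i \<omega> - p i\<bar> \<le> 1" using 01[OF that] p01[OF that(1)] by auto
    then show ?thesis using v0 by (simp add: Y_def abs_divide divide_right_mono)
  qed
  have Yint: "integrable M (Y i)" "integrable M (\<lambda>\<omega>. (Y i \<omega>)\<^sup>2)" if "i < N" for i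
  proof -
    show "integrable M (Y i)"
      by (rule integrable_const_bound[of _ "1 / sqrt v"]) (use Yb that Yrv in auto)
    have sq: "(Y i \<omega>)\<^sup>2 \<le> (1 / sqrt v)\<^sup>2" if "\<omega> \<in> space M" for \<omega>
      using power_mono[OF Yb[OF \<open>i < N\<close> that], of 2] by simp
    show "integrable M (\<lambda>\<omega>. (Y i \<omega>)\<^sup>2)"
      by (rule integrable_const_bound[of _ "(1 / sqrt v)\<^sup>2"]) (use sq that Yrv in auto)
  qed
  have Y0: "expectation (Y i) = 0" if "i < N" for i
    unfolding Y_def using int[OF that] by (simp add: prob_space p_def)
  have Yvar: "expectation (\<lambda>\<omega>. (Y i \<omega>)\<^sup>2) = s i" if "i < N" for i
    using var[OF that] v0 by (simp add: Y_def s_def power_divide)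
  have sb: "0 \<le> s i" "s i \<le> 1 / v" if "i < N" for i
  proof -
    show "0 \<le> s i" using p01[OF that] v0 by (simp add: s_def)
    have "p i * (1 - p i) \<le> 1 * 1" using p01[OF that] by (intro mult_mono) auto
    then show "s i \<le> 1 / v" using v0 unfolding s_def by (intro divide_right_mono) auto
  qed
  have ssum: "(\<Sum>i<N. s i) = 1"
    using v0 by (simp add: s_def sum_divide_distrib[symmetric] v_def trials_variance_def p_def)
  define x where "x i = t\<^sup>2 * s i / 2" for i
  have x0: "0 \<le> x i" if "i < N" for i using sb[OF that] by (simp add: x_def)
  have c1: "cmod (char (distr M borel (Y i)) t - (1 - x i)) \<le> \<bar>t\<bar> ^ 3 / (6 * sqrt v) * s i" if i: "i < N" for i
  proof -
    have "cmod (char (distr M borel (Y i)) t - (1 - t\<^sup>2 * s i / 2))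
        \<le> (t\<^sup>2 / 6) * expectation (\<lambda>\<omega>. min (6 * (Y i \<omega>)\<^sup>2) (\<bar>t\<bar> * \<bar>Y i \<omega>\<bar> ^ 3))"
      using char_approx3'[of "Y i" "s i" "distr M borel (Y i)" t] Yrv[OF i] Yint[OF i] Y0[OF i] Yvar[OF i]
      by simp
    also have "\<dots> \<le> (t\<^sup>2 / 6) * expectation (\<lambda>\<omega>. (\<bar>t\<bar> / sqrt v) * (Y i \<omega>)\<^sup>2)"
    proof (intro mult_left_mono integral_mono)
      show "integrable M (\<lambda>\<omega>. min (6 * (Y i \<omega>)\<^sup>2) (\<bar>t\<bar> * \<bar>Y i \<omega>\<bar> ^ 3))"
        by (rule Bochner_Integration.integrable_bound[of _ "\<lambda>\<omega>. 6 * (Y i \<omega>)\<^sup>2"])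
           (use Yint[OF i] Yrv[OF i] in auto)
      show "integrable M (\<lambda>\<omega>. (\<bar>t\<bar> / sqrt v) * (Y i \<omega>)\<^sup>2)" using Yint[OF i] by simp
      fix \<omega> assume w: "\<omega> \<in> space M"
      have "\<bar>t\<bar> * \<bar>Y i \<omega>\<bar> ^ 3 = \<bar>t\<bar> * (\<bar>Y i \<omega>\<bar> * (Y i \<omega>)\<^sup>2)"
        by (simp add: power3_eq_cube power2_eq_square)
      also have "\<dots> \<le> \<bar>t\<bar> * ((1 / sqrt v) * (Y i \<omega>)\<^sup>2)"
        by (intro mult_left_mono mult_right_mono Yb i w) auto
      finally show "min (6 * (Y i \<omega>)\<^sup>2) (\<bar>t\<bar> * \<bar>Y i \<omega>\<bar> ^ 3) \<le> (\<bar>t\<bar> / sqrt v) * (Y i \<omega>)\<^sup>2" by simp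
    qed auto
    also have "\<dots> = \<bar>t\<bar> ^ 3 / (6 * sqrt v) * s i"
    proof -
      have "\<bar>t\<bar> ^ 3 = \<bar>t\<bar> * \<bar>t\<bar>\<^sup>2" by (simp only: power3_eq_cube power2_eq_square mult.assoc)
      then show ?thesis using Yvar[OF i] by simp
    qed
    finally show ?thesis by (simp add: x_def)
  qed
  have c2: "cmod ((1 - x i) - exp (- complex_of_real (x i))) \<le> t ^ 4 / (4 * v) * s i" if i: "i < N" for i
  proof -
    have "cmod ((1 - x i) - exp (- complex_of_real (x i))) = \<bar>exp (- x i) - (1 - x i)\<bar>"
    proof -
      have "(1 - x i) - exp (- complex_of_real (x i)) = complex_of_real ((1 - x i) - exp (- x i))"
        by (simp add: exp_of_real[symmetric])
      then show ?thesis by (simp only: norm_of_real abs_minus_commute)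
    qed
    also have "\<dots> \<le> x i * x i" using exp_minus_linear_bound[OF x0[OF i]] by (simp add: power2_eq_square)
    also have "\<dots> \<le> (t\<^sup>2 / 2 * (1 / v)) * x i"
    proof (rule mult_right_mono)
      have "t\<^sup>2 / 2 * s i \<le> t\<^sup>2 / 2 * (1 / v)" using sb[OF i] by (intro mult_left_mono) auto
      then show "x i \<le> t\<^sup>2 / 2 * (1 / v)" by (simp add: x_def)
    qed (rule x0[OF i])
    also have "\<dots> = t ^ 4 / (4 * v) * s i"
      by (simp add: x_def power2_eq_square power4_eq_xxxx)
    finally show ?thesis .
  qed
  have "char (distr M borel (\<lambda>\<omega>. ((\<Sum>i<N. X i \<omega>) - trials_mean N X) / sqrt v)) t
      = char (distr M borel (\<lambda>\<omega>. \<Sum>i<N. Y i \<omega>)) t"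
    by (simp add: Y_def sum_divide_distrib[symmetric] sum_subtractf trials_mean_def p_def)
  also have "\<dots> = (\<Prod>i<N. char (distr M borel (Y i)) t)"
    unfolding Y_def[abs_def] by (intro char_distr_sum indep_vars_compose2[OF ind]) auto
  finally have eq1: "char (distr M borel (\<lambda>\<omega>. ((\<Sum>i<N. X i \<omega>) - trials_mean N X) / sqrt v)) t
      = (\<Prod>i<N. char (distr M borel (Y i)) t)" .
  have eq2: "complex_of_real (exp (- t\<^sup>2 / 2)) = (\<Prod>i<N. exp (- complex_of_real (x i)))"
  proof -
    have "(\<Sum>i<N. x i) = t\<^sup>2 / 2"
      using ssum unfolding x_def by (simp add: sum_divide_distrib[symmetric] sum_distrib_left[symmetric])
    then have "complex_of_real (\<Sum>i<N. - x i) = complex_of_real (- t\<^sup>2 / 2)"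
      by (simp only: sum_negf minus_divide_left)
    then have s: "(\<Sum>i<N. - complex_of_real (x i)) = complex_of_real (- t\<^sup>2 / 2)"
      by (simp only: of_real_sum of_real_minus)
    show ?thesis unfolding exp_sum[OF finite_lessThan, symmetric] s by (rule exp_of_real[symmetric])
  qed
  have "cmod ((\<Prod>i<N. char (distr M borel (Y i)) t) - (\<Prod>i<N. exp (- complex_of_real (x i))))
      \<le> (\<Sum>i<N. cmod (char (distr M borel (Y i)) t - exp (- complex_of_real (x i))))"
  proof (rule norm_prod_diff)
    fix i assume "i \<in> {..<N}"
    then have i: "i < N" by simp
    interpret D: real_distribution "distr M borel (Y i)" using Yrv[OF i] by (rule real_distribution_distr)
    show "cmod (char (distr M borel (Y i)) t) \<le> 1" by (rule D.cmod_char_le_1)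
    show "cmod (exp (- complex_of_real (x i))) \<le> 1" using x0[OF i] by (simp add: norm_exp_eq_Re)
  qed
  also have "\<dots> \<le> (\<Sum>i<N. \<bar>t\<bar> ^ 3 / (6 * sqrt v) * s i + t ^ 4 / (4 * v) * s i)"
  proof (rule sum_mono)
    fix i assume "i \<in> {..<N}"
    then have i: "i < N" by simp
    show "cmod (char (distr M borel (Y i)) t - exp (- complex_of_real (x i)))
      \<le> \<bar>t\<bar> ^ 3 / (6 * sqrt v) * s i + t ^ 4 / (4 * v) * s i"
      using norm_triangle_le[OF add_mono[OF c1[OF i] c2[OF i]]] by simp
  qed
  also have "\<dots> = \<bar>t\<bar> ^ 3 / (6 * sqrt v) + t ^ 4 / (4 * v)"
    unfolding sum.distrib sum_distrib_left[symmetric] ssum by simp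
  finally show ?thesis
    unfolding eq1[symmetric] eq2[symmetric] v_def by simp
qed

lemma trials_clt_sequence:
  assumes X: "\<And>n. indep_trials (N n) (X n)"
    and v: "\<And>n. real n + 1 \<le> trials_variance (N n) (X n)"
  shows "(\<lambda>n. prob {\<omega>\<in>space M. (\<Sum>i<N n. X n i \<omega>) \<le> trials_mean (N n) (X n) + y * sqrt (trials_variance (N n) (X n))})
           \<longlonglongrightarrow> std_normal_cdf y"
proof -
  define v where "v n = trials_variance (N n) (X n)" for n
  define D where "D n = distr M borel (\<lambda>\<omega>. ((\<Sum>i<N n. X n i \<omega>) - trials_mean (N n) (X n)) / sqrt (v n))" for n
  have v0: "0 < v n" "0 < sqrt (v n)" for n using v[of n] by (auto simp: v_def)
  have rv: "random_variable borel (X n i)" if "i < N n" for n i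
    using X that by (auto simp: indep_trials_def indep_vars_def2)
  have rvS: "random_variable borel (\<lambda>\<omega>. ((\<Sum>i<N n. X n i \<omega>) - trials_mean (N n) (X n)) / sqrt (v n))" for n
    using rv by (intro borel_measurable_divide borel_measurable_diff borel_measurable_sum) auto
  have vtop: "filterlim v at_top sequentially"
    by (rule filterlim_at_top_mono[OF filterlim_real_sequentially])
       (use v in \<open>auto simp: v_def intro!: always_eventually order_trans[OF _ v]\<close>)
  have "weak_conv_m D std_normal_distribution"
  proof (rule levy_continuity)
    show "real_distribution (D n)" for n unfolding D_def using rvS by (rule real_distribution_distr)
    fix t
    have lim: "(\<lambda>n. \<bar>t\<bar> ^ 3 / (6 * sqrt (v n)) + t ^ 4 / (4 * v n)) \<longlonglongrightarrow> 0"
    proof -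
      have "((\<lambda>w. \<bar>t\<bar> ^ 3 / (6 * sqrt w) + t ^ 4 / (4 * w)) \<longlongrightarrow> 0) at_top" by real_asymp
      from filterlim_compose[OF this vtop] show ?thesis .
    qed
    have "\<forall>n. cmod (char (D n) t - exp (- t\<^sup>2 / 2)) \<le> \<bar>t\<bar> ^ 3 / (6 * sqrt (v n)) + t ^ 4 / (4 * v n)"
      unfolding D_def v_def using char_standardized_trials[OF X v0(1)[unfolded v_def]] by blast
    then have "(\<lambda>n. char (D n) t - exp (- t\<^sup>2 / 2)) \<longlonglongrightarrow> 0"
      by (intro Lim_null_comparison[OF always_eventually lim])
    then have "(\<lambda>n. char (D n) t) \<longlonglongrightarrow> exp (- t\<^sup>2 / 2)" by (simp add: LIM_zero_iff)
    then show "(\<lambda>n. char (D n) t) \<longlonglongrightarrow> char std_normal_distribution t"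
      by (simp add: char_std_normal_distribution exp_of_real[symmetric])
  qed (rule real_dist_normal_dist)
  then have "(\<lambda>n. cdf (D n) y) \<longlonglongrightarrow> std_normal_cdf y"
    by (auto simp: weak_conv_m_def weak_conv_def isCont_std_normal_cdf)
  moreover have "cdf (D n) y = prob {\<omega>\<in>space M. (\<Sum>i<N n. X n i \<omega>) \<le> trials_mean (N n) (X n) + y * sqrt (v n)}" for n
  proof -
    have "cdf (D n) y = prob ((\<lambda>\<omega>. ((\<Sum>i<N n. X n i \<omega>) - trials_mean (N n) (X n)) / sqrt (v n)) -` {..y} \<inter> space M)"
      unfolding cdf_def D_def by (rule measure_distr[OF rvS]) simp
    also have "(\<lambda>\<omega>. ((\<Sum>i<N n. X n i \<omega>) - trials_mean (N n) (X n)) / sqrt (v n)) -` {..y} \<inter> space M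
        = {\<omega>\<in>space M. (\<Sum>i<N n. X n i \<omega>) \<le> trials_mean (N n) (X n) + y * sqrt (v n)}"
      using v0[of n] by (auto simp: divide_le_eq algebra_simps)
    finally show ?thesis .
  qed
  ultimately show ?thesis by (simp add: v_def)
qed

text \<open>By contradiction: a failing \<open>\<epsilon>\<close> supplies, for each
  \<open>n\<close>, trials of variance at least \<open>n + 1\<close>, and the resulting sequence
  contradicts the limit along sequences.\<close>

lemma trials_clt_uniform:
  assumes "0 < \<epsilon>"
  shows "\<exists>V>0. \<forall>N X. indep_trials N X \<longrightarrow> V \<le> trials_variance N X \<longrightarrow>
     \<bar>prob {\<omega>\<in>space M. (\<Sum>i<N. X i \<omega>) \<le> trials_mean N X + y * sqrt (trials_variance N X)} - std_normal_cdf y\<bar> \<le> \<epsilon>"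
    (is "\<exists>V>0. \<forall>N X. indep_trials N X \<longrightarrow> V \<le> trials_variance N X \<longrightarrow> ?P N X")
proof (rule ccontr)
  assume neg: "\<not> ?thesis"
  have "\<exists>N X. indep_trials N X \<and> real n + 1 \<le> trials_variance N X \<and> \<not> ?P N X" for n
  proof -
    have "0 < real n + 1" by simp
    then show ?thesis using neg by blast
  qed
  then have "\<forall>n. \<exists>N. \<exists>X. indep_trials N X \<and> real n + 1 \<le> trials_variance N X \<and> \<not> ?P N X"
    by (rule allI)
  from choice[OF this] obtain N where
    "\<forall>n. \<exists>X. indep_trials (N n) X \<and> real n + 1 \<le> trials_variance (N n) X \<and> \<not> ?P (N n) X"
    by (rule exE)
  from choice[OF this] obtain X where
    NX0: "\<forall>n. indep_trials (N n) (X n) \<and> real n + 1 \<le> trials_variance (N n) (X n) \<and> \<not> ?P (N n) (X n)"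
    by (rule exE)
  note NX = NX0[THEN spec, THEN conjunct1] NX0[THEN spec, THEN conjunct2, THEN conjunct1]
    NX0[THEN spec, THEN conjunct2, THEN conjunct2]
  obtain n where "dist (prob {\<omega>\<in>space M. (\<Sum>i<N n. X n i \<omega>) \<le> trials_mean (N n) (X n)
      + y * sqrt (trials_variance (N n) (X n))}) (std_normal_cdf y) < \<epsilon>"
    using eventually_happens'[OF sequentially_bot tendstoD[OF trials_clt_sequence[OF NX(1,2)] assms, of y]]
    by (elim exE)
  with NX(3)[of n] show False unfolding dist_real_def by linarith
qed

text \<open>The threshold \<open>c\<close> is known only up to a small multiple of the standard
  deviation, and the sums have atoms. Both are handled by comparison with the thresholds at
  \<open>y - 2 * \<delta>\<close> and \<open>y + 2 * \<delta>\<close> standard deviations, which lie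
  strictly on either side of \<open>c\<close>; continuity of \<open>\<Phi>\<close> closes the
  gap.\<close>

lemma trials_tail_uniform:
  assumes "0 < \<epsilon>"
  shows "\<exists>\<delta>>0. \<exists>V>0. \<forall>N X c. indep_trials N X \<longrightarrow> V \<le> trials_variance N X \<longrightarrow>
     \<bar>c - trials_mean N X - y * sqrt (trials_variance N X)\<bar> \<le> \<delta> * sqrt (trials_variance N X) \<longrightarrow>
     \<bar>prob {\<omega>\<in>space M. c < (\<Sum>i<N. X i \<omega>)} - std_normal_cdf (- y)\<bar> \<le> \<epsilon> \<and>
     \<bar>prob {\<omega>\<in>space M. c \<le> (\<Sum>i<N. X i \<omega>)} - std_normal_cdf (- y)\<bar> \<le> \<epsilon>"
proof -
  have "\<exists>d>0. \<forall>x. \<bar>x - y\<bar> < d \<longrightarrow> \<bar>std_normal_cdf x - std_normal_cdf y\<bar> < \<epsilon> / 2"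
    using isCont_std_normal_cdf[of y, unfolded continuous_at_eps_delta dist_real_def, rule_format, OF half_gt_zero[OF assms]]
    by blast
  then obtain d where d: "d > 0" "\<And>x. \<bar>x - y\<bar> < d \<Longrightarrow> \<bar>std_normal_cdf x - std_normal_cdf y\<bar> < \<epsilon> / 2" by blast
  define \<delta> where "\<delta> = d / 4"
  have \<delta>: "\<delta> > 0" "2 * \<delta> < d" using d by (auto simp: \<delta>_def)
  obtain V1 where V1: "V1 > 0" "\<And>N X. indep_trials N X \<Longrightarrow> V1 \<le> trials_variance N X \<Longrightarrow>
     \<bar>prob {\<omega>\<in>space M. (\<Sum>i<N. X i \<omega>) \<le> trials_mean N X + (y - 2 * \<delta>) * sqrt (trials_variance N X)} - std_normal_cdf (y - 2 * \<delta>)\<bar> \<le> \<epsilon> / 2"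
    using trials_clt_uniform[OF half_gt_zero[OF assms], of "y - 2 * \<delta>"] by blast
  obtain V2 where V2: "V2 > 0" "\<And>N X. indep_trials N X \<Longrightarrow> V2 \<le> trials_variance N X \<Longrightarrow>
     \<bar>prob {\<omega>\<in>space M. (\<Sum>i<N. X i \<omega>) \<le> trials_mean N X + (y + 2 * \<delta>) * sqrt (trials_variance N X)} - std_normal_cdf (y + 2 * \<delta>)\<bar> \<le> \<epsilon> / 2"
    using trials_clt_uniform[OF half_gt_zero[OF assms], of "y + 2 * \<delta>"] by blast
  have "\<bar>prob {\<omega>\<in>space M. c < (\<Sum>i<N. X i \<omega>)} - std_normal_cdf (- y)\<bar> \<le> \<epsilon> \<and>
     \<bar>prob {\<omega>\<in>space M. c \<le> (\<Sum>i<N. X i \<omega>)} - std_normal_cdf (- y)\<bar> \<le> \<epsilon>"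
    if X: "indep_trials N X" and V: "max V1 V2 \<le> trials_variance N X"
     and c: "\<bar>c - trials_mean N X - y * sqrt (trials_variance N X)\<bar> \<le> \<delta> * sqrt (trials_variance N X)" for N X c
  proof -
    define S where "S \<omega> = (\<Sum>i<N. X i \<omega>)" for \<omega>
    define m where "m = trials_mean N X"
    define w where "w = sqrt (trials_variance N X)"
    have w: "0 < w" using V V1(1) by (auto simp: w_def)
    have [measurable]: "random_variable borel S" unfolding S_def
      using X by (intro borel_measurable_sum) (auto simp: indep_trials_def indep_vars_def2)
    have dw: "0 < \<delta> * w" using \<delta> w by simp
    have lo: "m + (y - 2 * \<delta>) * w < c" and hi: "c < m + (y + 2 * \<delta>) * w"
      using c dw unfolding m_def[symmetric] w_def[symmetric] by (simp_all add: algebra_simps abs_le_iff)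
    have comp: "prob {\<omega>\<in>space M. x < S \<omega>} = 1 - prob {\<omega>\<in>space M. S \<omega> \<le> x}" for x
    proof -
      have "{\<omega>\<in>space M. x < S \<omega>} = space M - {\<omega>\<in>space M. S \<omega> \<le> x}" by auto
      then show ?thesis by (simp add: prob_compl)
    qed
    have dm: "\<bar>std_normal_cdf (y - 2 * \<delta>) - std_normal_cdf y\<bar> < \<epsilon> / 2"
      and dp: "\<bar>std_normal_cdf (y + 2 * \<delta>) - std_normal_cdf y\<bar> < \<epsilon> / 2"
      using \<delta> d(2)[of "y - 2 * \<delta>"] d(2)[of "y + 2 * \<delta>"] by simp_all
    have f1: "\<bar>prob {\<omega>\<in>space M. S \<omega> \<le> m + (y - 2 * \<delta>) * w} - std_normal_cdf (y - 2 * \<delta>)\<bar> \<le> \<epsilon> / 2"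
      unfolding m_def w_def S_def by (rule V1(2)[OF X]) (use V in simp)
    have f2: "\<bar>prob {\<omega>\<in>space M. S \<omega> \<le> m + (y + 2 * \<delta>) * w} - std_normal_cdf (y + 2 * \<delta>)\<bar> \<le> \<epsilon> / 2"
      unfolding m_def w_def S_def by (rule V2(2)[OF X]) (use V in simp)
    have "prob {\<omega>\<in>space M. c \<le> S \<omega>} \<le> prob {\<omega>\<in>space M. m + (y - 2 * \<delta>) * w < S \<omega>}"
      using lo by (intro finite_measure_mono) auto
    also have "\<dots> \<le> 1 - std_normal_cdf (y - 2 * \<delta>) + \<epsilon> / 2"
      using f1 unfolding comp abs_le_iff by linarith
    also have "\<dots> \<le> 1 - std_normal_cdf y + \<epsilon>"
      using dm by linarith
    finally have u: "prob {\<omega>\<in>space M. c \<le> S \<omega>} \<le> 1 - std_normal_cdf y + \<epsilon>" .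
    have "1 - std_normal_cdf y - \<epsilon> \<le> 1 - std_normal_cdf (y + 2 * \<delta>) - \<epsilon> / 2"
      using dp by linarith
    also have "\<dots> \<le> prob {\<omega>\<in>space M. m + (y + 2 * \<delta>) * w < S \<omega>}"
      using f2 unfolding comp abs_le_iff by linarith
    also have "\<dots> \<le> prob {\<omega>\<in>space M. c < S \<omega>}"
      using hi by (intro finite_measure_mono) auto
    finally have l: "1 - std_normal_cdf y - \<epsilon> \<le> prob {\<omega>\<in>space M. c < S \<omega>}" .
    have "prob {\<omega>\<in>space M. c < S \<omega>} \<le> prob {\<omega>\<in>space M. c \<le> S \<omega>}"
      by (intro finite_measure_mono) auto
    then show ?thesis using u l unfolding S_def std_normal_cdf_minus by auto
  qed
  then show ?thesis using \<delta>(1) V1(1) by (intro exI[of _ \<delta>] conjI exI[of _ "max V1 V2"]) auto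
qed

end

section \<open>Random success probabilities\<close>

context prob_space
begin

text \<open>In the application \<open>c n\<close> is \<open>\<tau> N\<close>; the conditional mean
  exceeds it by about \<open>L b\<close>, and the conditional standard deviation is about
  \<open>L * sqrt w\<close>. The uniform tail bound holds at every \<open>\<omega>\<close> of the
  good event, and since probabilities lie in the unit interval its complement costs at most
  \<open>\<delta>\<close>.\<close>

lemma mixed_trials_limit:
  fixes X :: "nat \<Rightarrow> 'a \<Rightarrow> nat \<Rightarrow> 'a \<Rightarrow> real" and c L :: "nat \<Rightarrow> real"
  assumes X: "\<And>n \<omega>. \<omega> \<in> space M \<Longrightarrow> indep_trials (N n) (X n \<omega>)"
    and L: "filterlim L at_top sequentially" and w: "0 < w"
    and good: "\<And>\<kappa> \<delta>. 0 < \<kappa> \<Longrightarrow> 0 < \<delta> \<Longrightarrow> \<forall>\<^sub>F n in sequentially. \<exists>A\<in>events. 1 - \<delta> \<le> prob A \<and>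
          (\<forall>\<omega>\<in>A. \<bar>trials_mean (N n) (X n \<omega>) - c n - L n * b\<bar> \<le> \<kappa> * L n \<and>
                 \<bar>trials_variance (N n) (X n \<omega>) - (L n)\<^sup>2 * w\<bar> \<le> \<kappa> * (L n)\<^sup>2)"
    and meas: "\<And>n. (\<lambda>\<omega>. prob {\<omega>'\<in>space M. c n < (\<Sum>i<N n. X n \<omega> i \<omega>')}) \<in> borel_measurable M"
              "\<And>n. (\<lambda>\<omega>. prob {\<omega>'\<in>space M. c n \<le> (\<Sum>i<N n. X n \<omega> i \<omega>')}) \<in> borel_measurable M"
  shows "(\<lambda>n. expectation (\<lambda>\<omega>. prob {\<omega>'\<in>space M. c n < (\<Sum>i<N n. X n \<omega> i \<omega>')})) \<longlonglongrightarrow> std_normal_cdf (b / sqrt w)"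
    and "(\<lambda>n. expectation (\<lambda>\<omega>. prob {\<omega>'\<in>space M. c n \<le> (\<Sum>i<N n. X n \<omega> i \<omega>')})) \<longlonglongrightarrow> std_normal_cdf (b / sqrt w)"
proof -
  \<comment> \<open>On the good event \<open>c n\<close> lies approximately
    \<open>b / sqrt w\<close> standard deviations below the mean.\<close>
  define y where "y = - (b / sqrt w)"
  have near: "\<bar>expectation f - l\<bar> \<le> \<epsilon> + \<delta>"
    if f: "f \<in> borel_measurable M" "\<And>\<omega>. 0 \<le> f \<omega>" "\<And>\<omega>. f \<omega> \<le> 1" and l: "0 \<le> l" "l \<le> 1"
      and A: "A \<in> events" "1 - \<delta> \<le> prob A" "\<And>\<omega>. \<omega> \<in> A \<Longrightarrow> \<bar>f \<omega> - l\<bar> \<le> \<epsilon>" and e: "0 \<le> \<epsilon>"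
    for f A l \<epsilon> \<delta>
  proof -
    have int: "integrable M f" by (rule integrable_const_bound[of _ 1]) (use f in auto)
    have "\<bar>expectation f - l\<bar> = \<bar>expectation (\<lambda>\<omega>. f \<omega> - l)\<bar>" using int by (simp add: prob_space)
    also have "\<dots> \<le> expectation (\<lambda>\<omega>. \<epsilon> + indicator (space M - A) \<omega>)"
    proof (rule order_trans[OF integral_abs_bound integral_mono])
      fix \<omega> assume "\<omega> \<in> space M"
      show "\<bar>f \<omega> - l\<bar> \<le> \<epsilon> + indicator (space M - A) \<omega>"
      proof (cases "\<omega> \<in> A")
        case False
        have "\<bar>f \<omega> - l\<bar> \<le> 1" using f(2,3)[of \<omega>] l by linarith
        then show ?thesis using False \<open>\<omega> \<in> space M\<close> e by simp
      qed (use A(3) in simp)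
    qed (use int A in \<open>auto simp: emeasure_eq_measure\<close>)
    also have "\<dots> = \<epsilon> + (1 - prob A)"
      using A(1) by (subst Bochner_Integration.integral_add) (auto simp: prob_space prob_compl emeasure_eq_measure)
    finally show ?thesis using A(2) by linarith
  qed
  let ?lt = "\<lambda>n \<omega>. prob {\<omega>'\<in>space M. c n < (\<Sum>i<N n. X n \<omega> i \<omega>')}"
  let ?le = "\<lambda>n \<omega>. prob {\<omega>'\<in>space M. c n \<le> (\<Sum>i<N n. X n \<omega> i \<omega>')}"
  have main: "\<forall>\<^sub>F n in sequentially.
      \<bar>expectation (?lt n) - std_normal_cdf (- y)\<bar> < \<epsilon> \<and>
      \<bar>expectation (?le n) - std_normal_cdf (- y)\<bar> < \<epsilon>"
    if \<epsilon>: "0 < \<epsilon>" for \<epsilon>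
  proof -
    have e3: "0 < \<epsilon> / 3" using \<epsilon> by simp
    obtain \<delta> V where \<delta>: "\<delta> > 0" "V > 0" and tail: "\<And>N X c. indep_trials N X \<Longrightarrow> V \<le> trials_variance N X \<Longrightarrow>
       \<bar>c - trials_mean N X - y * sqrt (trials_variance N X)\<bar> \<le> \<delta> * sqrt (trials_variance N X) \<Longrightarrow>
       \<bar>prob {\<omega>\<in>space M. c < (\<Sum>i<N. X i \<omega>)} - std_normal_cdf (- y)\<bar> \<le> \<epsilon> / 3 \<and>
       \<bar>prob {\<omega>\<in>space M. c \<le> (\<Sum>i<N. X i \<omega>)} - std_normal_cdf (- y)\<bar> \<le> \<epsilon> / 3"
      using trials_tail_uniform[OF e3, of y] by blast
    \<comment> \<open>The first entry keeps the variance above half of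
      \<open>(L n)\<^sup>2 * w\<close>. The second makes the error of the mean, plus
      \<open>\<bar>b\<bar> / sqrt w\<close> times the error of the standard deviation, at most
      \<open>\<delta>\<close> standard deviations.\<close>
    define \<kappa> where "\<kappa> = min (w / 2) (\<delta> * sqrt (w / 2) / (1 + \<bar>b\<bar> / w))"
    have den: "0 < 1 + \<bar>b\<bar> / w" using w by (simp add: add_pos_nonneg)
    have \<kappa>: "0 < \<kappa>" "\<kappa> \<le> w / 2" "\<kappa> * (1 + \<bar>b\<bar> / w) \<le> \<delta> * sqrt (w / 2)"
    proof -
      show "0 < \<kappa>" using w \<delta> den by (simp add: \<kappa>_def)
      show "\<kappa> \<le> w / 2" unfolding \<kappa>_def by (rule min.cobounded1)
      have "\<kappa> \<le> \<delta> * sqrt (w / 2) / (1 + \<bar>b\<bar> / w)" by (simp add: \<kappa>_def)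
      then show "\<kappa> * (1 + \<bar>b\<bar> / w) \<le> \<delta> * sqrt (w / 2)" using den by (simp add: pos_le_divide_eq)
    qed
    have L2: "\<forall>\<^sub>F n in sequentially. max 1 (2 * V / w) \<le> L n"
      using L[unfolded filterlim_at_top] by (rule spec)
    from good[OF \<kappa>(1) e3] L2 show ?thesis
    proof eventually_elim
      case (elim n)
      then obtain A where A: "A \<in> events" "1 - \<epsilon> / 3 \<le> prob A"
        and Am: "\<And>\<omega>. \<omega> \<in> A \<Longrightarrow> \<bar>trials_mean (N n) (X n \<omega>) - c n - L n * b\<bar> \<le> \<kappa> * L n"
        and Av: "\<And>\<omega>. \<omega> \<in> A \<Longrightarrow> \<bar>trials_variance (N n) (X n \<omega>) - (L n)\<^sup>2 * w\<bar> \<le> \<kappa> * (L n)\<^sup>2"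
        by blast
      have Ln: "1 \<le> L n" "2 * V / w \<le> L n" using elim by auto
      have t: "\<bar>?lt n \<omega> - std_normal_cdf (- y)\<bar> \<le> \<epsilon> / 3 \<and>
          \<bar>?le n \<omega> - std_normal_cdf (- y)\<bar> \<le> \<epsilon> / 3"
        if \<omega>: "\<omega> \<in> A" for \<omega>
      proof (rule tail)
        have "\<omega> \<in> space M" using A(1) \<omega> sets.sets_into_space by blast
        then show "indep_trials (N n) (X n \<omega>)" by (rule X)
        define v where "v = trials_variance (N n) (X n \<omega>)"
        have "\<kappa> * (L n)\<^sup>2 \<le> w / 2 * (L n)\<^sup>2" using \<kappa> by (intro mult_right_mono) auto
        moreover have "(L n)\<^sup>2 * w = (L n)\<^sup>2 * (w / 2) + w / 2 * (L n)\<^sup>2" by (simp add: field_simps)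
        ultimately have vlo: "(L n)\<^sup>2 * (w / 2) \<le> v" using Av[OF \<omega>] unfolding v_def abs_le_iff by linarith
        have "2 * V / w * 1 \<le> L n * L n" using Ln by (intro mult_mono) auto
        then have "V \<le> (L n)\<^sup>2 * (w / 2)" using w by (simp add: field_simps power2_eq_square)
        with vlo show "V \<le> trials_variance (N n) (X n \<omega>)" unfolding v_def by simp
        have v0: "0 \<le> v" using vlo w by (smt (verit) zero_le_power2 mult_nonneg_nonneg half_gt_zero)
        have sv: "L n * sqrt (w / 2) \<le> sqrt v"
        proof -
          have "sqrt ((L n)\<^sup>2 * (w / 2)) = L n * sqrt (w / 2)"
            unfolding real_sqrt_mult using Ln by simp
          then show ?thesis using real_sqrt_le_mono[OF vlo] by simp
        qed
        have Lw: "0 < L n * sqrt w" using Ln w by simp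
        \<comment> \<open>Multiplying by the conjugate sum turns control of the variance into
          control of the standard deviation.\<close>
        have "\<bar>sqrt v - L n * sqrt w\<bar> * (L n * sqrt w) \<le> \<bar>sqrt v - L n * sqrt w\<bar> * (sqrt v + L n * sqrt w)"
          using v0 by (intro mult_left_mono) auto
        also have "\<dots> = \<bar>(sqrt v - L n * sqrt w) * (sqrt v + L n * sqrt w)\<bar>"
          using Lw v0 by (simp add: abs_mult)
        also have "(sqrt v - L n * sqrt w) * (sqrt v + L n * sqrt w) = v - (L n)\<^sup>2 * w"
          using v0 w by (simp add: square_diff_square_factored[symmetric] power2_eq_square ac_simps)
            (simp add: algebra_simps)
        also have "\<bar>v - (L n)\<^sup>2 * w\<bar> \<le> \<kappa> * (L n)\<^sup>2" using Av[OF \<omega>] by (simp add: v_def)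
        finally have "\<bar>sqrt v - L n * sqrt w\<bar> \<le> \<kappa> * (L n)\<^sup>2 / (L n * sqrt w)"
          using Lw by (simp add: pos_le_divide_eq)
        also have "\<dots> = \<kappa> * L n / sqrt w" using Ln by (simp add: power2_eq_square)
        finally have sd: "\<bar>sqrt v - L n * sqrt w\<bar> \<le> \<kappa> * L n / sqrt w" .
        have "c n - trials_mean (N n) (X n \<omega>) - y * sqrt v
            = - (trials_mean (N n) (X n \<omega>) - c n - L n * b) + (b / sqrt w) * (sqrt v - L n * sqrt w)"
          using w by (simp add: y_def algebra_simps)
        then have "\<bar>c n - trials_mean (N n) (X n \<omega>) - y * sqrt v\<bar>
            \<le> \<bar>- (trials_mean (N n) (X n \<omega>) - c n - L n * b)\<bar> + \<bar>(b / sqrt w) * (sqrt v - L n * sqrt w)\<bar>"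
          by (simp only: abs_triangle_ineq)
        also have "\<bar>- (trials_mean (N n) (X n \<omega>) - c n - L n * b)\<bar> \<le> \<kappa> * L n"
          unfolding abs_minus_cancel using Am[OF \<omega>] .
        also have "\<bar>(b / sqrt w) * (sqrt v - L n * sqrt w)\<bar> \<le> (\<bar>b\<bar> / sqrt w) * (\<kappa> * L n / sqrt w)"
          unfolding abs_mult using sd w by (intro mult_mono) auto
        also have "\<kappa> * L n + (\<bar>b\<bar> / sqrt w) * (\<kappa> * L n / sqrt w) = \<kappa> * (1 + \<bar>b\<bar> / w) * L n"
          using w by (simp add: field_simps)
        also have "\<dots> \<le> \<delta> * sqrt (w / 2) * L n" using \<kappa>(3) Ln by (intro mult_right_mono) auto
        also have "\<dots> \<le> \<delta> * sqrt v" using sv \<delta> by (simp add: mult.assoc mult.commute del: real_sqrt_divide)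
        finally show "\<bar>c n - trials_mean (N n) (X n \<omega>) - y * sqrt (trials_variance (N n) (X n \<omega>))\<bar>
            \<le> \<delta> * sqrt (trials_variance (N n) (X n \<omega>))" by (simp add: v_def)
      qed
      have "\<bar>expectation (?lt n) - std_normal_cdf (- y)\<bar> \<le> \<epsilon>/3 + \<epsilon>/3"
        by (rule near[OF meas(1) _ _ _ _ A]) (use t e3 std_normal_cdf_bounds in auto)
      moreover have "\<bar>expectation (?le n) - std_normal_cdf (- y)\<bar> \<le> \<epsilon>/3 + \<epsilon>/3"
        by (rule near[OF meas(2) _ _ _ _ A]) (use t e3 std_normal_cdf_bounds in auto)
      ultimately show ?case using \<epsilon> by auto
    qed
  qed
  have y': "- y = b / sqrt w" by (simp add: y_def)
  show "(\<lambda>n. expectation (?lt n)) \<longlonglongrightarrow> std_normal_cdf (b / sqrt w)"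
    by (rule tendstoI, drule main, erule eventually_mono, unfold dist_real_def y', elim conjE, assumption)
  show "(\<lambda>n. expectation (?le n)) \<longlonglongrightarrow> std_normal_cdf (b / sqrt w)"
    by (rule tendstoI, drule main, erule eventually_mono, unfold dist_real_def y', elim conjE, assumption)
qed

text \<open>Units with \<open>\<bar>x - a\<^sub>i\<bar> \<le> B K / t\<close> contribute \<open>O(1 / t)\<close> each, but there are at most \<open>R\<close> of them. For the others
  the conditional deviation \<open>C3 / t\<close> would be too crude; instead \<open>\<bar>p\<^sub>i - 1{a\<^sub>i \<le> x}\<bar>\<close> is affine in \<open>p\<^sub>i\<close>, so its mean
  is governed by the unconditional probability, which is within \<open>O(1 / t\<^sup>2)\<close> of \<open>0\<close> or \<open>1\<close>, and Markov's
  inequality applies to the sum.\<close>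

lemma conditional_probabilities_deviation:
  fixes p :: "nat \<Rightarrow> 'a \<Rightarrow> real" and a sd :: "nat \<Rightarrow> real"
  assumes p [measurable]: "\<And>i. i < N \<Longrightarrow> p i \<in> borel_measurable M"
    and N: "0 < N" and p01: "\<And>i \<omega>. i < N \<Longrightarrow> 0 \<le> p i \<omega> \<and> p i \<omega> \<le> 1"
    and t: "1 \<le> t" and K: "1 \<le> K" "exp (- K\<^sup>2 / 4) \<le> 1 / t\<^sup>2"
    and sd: "\<And>i. i < N \<Longrightarrow> 0 < sd i \<and> sd i \<le> B" and s0: "0 < s0" "s0 \<le> B"
    and C: "0 \<le> C1" "0 \<le> C2" "0 \<le> C3"
    and edge: "\<And>i. i < N \<Longrightarrow> \<bar>expectation (p i) - std_normal_cdf (t * (x - a i) / sd i)\<bar>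
            \<le> C1 * exp (- (t * (x - a i) / sd i)\<^sup>2 / 4) / t + 1 / t\<^sup>2"
    and scale: "\<And>i. i < N \<Longrightarrow> \<bar>std_normal_cdf (t * (x - a i) / sd i) - std_normal_cdf (t * (x - a i) / s0)\<bar> \<le> C2 / t"
    and A: "A \<in> events" "\<And>\<omega> i. \<omega> \<in> A \<Longrightarrow> i < N \<Longrightarrow> \<bar>p i \<omega> - expectation (p i)\<bar> \<le> C3 / t"
    and R: "real (card {i\<in>{..<N}. \<bar>x - a i\<bar> \<le> B * K / t}) \<le> R"
  shows "\<exists>A'\<in>events. prob A - (C1 + 3) / K \<le> prob A' \<and>
    (\<forall>\<omega>\<in>A'. (\<Sum>i<N. \<bar>p i \<omega> - std_normal_cdf (t * (x - a i) / s0)\<bar>)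
        \<le> (C1 + C2 + C3 + 1) * R / t + 3 * real N * K / t\<^sup>2)"
proof -
  define near where "near = {i\<in>{..<N}. \<bar>x - a i\<bar> \<le> B * K / t}"
  define far where "far = {..<N} - near"
  define u where "u i = (if a i \<le> x then 1 else 0 :: real)" for i
  define D where "D i \<omega> = \<bar>p i \<omega> - u i\<bar>" for i \<omega>
  define q where "q i = std_normal_cdf (t * (x - a i) / s0)" for i
  have card_far: "real (card far) \<le> real N"
    using card_mono[of "{..<N}" far] by (auto simp: far_def)
  have t0: "0 < t" and tt: "1 / t\<^sup>2 \<le> 1 / t"
    using t by (auto simp: power2_eq_square field_simps)
  have pint: "integrable M (p i)" if "i < N" for i
    by (rule integrable_const_bound[of _ 1]) (use p01[OF that] p[OF that] in auto)
  have Dint: "integrable M (D i)" if "i < N" for i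
    unfolding D_def using pint[OF that] by auto
  have gt: "K \<le> \<bar>t * (x - a i) / s\<bar> \<and> (0 \<le> t * (x - a i) / s \<longleftrightarrow> a i \<le> x)"
    if i: "i \<in> far" and s: "0 < s" "s \<le> B" for i s
  proof -
    have d: "B * K < t * \<bar>x - a i\<bar>"
      using i t0 by (auto simp: far_def near_def not_le pos_divide_less_eq mult.commute)
    have "s * K \<le> B * K" using s K by (intro mult_right_mono) auto
    with d have "K * s \<le> t * \<bar>x - a i\<bar>" by (simp add: mult.commute)
    then have "K \<le> \<bar>t * (x - a i) / s\<bar>" using s t0 by (simp add: abs_mult abs_divide pos_le_divide_eq)
    then show ?thesis using s t0 by (auto simp: zero_le_divide_iff zero_le_mult_iff)
  qed
  have e4: "exp (- z\<^sup>2 / 4) \<le> 1 / t\<^sup>2" if "K \<le> \<bar>z\<bar>" for z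
  proof -
    have "K\<^sup>2 \<le> z\<^sup>2" using power_mono[OF that, of 2] K by simp
    then have "exp (- z\<^sup>2 / 4) \<le> exp (- K\<^sup>2 / 4)" by simp
    then show ?thesis using K by linarith
  qed
  have s2: "sqrt 2 \<le> (2::real)" by (rule real_le_lsqrt) auto
  have tail: "\<bar>std_normal_cdf z - (if 0 \<le> z then 1 else 0)\<bar> \<le> 2 / t\<^sup>2" if "K \<le> \<bar>z\<bar>" for z
  proof -
    have "sqrt 2 * exp (- z\<^sup>2 / 4) \<le> 2 * (1 / t\<^sup>2)"
      using s2 e4[OF that] by (intro mult_mono) auto
    then show ?thesis using std_normal_cdf_tail[of z] by simp
  qed
  have qfar: "\<bar>u i - q i\<bar> \<le> 2 / t\<^sup>2" if i: "i \<in> far" for i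
    using tail[of "t * (x - a i) / s0"] gt[OF i s0] unfolding q_def u_def by (auto simp: abs_minus_commute)
  have EDfar: "expectation (D i) \<le> (C1 + 3) / t\<^sup>2" if i: "i \<in> far" for i
  proof -
    have iN: "i < N" using i by (auto simp: far_def)
    have "expectation (D i) = \<bar>expectation (p i) - u i\<bar>"
    proof (cases "a i \<le> x")
      case True
      then have "expectation (D i) = expectation (\<lambda>\<omega>. 1 - p i \<omega>)"
        unfolding D_def u_def using p01[OF iN] by (intro Bochner_Integration.integral_cong) auto
      moreover have "expectation (p i) \<le> expectation (\<lambda>\<omega>. 1)"
        using p01[OF iN] pint[OF iN] by (intro integral_mono) auto
      ultimately show ?thesis using pint[OF iN] True by (simp add: prob_space u_def)
    next
      case False
      then have "expectation (D i) = expectation (p i)"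
        unfolding D_def u_def using p01[OF iN] by (intro Bochner_Integration.integral_cong) auto
      moreover have "0 \<le> expectation (p i)"
        using p01[OF iN] by (intro Bochner_Integration.integral_nonneg) auto
      ultimately show ?thesis using False by (simp add: u_def)
    qed
    also have "\<dots> \<le> \<bar>expectation (p i) - std_normal_cdf (t * (x - a i) / sd i)\<bar>
        + \<bar>std_normal_cdf (t * (x - a i) / sd i) - u i\<bar>" by linarith
    also have "\<bar>std_normal_cdf (t * (x - a i) / sd i) - u i\<bar> \<le> 2 / t\<^sup>2"
      using tail[of "t * (x - a i) / sd i"] gt[OF i, of "sd i"] sd[OF iN] by (auto simp: u_def)
    also have "\<bar>expectation (p i) - std_normal_cdf (t * (x - a i) / sd i)\<bar> \<le> C1 / t\<^sup>2 + 1 / t\<^sup>2"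
    proof -
      have "C1 * exp (- (t * (x - a i) / sd i)\<^sup>2 / 4) / t \<le> C1 * exp (- (t * (x - a i) / sd i)\<^sup>2 / 4) / 1"
        using C t by (intro divide_left_mono) auto
      also have "\<dots> \<le> C1 * (1 / t\<^sup>2)"
        using C e4[of "t * (x - a i) / sd i"] gt[OF i, of "sd i"] sd[OF iN]
        by (simp del: times_divide_eq_right mult_1_right) (intro mult_left_mono, auto)
      finally show ?thesis using edge[OF iN] by simp
    qed
    finally show ?thesis by (simp add: add_divide_distrib)
  qed
  \<comment> \<open>The cutoff is \<open>K / (C1 + 3)\<close> times the bound on the expected sum,
    so the exceptional event has probability at most \<open>(C1 + 3) / K\<close>, which vanishes as
    \<open>K\<close> grows.\<close>
  define G where "G = {\<omega>\<in>space M. real N * K / t\<^sup>2 \<le> (\<Sum>i\<in>far. D i \<omega>)}"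
  have SD: "integrable M (\<lambda>\<omega>. \<Sum>i\<in>far. D i \<omega>)"
    by (intro Bochner_Integration.integrable_sum Dint) (auto simp: far_def)
  have G: "G \<in> events"
    unfolding G_def using SD by measurable
  have pG: "prob G \<le> (C1 + 3) / K"
  proof -
    have pos: "0 < real N * K / t\<^sup>2" using N K t0 by simp
    have "prob G \<le> expectation (\<lambda>\<omega>. \<Sum>i\<in>far. D i \<omega>) / (real N * K / t\<^sup>2)"
      unfolding G_def
      by (rule integral_Markov_inequality_measure[OF SD, of "{}"])
         (use pos in \<open>auto simp: D_def intro!: sum_nonneg\<close>)
    also have "expectation (\<lambda>\<omega>. \<Sum>i\<in>far. D i \<omega>) / (real N * K / t\<^sup>2)
        \<le> real N * ((C1 + 3) / t\<^sup>2) / (real N * K / t\<^sup>2)"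
    proof (rule divide_right_mono)
      have "expectation (\<lambda>\<omega>. \<Sum>i\<in>far. D i \<omega>) = (\<Sum>i\<in>far. expectation (D i))"
        by (intro Bochner_Integration.integral_sum Dint) (auto simp: far_def)
      also have "\<dots> \<le> (\<Sum>i\<in>far. (C1 + 3) / t\<^sup>2)" by (intro sum_mono EDfar)
      also have "\<dots> = real (card far) * ((C1 + 3) / t\<^sup>2)" by simp
      also have "\<dots> \<le> real N * ((C1 + 3) / t\<^sup>2)" using card_far C by (intro mult_right_mono) auto
      finally show "expectation (\<lambda>\<omega>. \<Sum>i\<in>far. D i \<omega>) \<le> real N * ((C1 + 3) / t\<^sup>2)" .
    qed (use pos in simp)
    also have "real N * ((C1 + 3) / t\<^sup>2) / (real N * K / t\<^sup>2) = (C1 + 3) / K"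
      using N t0 K by (simp add: field_simps)
    finally show ?thesis .
  qed
  have "prob A - (C1 + 3) / K \<le> prob (A - G)"
    using finite_measure_mono[of A "(A - G) \<union> G"] measure_Un_le[of "A - G" M G] A(1) G pG by auto
  moreover have "(\<Sum>i<N. \<bar>p i \<omega> - q i\<bar>) \<le> (C1 + C2 + C3 + 1) * R / t + 3 * real N * K / t\<^sup>2"
    if \<omega>: "\<omega> \<in> A - G" for \<omega>
  proof -
    have \<omega>s: "\<omega> \<in> space M" using \<omega> A(1) sets.sets_into_space by blast
    have "(\<Sum>i\<in>near. \<bar>p i \<omega> - q i\<bar>) \<le> (\<Sum>i\<in>near. (C1 + C2 + C3 + 1) / t)"
    proof (rule sum_mono)
      fix i assume "i \<in> near"
      then have i: "i < N" by (simp add: near_def)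
      have "C1 * exp (- (t * (x - a i) / sd i)\<^sup>2 / 4) \<le> C1 * 1" using C by (intro mult_left_mono) auto
      then have "C1 * exp (- (t * (x - a i) / sd i)\<^sup>2 / 4) / t \<le> C1 / t"
        using t0 by (simp add: divide_right_mono)
      then have "\<bar>expectation (p i) - std_normal_cdf (t * (x - a i) / sd i)\<bar> \<le> C1 / t + 1 / t"
        using edge[OF i] tt by linarith
      moreover have "\<bar>p i \<omega> - expectation (p i)\<bar> \<le> C3 / t" using A(2) \<omega> i by auto
      moreover note scale[OF i]
      ultimately show "\<bar>p i \<omega> - q i\<bar> \<le> (C1 + C2 + C3 + 1) / t"
        unfolding q_def add_divide_distrib by linarith
    qed
    also have "\<dots> = real (card near) * ((C1 + C2 + C3 + 1) / t)" by simp
    also have "\<dots> \<le> R * ((C1 + C2 + C3 + 1) / t)"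
      using R C t0 unfolding near_def[symmetric] by (intro mult_right_mono) auto
    finally have n: "(\<Sum>i\<in>near. \<bar>p i \<omega> - q i\<bar>) \<le> (C1 + C2 + C3 + 1) * R / t"
      by (simp add: mult.commute)
    have "(\<Sum>i\<in>far. \<bar>p i \<omega> - q i\<bar>) \<le> (\<Sum>i\<in>far. D i \<omega> + 2 / t\<^sup>2)"
    proof (rule sum_mono)
      fix i assume "i \<in> far"
      from qfar[OF this] show "\<bar>p i \<omega> - q i\<bar> \<le> D i \<omega> + 2 / t\<^sup>2" unfolding D_def by linarith
    qed
    also have "\<dots> = (\<Sum>i\<in>far. D i \<omega>) + real (card far) * (2 / t\<^sup>2)" by (simp add: sum.distrib)
    also have "\<dots> \<le> real N * K / t\<^sup>2 + real N * K * (2 / t\<^sup>2)"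
    proof (intro add_mono mult_right_mono)
      show "(\<Sum>i\<in>far. D i \<omega>) \<le> real N * K / t\<^sup>2" using \<omega> \<omega>s by (auto simp: G_def)
      have "real N * 1 \<le> real N * K" using K by (intro mult_left_mono) auto
      then show "real (card far) \<le> real N * K" using card_far by simp
    qed auto
    also have "\<dots> = 3 * real N * K / t\<^sup>2" by simp
    finally have f: "(\<Sum>i\<in>far. \<bar>p i \<omega> - q i\<bar>) \<le> 3 * real N * K / t\<^sup>2" .
    have "(\<Sum>i<N. \<bar>p i \<omega> - q i\<bar>) = (\<Sum>i\<in>far. \<bar>p i \<omega> - q i\<bar>) + (\<Sum>i\<in>near. \<bar>p i \<omega> - q i\<bar>)"
      unfolding far_def by (rule sum.subset_diff) (auto simp: near_def)
    then show ?thesis using n f by linarith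
  qed
  ultimately show ?thesis
    using A(1) G unfolding q_def by (intro bexI[of _ "A - G"]) auto
qed

text \<open>Not phrased with \<open>indep_var\<close>, which forces both variables to have the same type.\<close>

lemma indep_vimage_fubini:
  assumes X [measurable]: "X \<in> measurable M S" and Y [measurable]: "Y \<in> measurable M T"
    and ind: "indep_set (sets (vimage_algebra (space M) X S)) (sets (vimage_algebra (space M) Y T))"
    and D [measurable]: "D \<in> sets (S \<Otimes>\<^sub>M T)"
  shows "(\<lambda>\<omega>. prob {\<omega>'\<in>space M. (X \<omega>', Y \<omega>) \<in> D}) \<in> borel_measurable M"
    and "prob {\<omega>\<in>space M. (X \<omega>, Y \<omega>) \<in> D} = expectation (\<lambda>\<omega>. prob {\<omega>'\<in>space M. (X \<omega>', Y \<omega>) \<in> D})"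
proof -
  interpret X: prob_space "distr M S X" by (rule prob_space_distr) simp
  interpret Y: prob_space "distr M T Y" by (rule prob_space_distr) simp
  interpret XY: pair_prob_space "distr M S X" "distr M T Y" ..
  \<comment> \<open>Agreement on rectangles suffices, and there it is the product rule for the two
    generated sigma algebras.\<close>
  have joint: "distr M S X \<Otimes>\<^sub>M distr M T Y = distr M (S \<Otimes>\<^sub>M T) (\<lambda>\<omega>. (X \<omega>, Y \<omega>))"
  proof (rule pair_measure_eqI)
    fix a b assume "a \<in> sets (distr M S X)" "b \<in> sets (distr M T Y)"
    then have ab: "a \<in> sets S" "b \<in> sets T" by auto
    have "X -` a \<inter> space M \<in> sets (vimage_algebra (space M) X S)"
      "Y -` b \<inter> space M \<in> sets (vimage_algebra (space M) Y T)"
      using ab by (auto intro: in_vimage_algebra)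
    from indep_setD[OF ind this] have "prob ((X -` a \<inter> space M) \<inter> (Y -` b \<inter> space M))
        = prob (X -` a \<inter> space M) * prob (Y -` b \<inter> space M)" .
    moreover have "(X -` a \<inter> space M) \<inter> (Y -` b \<inter> space M) = (\<lambda>\<omega>. (X \<omega>, Y \<omega>)) -` (a \<times> b) \<inter> space M"
      by auto
    ultimately show "emeasure (distr M S X) a * emeasure (distr M T Y) b
        = emeasure (distr M (S \<Otimes>\<^sub>M T) (\<lambda>\<omega>. (X \<omega>, Y \<omega>))) (a \<times> b)"
      using ab by (simp add: emeasure_distr emeasure_eq_measure ennreal_mult[symmetric])
  qed (auto intro: X.sigma_finite_measure_axioms Y.sigma_finite_measure_axioms)
  have D': "D \<in> sets (distr M S X \<Otimes>\<^sub>M distr M T Y)" by simp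
  have sec: "emeasure (distr M S X) ((\<lambda>x. (x, y)) -` D) = ennreal (prob {\<omega>'\<in>space M. (X \<omega>', y) \<in> D})" for y
  proof -
    have "(\<lambda>x. (x, y)) -` D \<in> sets S" using D by (rule sets_Pair2)
    then have "emeasure (distr M S X) ((\<lambda>x. (x, y)) -` D) = emeasure M (X -` ((\<lambda>x. (x, y)) -` D) \<inter> space M)"
      by (rule emeasure_distr[OF X])
    also have "X -` ((\<lambda>x. (x, y)) -` D) \<inter> space M = {\<omega>'\<in>space M. (X \<omega>', y) \<in> D}" by auto
    finally show ?thesis by (simp add: emeasure_eq_measure)
  qed
  have m0: "(\<lambda>y. ennreal (prob {\<omega>'\<in>space M. (X \<omega>', y) \<in> D})) \<in> borel_measurable T"
    using XY.measurable_emeasure_Pair2[OF D'] unfolding sec by simp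
  have m1: "(\<lambda>y. prob {\<omega>'\<in>space M. (X \<omega>', y) \<in> D}) \<in> borel_measurable T"
    using borel_measurable_enn2real[OF m0] by simp
  show m2: "(\<lambda>\<omega>. prob {\<omega>'\<in>space M. (X \<omega>', Y \<omega>) \<in> D}) \<in> borel_measurable M"
    using measurable_compose[OF Y m1] .
  have "emeasure M {\<omega>\<in>space M. (X \<omega>, Y \<omega>) \<in> D} = emeasure (distr M (S \<Otimes>\<^sub>M T) (\<lambda>\<omega>. (X \<omega>, Y \<omega>))) D"
    by (subst emeasure_distr) (auto intro!: arg_cong[of _ _ "emeasure M"])
  also have "\<dots> = emeasure (distr M S X \<Otimes>\<^sub>M distr M T Y) D"
    unfolding joint ..
  also have "\<dots> = (\<integral>\<^sup>+ y. emeasure (distr M S X) ((\<lambda>x. (x, y)) -` D) \<partial>distr M T Y)"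
    by (rule XY.emeasure_pair_measure_alt2[OF D'])
  also have "\<dots> = (\<integral>\<^sup>+ y. ennreal (prob {\<omega>'\<in>space M. (X \<omega>', y) \<in> D}) \<partial>distr M T Y)"
    unfolding sec ..
  also have "\<dots> = (\<integral>\<^sup>+ \<omega>. ennreal (prob {\<omega>'\<in>space M. (X \<omega>', Y \<omega>) \<in> D}) \<partial>M)"
    by (rule nn_integral_distr) (use m0 in simp_all)
  also have "\<dots> = ennreal (expectation (\<lambda>\<omega>. prob {\<omega>'\<in>space M. (X \<omega>', Y \<omega>) \<in> D}))"
    by (intro nn_integral_eq_integral integrable_const_bound[of _ 1] m2) auto
  finally show "prob {\<omega>\<in>space M. (X \<omega>, Y \<omega>) \<in> D} = expectation (\<lambda>\<omega>. prob {\<omega>'\<in>space M. (X \<omega>', Y \<omega>) \<in> D})"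
    by (simp add: emeasure_eq_measure Bochner_Integration.integral_nonneg)
qed

text \<open>Preimages of rectangles form an intersection-stable generator, and on them probabilities
  factor twice: between the two families, and then over the indices within each family.\<close>

lemma indep_vars_Pair:
  fixes X :: "'i \<Rightarrow> 'a \<Rightarrow> 'b" and Y :: "'i \<Rightarrow> 'a \<Rightarrow> 'c"
  assumes X: "indep_vars (\<lambda>_. S) X UNIV" and Y: "indep_vars (\<lambda>_. T) Y UNIV"
    and ind: "indep_set (sets (vimage_algebra (space M) (\<lambda>\<omega> i. X i \<omega>) (Pi\<^sub>M UNIV (\<lambda>_. S))))
      (sets (vimage_algebra (space M) (\<lambda>\<omega> i. Y i \<omega>) (Pi\<^sub>M UNIV (\<lambda>_. T))))"
  shows "indep_vars (\<lambda>_. S \<Otimes>\<^sub>M T) (\<lambda>i \<omega>. (X i \<omega>, Y i \<omega>)) UNIV"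
proof -
  have rv [measurable]: "X i \<in> measurable M S" "Y i \<in> measurable M T" for i
    using X Y by (auto simp: indep_vars_def2)
  have vX: "X i -` a \<inter> space M \<in> sets (vimage_algebra (space M) (\<lambda>\<omega> i. X i \<omega>) (Pi\<^sub>M UNIV (\<lambda>_. S)))"
    if "a \<in> sets S" for i a
  proof -
    have "(\<lambda>\<omega> i. X i \<omega>) \<in> measurable (vimage_algebra (space M) (\<lambda>\<omega> i. X i \<omega>) (Pi\<^sub>M UNIV (\<lambda>_. S))) (Pi\<^sub>M UNIV (\<lambda>_. S))"
      by (rule measurable_vimage_algebra1) (auto simp: space_PiM dest: measurable_space[OF rv(1)])
    from measurable_sets[OF measurable_compose[OF this measurable_component_singleton[of i]], of a] that
    show ?thesis by simp
  qed
  have vY: "Y i -` a \<inter> space M \<in> sets (vimage_algebra (space M) (\<lambda>\<omega> i. Y i \<omega>) (Pi\<^sub>M UNIV (\<lambda>_. T)))"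
    if "a \<in> sets T" for i a
  proof -
    have "(\<lambda>\<omega> i. Y i \<omega>) \<in> measurable (vimage_algebra (space M) (\<lambda>\<omega> i. Y i \<omega>) (Pi\<^sub>M UNIV (\<lambda>_. T))) (Pi\<^sub>M UNIV (\<lambda>_. T))"
      by (rule measurable_vimage_algebra1) (auto simp: space_PiM dest: measurable_space[OF rv(2)])
    from measurable_sets[OF measurable_compose[OF this measurable_component_singleton[of i]], of a] that
    show ?thesis by simp
  qed
  define F where "F i = {(\<lambda>\<omega>. (X i \<omega>, Y i \<omega>)) -` R \<inter> space M | R. R \<in> {a \<times> b | a b. a \<in> sets S \<and> b \<in> sets T}}" for i
  have F_E: thesis if "P \<in> F i" "\<And>a b. a \<in> sets S \<Longrightarrow> b \<in> sets T \<Longrightarrow>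
      P = (\<lambda>\<omega>. (X i \<omega>, Y i \<omega>)) -` (a \<times> b) \<inter> space M \<Longrightarrow> thesis" for P i thesis
    using that(1) unfolding F_def by (elim CollectE exE conjE) (rule that(2), auto)
  have "indep_sets F UNIV"
  proof (rule indep_setsI)
    show "F i \<subseteq> events" for i
    proof -
      have "a \<times> b \<in> sets (S \<Otimes>\<^sub>M T)" if "a \<in> sets S" "b \<in> sets T" for a b using that by simp
      moreover have "(\<lambda>\<omega>. (X i \<omega>, Y i \<omega>)) \<in> measurable M (S \<Otimes>\<^sub>M T)" by measurable
      ultimately show ?thesis unfolding F_def using measurable_sets by blast
    qed
    fix A J assume J: "J \<noteq> {}" "J \<subseteq> UNIV" "finite J" and A: "\<forall>j\<in>J. A j \<in> F j"
    have "\<forall>j\<in>J. \<exists>a b. a \<in> sets S \<and> b \<in> sets T \<and> A j = (X j -` a \<inter> space M) \<inter> (Y j -` b \<inter> space M)"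
    proof
      fix j assume "j \<in> J"
      with A have "A j \<in> F j" by (rule bspec)
      then obtain a b where "a \<in> sets S" "b \<in> sets T" "A j = (\<lambda>\<omega>. (X j \<omega>, Y j \<omega>)) -` (a \<times> b) \<inter> space M"
        by (rule F_E)
      then show "\<exists>a b. a \<in> sets S \<and> b \<in> sets T \<and> A j = (X j -` a \<inter> space M) \<inter> (Y j -` b \<inter> space M)"
        by (intro exI[of _ a] exI[of _ b]) auto
    qed
    then obtain a b where ab: "\<And>j. j \<in> J \<Longrightarrow> a j \<in> sets S" "\<And>j. j \<in> J \<Longrightarrow> b j \<in> sets T"
      "\<And>j. j \<in> J \<Longrightarrow> A j = (X j -` a j \<inter> space M) \<inter> (Y j -` b j \<inter> space M)"
      by metis
    have split: "prob (U \<inter> V) = prob U * prob V"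
      if "U \<in> sets (vimage_algebra (space M) (\<lambda>\<omega> i. X i \<omega>) (Pi\<^sub>M UNIV (\<lambda>_. S)))"
         "V \<in> sets (vimage_algebra (space M) (\<lambda>\<omega> i. Y i \<omega>) (Pi\<^sub>M UNIV (\<lambda>_. T)))" for U V
      using indep_setD[OF ind that] .
    have "(\<Inter>j\<in>J. A j) = (\<Inter>j\<in>J. X j -` a j \<inter> space M) \<inter> (\<Inter>j\<in>J. Y j -` b j \<inter> space M)"
      using ab(3) J by auto
    then have "prob (\<Inter>j\<in>J. A j) = prob (\<Inter>j\<in>J. X j -` a j \<inter> space M) * prob (\<Inter>j\<in>J. Y j -` b j \<inter> space M)"
      by (simp only:) (intro split sets.finite_INT vX vY ab J; assumption)
    also have "prob (\<Inter>j\<in>J. X j -` a j \<inter> space M) = (\<Prod>j\<in>J. prob (X j -` a j \<inter> space M))"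
      using ab J by (intro indep_varsD[OF X]) auto
    also have "prob (\<Inter>j\<in>J. Y j -` b j \<inter> space M) = (\<Prod>j\<in>J. prob (Y j -` b j \<inter> space M))"
      using ab J by (intro indep_varsD[OF Y]) auto
    also have "(\<Prod>j\<in>J. prob (X j -` a j \<inter> space M)) * (\<Prod>j\<in>J. prob (Y j -` b j \<inter> space M)) = (\<Prod>j\<in>J. prob (A j))"
      unfolding prod.distrib[symmetric]
      by (intro prod.cong refl) (use ab in \<open>simp add: split vX vY\<close>)
    finally show "prob (\<Inter>j\<in>J. A j) = (\<Prod>j\<in>J. prob (A j))" .
  qed
  then have "indep_sets (\<lambda>i. sigma_sets (space M) (F i)) UNIV"
  proof (rule indep_sets_sigma)
    show "Int_stable (F i)" for i
    proof (rule Int_stableI)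
      fix P Q assume "P \<in> F i" "Q \<in> F i"
      from \<open>P \<in> F i\<close> obtain a b where *: "a \<in> sets S" "b \<in> sets T"
        "P = (\<lambda>\<omega>. (X i \<omega>, Y i \<omega>)) -` (a \<times> b) \<inter> space M"
        by (rule F_E)
      from \<open>Q \<in> F i\<close> obtain a' b' where **: "a' \<in> sets S" "b' \<in> sets T"
        "Q = (\<lambda>\<omega>. (X i \<omega>, Y i \<omega>)) -` (a' \<times> b') \<inter> space M"
        by (rule F_E)
      from * ** have "P \<inter> Q = (\<lambda>\<omega>. (X i \<omega>, Y i \<omega>)) -` ((a \<inter> a') \<times> (b \<inter> b')) \<inter> space M" by auto
      moreover have "a \<inter> a' \<in> sets S" "b \<inter> b' \<in> sets T" using * ** by auto
      ultimately show "P \<inter> Q \<in> F i"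
        unfolding F_def by (intro CollectI exI[of _ "(a \<inter> a') \<times> (b \<inter> b')"] conjI exI[of _ "a \<inter> a'"] exI[of _ "b \<inter> b'"]) auto
    qed
  qed
  moreover have "{(\<lambda>\<omega>. (X i \<omega>, Y i \<omega>)) -` R \<inter> space M | R. R \<in> sets (S \<Otimes>\<^sub>M T)} = sigma_sets (space M) (F i)" for i
    unfolding F_def sets_pair_measure
    by (rule sigma_sets_vimage_commute) (auto dest: measurable_space[OF rv(1)] measurable_space[OF rv(2)])
  ultimately show ?thesis
    unfolding indep_vars_def2 by simp
qed

text \<open>The rows \<open>{i} \<times> {..<T}\<close> of the array are disjoint, and each
  \<open>g i\<close> reads only its own row.\<close>

lemma indep_vars_blocks:
  fixes U :: "nat \<Rightarrow> nat \<Rightarrow> 'a \<Rightarrow> 'b" and g :: "nat \<Rightarrow> (nat \<Rightarrow> 'b) \<Rightarrow> real"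
  assumes U: "indep_vars (\<lambda>_. S) (\<lambda>(i, t). U i t) UNIV"
    and g: "\<And>i. i \<in> I \<Longrightarrow> g i \<in> borel_measurable (Pi\<^sub>M {..<T} (\<lambda>_. S))"
  shows "indep_vars (\<lambda>_. borel) (\<lambda>i \<omega>. g i (\<lambda>t\<in>{..<T}. U i t \<omega>)) I"
proof -
  define K :: "nat \<Rightarrow> (nat \<times> nat) set" where "K i = {i} \<times> {..<T}" for i
  have "indep_vars (\<lambda>i. Pi\<^sub>M (K i) (\<lambda>_. S)) (\<lambda>i \<omega>. restrict (\<lambda>p. (case p of (i, t) \<Rightarrow> U i t) \<omega>) (K i)) I"
    by (rule indep_vars_restrict[OF U]) (auto simp: K_def disjoint_family_on_def)
  moreover have "(\<lambda>f. g i (\<lambda>t\<in>{..<T}. f (i, t))) \<in> borel_measurable (Pi\<^sub>M (K i) (\<lambda>_. S))" if "i \<in> I" for i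
    by (rule measurable_compose[OF measurable_restrict g[OF that]])
       (auto simp: K_def intro!: measurable_component_singleton)
  ultimately have "indep_vars (\<lambda>_. borel)
      (\<lambda>i \<omega>. g i (\<lambda>t\<in>{..<T}. restrict (\<lambda>p. (case p of (i, t) \<Rightarrow> U i t) \<omega>) (K i) (i, t))) I"
    by (rule indep_vars_compose2)
  moreover have "(\<lambda>t\<in>{..<T}. restrict (\<lambda>p. (case p of (i, t) \<Rightarrow> U i t) \<omega>) (K i) (i, t)) = (\<lambda>t\<in>{..<T}. U i t \<omega>)" for i \<omega>
    by (auto simp: K_def restrict_def)
  ultimately show ?thesis by simp
qed

end

section \<open>The number of estimates below a local threshold\<close>

context prob_space
begin

lemma indep_trials_threshold:
  fixes W :: "nat \<Rightarrow> 'a \<Rightarrow> real"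
  assumes "indep_vars (\<lambda>_. borel) W {..<N}"
  shows "indep_trials N (\<lambda>i \<omega>. if W i \<omega> \<le> x then 1 else 0 :: real)"
proof -
  have "indep_vars (\<lambda>_. borel) (\<lambda>i \<omega>. (\<lambda>w. if w \<le> x then 1 else 0 :: real) (W i \<omega>)) {..<N}"
    by (rule indep_vars_compose2[OF assms]) measurable
  then show ?thesis by (auto simp: indep_trials_def)
qed

text \<open>Conditionally on an environment \<open>\<omega>\<close> the estimates \<open>W n \<omega> i\<close> are independent over \<open>i\<close>. For i.i.d. regressors the
  environment is void (\<open>W n \<omega> = Y n\<close>); for common regressors it consists of their values.\<close>

definition conditional_trials ::
  "(nat \<Rightarrow> nat) \<Rightarrow> (nat \<Rightarrow> nat) \<Rightarrow> (nat \<Rightarrow> nat \<Rightarrow> 'a \<Rightarrow> real) \<Rightarrow> (nat \<Rightarrow> 'a \<Rightarrow> nat \<Rightarrow> 'a \<Rightarrow> real) \<Rightarrow> bool" where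
  "conditional_trials N T Y W \<longleftrightarrow>
     (\<forall>n. \<forall>\<omega>\<in>space M. indep_vars (\<lambda>_. borel) (W n \<omega>) {..<N n}) \<and>
     (\<forall>n. \<forall>B\<in>sets (Pi\<^sub>M UNIV (\<lambda>_. borel)).
        (\<lambda>\<omega>. prob {\<omega>'\<in>space M. (\<lambda>i. W n \<omega> i \<omega>') \<in> B}) \<in> borel_measurable M \<and>
        prob {\<omega>\<in>space M. (\<lambda>i. Y n i \<omega>) \<in> B} = expectation (\<lambda>\<omega>. prob {\<omega>'\<in>space M. (\<lambda>i. W n \<omega> i \<omega>') \<in> B})) \<and>
     (\<forall>\<delta>>0. \<exists>C. \<forall>\<^sub>F n in sequentially. \<exists>A\<in>events. 1 - \<delta> \<le> prob A \<and>
        (\<forall>\<omega>\<in>A. \<forall>i<N n. \<forall>x. \<bar>prob {\<omega>'\<in>space M. W n \<omega> i \<omega>' \<le> x} - prob {\<omega>'\<in>space M. Y n i \<omega>' \<le> x}\<bar>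
           \<le> C / sqrt (real (T n))))"

text \<open>Here the rates meet the estimates: every error is written as \<open>L\<close> times a
  combination of the null sequences \<open>\<rho>\<close>, \<open>1 / L\<close>,
  \<open>1 / s\<close>, \<open>1 / K\<close> and \<open>K / s\<close>, after which the mixed limit
  for random success probabilities applies.\<close>

lemma threshold_count_limit:
  fixes Y :: "nat \<Rightarrow> nat \<Rightarrow> 'a \<Rightarrow> real" and W :: "nat \<Rightarrow> 'a \<Rightarrow> nat \<Rightarrow> 'a \<Rightarrow> real"
    and a :: "nat \<Rightarrow> nat \<Rightarrow> real" and sd :: "nat \<Rightarrow> nat \<Rightarrow> real" and N T :: "nat \<Rightarrow> nat"
    and \<tau> f m v s0 c0 B \<Lambda> C C1 :: real
  assumes env: "conditional_trials N T Y W"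
    and c0: "0 < c0" and s0: "c0 \<le> s0" "s0 \<le> B" and sd: "\<And>n i. i < N n \<Longrightarrow> c0 \<le> sd n i \<and> sd n i \<le> B"
    and lip: "0 \<le> \<Lambda>" "\<And>n i. i < N n \<Longrightarrow> \<bar>sd n i - s0\<bar> \<le> \<Lambda> * \<bar>a n i - m\<bar>"
    and C1: "0 \<le> C1"
    and edge: "\<forall>\<^sub>F n in sequentially. \<forall>i<N n. \<forall>x.
          \<bar>prob {\<omega>\<in>space M. Y n i \<omega> \<le> x} - std_normal_cdf (sqrt (real (T n)) * (x - a n i) / sd n i)\<bar>
          \<le> C1 * exp (- (sqrt (real (T n)) * (x - a n i) / sd n i)\<^sup>2 / 4) / sqrt (real (T n)) + 1 / real (T n)"
    and C: "0 \<le> C" and cdf: "\<forall>\<^sub>F n in sequentially. \<forall>y.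
          \<bar>empirical_cdf (N n) (a n) y - \<tau> - f * (y - m)\<bar> \<le> C * ((y - m)\<^sup>2 + 1 / real (N n))"
    and f: "0 < f"
    and N_inf: "filterlim N at_top sequentially" and T_inf: "filterlim T at_top sequentially"
    and lower: "(\<lambda>n. sqrt (real (T n)) / real (N n)) \<longlonglongrightarrow> 0"
    and upper: "(\<lambda>n. real (N n) / (real (T n) powr (3/2) / (ln (real (T n)))\<^sup>2)) \<longlonglongrightarrow> 0"
  defines "x \<equiv> \<lambda>n. m + v / sqrt (real (N n) * sqrt (real (T n)))"
  shows "(\<lambda>n. prob {\<omega>\<in>space M. \<tau> * real (N n) < (\<Sum>i<N n. if Y n i \<omega> \<le> x n then 1 else 0)})
           \<longlonglongrightarrow> std_normal_cdf (f * v / sqrt (f * s0 / sqrt pi))"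
    and "(\<lambda>n. prob {\<omega>\<in>space M. \<tau> * real (N n) \<le> (\<Sum>i<N n. if Y n i \<omega> \<le> x n then 1 else 0)})
           \<longlonglongrightarrow> std_normal_cdf (f * v / sqrt (f * s0 / sqrt pi))"
proof -
  have indW: "\<And>n \<omega>. \<omega> \<in> space M \<Longrightarrow> indep_vars (\<lambda>_. borel) (W n \<omega>) {..<N n}"
    using env unfolding conditional_trials_def by blast
  note env' = env[unfolded conditional_trials_def, THEN conjunct2]
  note law_meas = env'[THEN conjunct1, rule_format, THEN conjunct1]
  note law = env'[THEN conjunct1, rule_format, THEN conjunct2]
  note close = env'[THEN conjunct2, rule_format]
  define s where "s n = sqrt (real (T n))" for n
  define L where "L n = sqrt (real (N n) / s n)" for n
  define K where "K n = ln (real (T n))" for n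
  define X where "X n \<omega> i \<omega>' = (if W n \<omega> i \<omega>' \<le> x n then 1 else 0 :: real)" for n \<omega> i \<omega>'
  have B: "0 < B" using c0 s0 by linarith
  have Tr: "filterlim (\<lambda>n. real (T n)) at_top sequentially"
    by (rule filterlim_compose[OF filterlim_real_sequentially T_inf])
  have s_inf: "filterlim s at_top sequentially"
    unfolding s_def by (rule filterlim_compose[OF sqrt_at_top Tr])
  have K_inf: "filterlim K at_top sequentially"
    unfolding K_def by (rule filterlim_compose[OF ln_at_top Tr])
  have ev1: "\<forall>\<^sub>F n in sequentially. 0 < N n \<and> 1 \<le> s n \<and> 4 \<le> K n"
    using eventually_compose_filterlim[OF eventually_gt_at_top[of 0] N_inf]
      s_inf[unfolded filterlim_at_top, rule_format, of 1] K_inf[unfolded filterlim_at_top, rule_format, of 4]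
    by eventually_elim auto
  have L_inf: "filterlim L at_top sequentially"
  proof -
    have "filterlim (\<lambda>n. inverse (s n / real (N n))) at_top sequentially"
    proof (rule filterlim_inverse_at_top)
      show "(\<lambda>n. s n / real (N n)) \<longlonglongrightarrow> 0" using lower by (simp add: s_def)
      show "\<forall>\<^sub>F n in sequentially. 0 < s n / real (N n)"
        using ev1 by eventually_elim (auto intro!: divide_pos_pos)
    qed
    then have "filterlim (\<lambda>n. real (N n) / s n) at_top sequentially" by simp
    then show ?thesis unfolding L_def by (rule filterlim_compose[OF sqrt_at_top])
  qed
  \<comment> \<open>The replacement error \<open>N K / s\<^sup>2\<close> in units of
    \<open>L\<close>; its square is exactly the quotient in \<open>upper\<close>.\<close>
  define \<rho> where "\<rho> n = L n * K n / s n" for n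
  have \<rho>0: "\<rho> \<longlonglongrightarrow> 0"
  proof -
    have "\<forall>\<^sub>F n in sequentially. real (N n) / (real (T n) powr (3/2) / (ln (real (T n)))\<^sup>2) = (\<rho> n)\<^sup>2"
      using ev1
    proof eventually_elim
      case (elim n)
      have T0: "0 < real (T n)" using elim by (auto simp: s_def intro: gr0I)
      have "real (T n) powr (3/2) = real (T n) powr (1 + 1/2)" by simp
      also have "\<dots> = real (T n) * sqrt (real (T n))"
        unfolding powr_add using T0 by (simp add: powr_half_sqrt)
      also have "\<dots> = s n * (s n)\<^sup>2" by (simp add: s_def)
      finally have p: "real (T n) powr (3/2) = s n * (s n)\<^sup>2" .
      have "(\<rho> n)\<^sup>2 = (L n)\<^sup>2 * (K n)\<^sup>2 / (s n)\<^sup>2"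
        by (simp add: \<rho>_def power_mult_distrib power_divide)
      also have "(L n)\<^sup>2 = real (N n) / s n" using elim by (simp add: L_def)
      finally show ?case unfolding p K_def by simp
    qed
    with upper have "(\<lambda>n. (\<rho> n)\<^sup>2) \<longlonglongrightarrow> 0" by (simp cong: tendsto_cong)
    from tendsto_real_sqrt[OF this] have "(\<lambda>n. \<bar>\<rho> n\<bar>) \<longlonglongrightarrow> 0" by simp
    then show ?thesis by (rule tendsto_rabs_zero_cancel)
  qed
  have I0: "(\<lambda>n. 1 / L n) \<longlonglongrightarrow> 0" and J0: "(\<lambda>n. 1 / s n) \<longlonglongrightarrow> 0" and K0: "(\<lambda>n. 1 / K n) \<longlonglongrightarrow> 0"
    using tendsto_inverse_0_at_top[OF L_inf] tendsto_inverse_0_at_top[OF s_inf] tendsto_inverse_0_at_top[OF K_inf]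
    by (simp_all add: inverse_eq_divide)
  have Ks0: "(\<lambda>n. K n / s n) \<longlonglongrightarrow> 0"
  proof -
    have "((\<lambda>z::real. ln z / sqrt z) \<longlongrightarrow> 0) at_top" by real_asymp
    from filterlim_compose[OF this Tr] show ?thesis by (simp add: K_def s_def)
  qed
  define w where "w = f * s0 / sqrt pi"
  have w: "0 < w" using f s0 c0 by (simp add: w_def)
  have good: "\<forall>\<^sub>F n in sequentially. \<exists>A\<in>events. 1 - \<delta> \<le> prob A \<and>
          (\<forall>\<omega>\<in>A. \<bar>trials_mean (N n) (X n \<omega>) - \<tau> * real (N n) - L n * (f * v)\<bar> \<le> \<kappa> * L n \<and>
                 \<bar>trials_variance (N n) (X n \<omega>) - (L n)\<^sup>2 * w\<bar> \<le> \<kappa> * (L n)\<^sup>2)"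
    if pos: "0 < \<kappa>" "0 < \<delta>" for \<kappa> \<delta>
  proof -
    obtain C3' where close': "\<forall>\<^sub>F n in sequentially. \<exists>A\<in>events. 1 - \<delta> / 2 \<le> prob A \<and>
          (\<forall>\<omega>\<in>A. \<forall>i<N n. \<forall>x. \<bar>prob {\<omega>'\<in>space M. W n \<omega> i \<omega>' \<le> x} - prob {\<omega>'\<in>space M. Y n i \<omega>' \<le> x}\<bar>
             \<le> C3' / sqrt (real (T n)))"
      using close[of "\<delta> / 2"] pos by auto
    define C3 where "C3 = max C3' 0"
    define C2 where "C2 = \<Lambda> * (B\<^sup>2 + \<bar>v\<bar> * B) / c0\<^sup>2"
    have C23: "0 \<le> C2" "0 \<le> C3" "C3' \<le> C3" using lip(1) B by (auto simp: C2_def C3_def)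
    define G where "G = C1 + C2 + C3 + 1"
    \<comment> \<open>Bounds the number of units within \<open>d = B * K n / s n\<close> of the
      threshold, by the expansion of the empirical distribution function over an interval of length
      \<open>3 d\<close>.\<close>
    define R where "R n = real (N n) * (3 * f * (B * K n / s n) + C * (4 * (v / (L n * s n))\<^sup>2 + 10 * (B * K n / s n)\<^sup>2)) + 2 * C" for n
    \<comment> \<open>\<open>E1\<close> is the cost of replacing the conditional probabilities by
      Gaussian ones with common scale \<open>s0\<close>; \<open>E2\<close> is the error in summing
      the latter.\<close>
    define E1 where "E1 n = G * R n / s n + 3 * real (N n) * K n / (s n)\<^sup>2" for n
    define E2 where "E2 n = C * (2 * real (N n) * (v / (L n * s n))\<^sup>2 + 2 * real (N n) / (s n / s0)\<^sup>2 + 1)" for n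
    have NL: "\<forall>\<^sub>F n in sequentially. real (N n) = (L n)\<^sup>2 * s n \<and> sqrt (real (N n) * s n) = L n * s n \<and> 1 \<le> L n"
      using ev1 L_inf[unfolded filterlim_at_top, rule_format, of 1]
    proof eventually_elim
      case (elim n)
      have 1: "real (N n) = (L n)\<^sup>2 * s n" using elim by (simp add: L_def)
      have "real (N n) * s n = (L n * s n)\<^sup>2" unfolding 1 by (simp add: power2_eq_square)
      then show ?case using 1 elim by simp
    qed
    \<comment> \<open>\<open>E1 / L\<close> and \<open>E2 / L\<close> after the substitution
      \<open>N = L\<^sup>2 s\<close>, written in null sequences.\<close>
    let ?e1 = "\<lambda>n. G * (3 * f * B * \<rho> n + 4 * C * v\<^sup>2 * ((1 / L n) * (1 / s n) * (1 / s n)) + 10 * C * B\<^sup>2 * (\<rho> n * (K n / s n))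
              + 2 * C * ((1 / s n) * (1 / L n))) + 3 * \<rho> n"
    let ?e2 = "\<lambda>n. C * (2 * v\<^sup>2 * ((1 / s n) * (1 / L n)) + 2 * s0\<^sup>2 * (\<rho> n * (1 / K n)) + 1 / L n)"
    have "?e1
         \<longlonglongrightarrow> G * (3 * f * B * 0 + 4 * C * v\<^sup>2 * (0 * 0 * 0) + 10 * C * B\<^sup>2 * (0 * 0) + 2 * C * (0 * 0)) + 3 * 0"
      by (intro tendsto_intros \<rho>0 I0 J0 Ks0)
    then have "\<forall>\<^sub>F n in sequentially. ?e1 n < \<kappa> / 2"
      using pos by (intro order_tendstoD(2)) auto
    then have evE1: "\<forall>\<^sub>F n in sequentially. E1 n \<le> \<kappa> / 2 * L n"
      using NL ev1
    proof eventually_elim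
      case (elim n)
      have p: "0 < L n" "0 < s n" using elim by auto
      have "E1 n = L n * (?e1 n)"
        unfolding E1_def R_def \<rho>_def conjunct1[OF elim(2)] using p
        by (simp add: field_simps power2_eq_square)
      also have "\<dots> \<le> L n * (\<kappa> / 2)" using elim(1) p by (intro mult_left_mono) auto
      finally show ?case by (simp add: mult.commute)
    qed
    have "?e2
        \<longlonglongrightarrow> C * (2 * v\<^sup>2 * (0 * 0) + 2 * s0\<^sup>2 * (0 * 0) + 0)"
      by (intro tendsto_intros \<rho>0 I0 J0 K0)
    then have "\<forall>\<^sub>F n in sequentially. ?e2 n < \<kappa> / 2"
      using pos by (intro order_tendstoD(2)) auto
    then have evE2: "\<forall>\<^sub>F n in sequentially. E2 n \<le> \<kappa> / 2 * L n"
      using NL ev1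
    proof eventually_elim
      case (elim n)
      have p: "0 < L n" "0 < s n" "0 < K n" using elim by auto
      have "E2 n = L n * ?e2 n"
        unfolding E2_def \<rho>_def conjunct1[OF elim(2)] using p s0 c0
        by (simp add: field_simps power2_eq_square)
      also have "\<dots> \<le> L n * (\<kappa> / 2)" using elim(1) p by (intro mult_left_mono) auto
      finally show ?case by (simp add: mult.commute)
    qed
    have evK: "\<forall>\<^sub>F n in sequentially. (C1 + 3) / K n \<le> \<delta> / 2"
      using K_inf[unfolded filterlim_at_top, rule_format, of "2 * (C1 + 3) / \<delta>"] ev1
    proof eventually_elim
      case (elim n)
      then have "2 * (C1 + 3) \<le> K n * \<delta>" using pos by (simp add: pos_divide_le_eq)
      then show ?case using elim by (simp add: pos_divide_le_eq mult.commute)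
    qed
    from close' edge cdf ev1 NL evE1 evE2 evK show ?thesis
    proof eventually_elim
      case (elim n)
      then obtain A where A: "A \<in> events" "1 - \<delta> / 2 \<le> prob A"
        and Ac: "\<And>\<omega> i x. \<omega> \<in> A \<Longrightarrow> i < N n \<Longrightarrow>
          \<bar>prob {\<omega>'\<in>space M. W n \<omega> i \<omega>' \<le> x} - prob {\<omega>'\<in>space M. Y n i \<omega>' \<le> x}\<bar> \<le> C3' / sqrt (real (T n))"
        by blast
      have s1: "1 \<le> s n" "0 < s n" and N0: "0 < N n" and K4: "4 \<le> K n" and L1: "1 \<le> L n"
        and NLn: "real (N n) = (L n)\<^sup>2 * s n" and xm: "x n - m = v / (L n * s n)"
        using elim by (auto simp: x_def s_def)
      have sT: "(s n)\<^sup>2 = real (T n)" by (simp add: s_def)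
      define p where "p i \<omega> = prob {\<omega>'\<in>space M. W n \<omega> i \<omega>' \<le> x n}" for i \<omega>
      define q where "q i = std_normal_cdf (s n * (x n - a n i) / s0)" for i
      have Bset: "{z. z i \<le> x n} \<in> sets (Pi\<^sub>M UNIV (\<lambda>_. borel))" for i :: nat
      proof -
        have "(\<lambda>z. z i) -` {..x n} \<inter> space (Pi\<^sub>M UNIV (\<lambda>_::nat. borel :: real measure)) \<in> sets (Pi\<^sub>M UNIV (\<lambda>_. borel))"
          by (rule measurable_sets[OF measurable_component_singleton]) auto
        moreover have "(\<lambda>z. z i) -` {..x n} \<inter> space (Pi\<^sub>M UNIV (\<lambda>_::nat. borel :: real measure)) = {z. z i \<le> x n}"
          by (auto simp: space_PiM)
        ultimately show ?thesis by simp
      qed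
      have pm: "p i \<in> borel_measurable M" for i
        using law_meas[OF Bset[of i], of n] by (simp add: p_def[abs_def])
      have Ep: "expectation (p i) = prob {\<omega>\<in>space M. Y n i \<omega> \<le> x n}" for i
        using law[OF Bset[of i], of n] by (simp add: p_def[abs_def])
      have count: "real (card {i\<in>{..<N n}. \<bar>x n - a n i\<bar> \<le> B * K n / s n}) \<le> R n"
      proof -
        let ?F = "empirical_cdf (N n) (a n)"
        define d where "d = B * K n / s n"
        have d: "0 < d" using B K4 s1 by (simp add: d_def)
        \<comment> \<open>The left end is \<open>x n - 2 * d\<close> because the empirical
          distribution function at \<open>x n - d\<close> also counts, and would remove, units
          sitting exactly at \<open>x n - d\<close>.\<close>
        have "card {i\<in>{..<N n}. \<bar>x n - a n i\<bar> \<le> d}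
            \<le> card ({i\<in>{..<N n}. a n i \<le> x n + d} - {i\<in>{..<N n}. a n i \<le> x n - 2 * d})"
          by (rule card_mono) (use d in auto)
        also have "\<dots> = card {i\<in>{..<N n}. a n i \<le> x n + d} - card {i\<in>{..<N n}. a n i \<le> x n - 2 * d}"
          by (rule card_Diff_subset) (use d in auto)
        finally have "card {i\<in>{..<N n}. \<bar>x n - a n i\<bar> \<le> d} + card {i\<in>{..<N n}. a n i \<le> x n - 2 * d}
            \<le> card {i\<in>{..<N n}. a n i \<le> x n + d}"
          using card_mono[of "{i\<in>{..<N n}. a n i \<le> x n + d}" "{i\<in>{..<N n}. a n i \<le> x n - 2 * d}"] d
          by (auto simp: subset_eq)
        then have "real (card {i\<in>{..<N n}. \<bar>x n - a n i\<bar> \<le> d})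
            \<le> real (N n) * ?F (x n + d) - real (N n) * ?F (x n - 2 * d)"
          using N0 by (simp add: empirical_cdf_card)
        also have "\<dots> = real (N n) * (?F (x n + d) - ?F (x n - 2 * d))"
          by (simp add: right_diff_distrib)
        also have "\<dots> \<le> real (N n) * (3 * f * d + C * (4 * (x n - m)\<^sup>2 + 10 * d\<^sup>2 + 2 / real (N n)))"
        proof (rule mult_left_mono)
          have e1: "?F (x n + d) \<le> \<tau> + f * (x n + d - m) + C * ((x n + d - m)\<^sup>2 + 1 / real (N n))"
            using elim(3)[rule_format, of "x n + d"] by (simp add: abs_le_iff)
          have e2: "\<tau> + f * (x n - 2 * d - m) - C * ((x n - 2 * d - m)\<^sup>2 + 1 / real (N n)) \<le> ?F (x n - 2 * d)"
            using elim(3)[rule_format, of "x n - 2 * d"] by (simp add: abs_le_iff)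
          have "(y + z)\<^sup>2 + (y - 2 * z)\<^sup>2 \<le> 4 * y\<^sup>2 + 10 * z\<^sup>2" for y z :: real
          proof -
            have "4 * y\<^sup>2 + 10 * z\<^sup>2 = (y + z)\<^sup>2 + (y - 2 * z)\<^sup>2 + ((y + z)\<^sup>2 + y\<^sup>2 + 4 * z\<^sup>2)"
              by (simp add: power2_eq_square algebra_simps)
            then show ?thesis
              using zero_le_power2[of "y + z"] zero_le_power2[of y] zero_le_power2[of z] by linarith
          qed
          from this[of "x n - m" d] have "(x n + d - m)\<^sup>2 + (x n - 2 * d - m)\<^sup>2 \<le> 4 * (x n - m)\<^sup>2 + 10 * d\<^sup>2"
            by (simp add: algebra_simps)
          from mult_left_mono[OF this C]
          have "C * (x n + d - m)\<^sup>2 + C * (x n - 2 * d - m)\<^sup>2 \<le> C * (4 * (x n - m)\<^sup>2 + 10 * d\<^sup>2)"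
            by (simp only: distrib_left)
          moreover have "f * (x n + d - m) - f * (x n - 2 * d - m) = 3 * f * d" by (simp add: algebra_simps)
          moreover have "C * (4 * (x n - m)\<^sup>2 + 10 * d\<^sup>2 + 2 / real (N n))
              = C * (4 * (x n - m)\<^sup>2 + 10 * d\<^sup>2) + C * (1 / real (N n)) + C * (1 / real (N n))"
            by (simp add: distrib_left)
          moreover note e1[unfolded distrib_left[of C]] e2[unfolded distrib_left[of C]]
          ultimately show "?F (x n + d) - ?F (x n - 2 * d)
              \<le> 3 * f * d + C * (4 * (x n - m)\<^sup>2 + 10 * d\<^sup>2 + 2 / real (N n))"
            by linarith
        qed simp
        also have "\<dots> = R n" unfolding R_def xm d_def using N0 by (simp add: field_simps)
        finally show ?thesis by (simp add: d_def)
      qed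
      have "\<exists>A'\<in>events. prob A - (C1 + 3) / K n \<le> prob A' \<and>
        (\<forall>\<omega>\<in>A'. (\<Sum>i<N n. \<bar>p i \<omega> - std_normal_cdf (s n * (x n - a n i) / s0)\<bar>)
            \<le> (C1 + C2 + C3 + 1) * R n / s n + 3 * real (N n) * K n / (s n)\<^sup>2)"
      proof (rule conditional_probabilities_deviation[where sd = "sd n" and B = B])
        show "0 < N n" "1 \<le> s n" "1 \<le> K n" using N0 s1 K4 by auto
        show "exp (- (K n)\<^sup>2 / 4) \<le> 1 / (s n)\<^sup>2"
        proof -
          \<comment> \<open>Since \<open>K n \<ge> 4\<close>, the number
            \<open>(K n)\<^sup>2 / 4\<close> is at least \<open>K n = ln T\<close>; a window of
            logarithmic width thus leaves a tail of at most \<open>1 / T\<close>.\<close>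
          have "K n * 4 \<le> K n * K n" using K4 by (intro mult_left_mono) auto
          then have "exp (- (K n)\<^sup>2 / 4) \<le> exp (- K n)" by (simp add: power2_eq_square)
          also have "\<dots> = 1 / (s n)\<^sup>2"
            using s1 unfolding sT K_def by (auto simp: exp_minus inverse_eq_divide s_def)
          finally show ?thesis .
        qed
        show "0 < s0" "s0 \<le> B" using s0 c0 by auto
        show "0 < sd n i \<and> sd n i \<le> B" if "i < N n" for i using sd[OF that] c0 by auto
        show "\<bar>expectation (p i) - std_normal_cdf (s n * (x n - a n i) / sd n i)\<bar>
            \<le> C1 * exp (- (s n * (x n - a n i) / sd n i)\<^sup>2 / 4) / s n + 1 / (s n)\<^sup>2" if "i < N n" for i
          using elim(2) that unfolding Ep sT by (simp add: s_def)
        show "\<bar>std_normal_cdf (s n * (x n - a n i) / sd n i) - std_normal_cdf (s n * (x n - a n i) / s0)\<bar> \<le> C2 / s n"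
          if i: "i < N n" for i
          unfolding C2_def
        proof (rule std_normal_cdf_rescale[OF c0])
          \<comment> \<open>The Lipschitz bound is centred at \<open>m\<close>, the rescaling at the
            threshold \<open>x n\<close>. They differ by at most \<open>\<bar>v\<bar> / s n\<close>,
            so \<open>\<bar>v\<bar>\<close> takes the role of \<open>\<rho>\<close> in the rescaling
            bound.\<close>
          have "\<bar>a n i - m\<bar> \<le> \<bar>x n - a n i\<bar> + \<bar>x n - m\<bar>" by linarith
          moreover have "\<bar>x n - m\<bar> \<le> \<bar>v\<bar> / s n"
          proof -
            have "1 * s n \<le> L n * s n" using L1 s1 by (intro mult_right_mono) auto
            then have "\<bar>v\<bar> / (L n * s n) \<le> \<bar>v\<bar> / s n" using s1 L1 by (intro divide_left_mono) auto
            then show ?thesis unfolding xm using s1 L1 by (simp add: abs_divide abs_mult)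
          qed
          ultimately have "\<Lambda> * \<bar>a n i - m\<bar> \<le> \<Lambda> * (\<bar>x n - a n i\<bar> + \<bar>v\<bar> / s n)"
            using lip(1) by (intro mult_left_mono) auto
          then show "\<bar>sd n i - s0\<bar> \<le> \<Lambda> * (\<bar>x n - a n i\<bar> + \<bar>v\<bar> / s n)" using lip(2)[OF i] by linarith
        qed (use sd[OF i] s0 s1 lip in auto)
        show "\<bar>p i \<omega> - expectation (p i)\<bar> \<le> C3 / s n" if "\<omega> \<in> A" "i < N n" for \<omega> i
        proof -
          have "\<bar>p i \<omega> - expectation (p i)\<bar> \<le> C3' / s n"
            using Ac[OF that] unfolding Ep p_def s_def by simp
          also have "\<dots> \<le> C3 / s n" using C23 s1 by (intro divide_right_mono) auto
          finally show ?thesis .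
        qed
        show "p i \<in> borel_measurable M" for i by (rule pm)
        show "0 \<le> p i \<omega> \<and> p i \<omega> \<le> 1" for i \<omega> by (simp add: p_def)
      qed (use C1 C23 A(1) count in auto)
      then obtain A' where A': "A' \<in> events" "prob A - (C1 + 3) / K n \<le> prob A'"
        and dev: "\<And>\<omega>. \<omega> \<in> A' \<Longrightarrow> (\<Sum>i<N n. \<bar>p i \<omega> - q i\<bar>) \<le> E1 n"
        unfolding q_def E1_def G_def by blast
      have cdf': "\<bar>empirical_cdf (N n) (a n) y - \<tau> - f * (y - m)\<bar> \<le> C * ((y - m)\<^sup>2 + 1 / real (N n))" for y
        using elim(3) by blast
      have ss: "0 < s n / s0" using s1 s0 c0 by simp
      have arg: "s n / s0 * (x n - a n i) = s n * (x n - a n i) / s0" for i by simp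
      \<comment> \<open>Weight 1: its first moment under the standard normal law vanishes, so beyond
        \<open>\<tau> N\<close> only the drift \<open>L f v\<close> remains.\<close>
      have q1: "\<bar>(\<Sum>i<N n. q i) - \<tau> * real (N n) - L n * (f * v)\<bar> \<le> E2 n"
      proof -
        have "real (N n) * (f * (v / (L n * s n))) = L n * (f * v)"
          unfolding NLn using s1 L1 by (simp add: power2_eq_square)
        moreover have "\<bar>(\<Sum>i<N n. q i) - real (N n) * ((\<tau> + f * (x n - m)) * 1 - f / (s n / s0) * 0)\<bar> \<le> E2 n"
          using sum_smoothed_empirical_cdf[OF N0 ss _ _ C cdf', of "\<lambda>_. 1" "x n"]
            integral_std_normal_distribution_moment_odd[of 1] std_normal.prob_space
          unfolding arg E2_def q_def xm by (simp add: cdf_def)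
        ultimately show ?thesis unfolding xm by (simp add: algebra_simps)
      qed
      \<comment> \<open>Weight \<open>bernoulli_weight\<close>: its mean vanishes, so level and
        drift drop out, and its first moment \<open>- 1 / sqrt pi\<close> produces the variance
        term.\<close>
      have q2: "\<bar>(\<Sum>i<N n. q i * (1 - q i)) - (L n)\<^sup>2 * w\<bar> \<le> E2 n"
      proof -
        have "real (N n) * (f / (s n / s0) * (1 / sqrt pi)) = (L n)\<^sup>2 * w"
          unfolding NLn w_def using s1 by simp
        moreover have "\<bar>(\<Sum>i<N n. q i * (1 - q i)) - real (N n) * ((\<tau> + f * (x n - m)) * 0 - f / (s n / s0) * (- 1 / sqrt pi))\<bar> \<le> E2 n"
          using sum_smoothed_empirical_cdf[OF N0 ss bernoulli_weight_measurable abs_bernoulli_weight_le C cdf', of "x n"]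
          unfolding arg E2_def q_def xm integral_bernoulli_weight_indicator integral_bernoulli_weight integral_bernoulli_weight_times
          by simp
        ultimately show ?thesis by simp
      qed
      show ?case
      proof (intro bexI[OF _ A'(1)] conjI ballI)
        show "1 - \<delta> \<le> prob A'" using A(2) A'(2) elim(8) by linarith
        fix \<omega> assume \<omega>: "\<omega> \<in> A'"
        have \<omega>s: "\<omega> \<in> space M" using \<omega> A'(1) sets.sets_into_space by blast
        have EX: "expectation (X n \<omega> i) = p i \<omega>" if "i < N n" for i
        proof -
          have [measurable]: "W n \<omega> i \<in> borel_measurable M"
            using indW[OF \<omega>s, of n] that by (auto simp: indep_vars_def2)
          have "expectation (X n \<omega> i) = expectation (indicator {\<omega>'\<in>space M. W n \<omega> i \<omega>' \<le> x n})"
            by (intro Bochner_Integration.integral_cong) (auto simp: X_def)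
          then show ?thesis by (simp add: p_def)
        qed
        have tm: "trials_mean (N n) (X n \<omega>) = (\<Sum>i<N n. p i \<omega>)"
          unfolding trials_mean_def using EX by (intro sum.cong) auto
        have tv: "trials_variance (N n) (X n \<omega>) = (\<Sum>i<N n. p i \<omega> * (1 - p i \<omega>))"
          unfolding trials_variance_def using EX by (intro sum.cong) auto
        have "\<bar>(\<Sum>i<N n. p i \<omega>) - (\<Sum>i<N n. q i)\<bar> \<le> (\<Sum>i<N n. \<bar>p i \<omega> - q i\<bar>)"
          unfolding sum_subtractf[symmetric] by (rule sum_abs)
        then have "\<bar>(\<Sum>i<N n. p i \<omega>) - (\<Sum>i<N n. q i)\<bar> \<le> \<kappa> / 2 * L n"
          using dev[OF \<omega>] elim(6) by linarith
        then show "\<bar>trials_mean (N n) (X n \<omega>) - \<tau> * real (N n) - L n * (f * v)\<bar> \<le> \<kappa> * L n"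
          using q1 elim(7) unfolding tm by linarith
        \<comment> \<open>\<open>p * (1 - p)\<close> is 1-Lipschitz on the unit interval, so the
          bound for the means also serves for the variances.\<close>
        have pq: "\<bar>p i \<omega> * (1 - p i \<omega>) - q i * (1 - q i)\<bar> \<le> \<bar>p i \<omega> - q i\<bar>" for i
        proof -
          have "p i \<omega> * (1 - p i \<omega>) - q i * (1 - q i) = (p i \<omega> - q i) * (1 - p i \<omega> - q i)"
            by (simp add: algebra_simps)
          then have "\<bar>p i \<omega> * (1 - p i \<omega>) - q i * (1 - q i)\<bar> = \<bar>p i \<omega> - q i\<bar> * \<bar>1 - p i \<omega> - q i\<bar>"
            by (simp add: abs_mult)
          also have "\<dots> \<le> \<bar>p i \<omega> - q i\<bar> * 1"
          proof (rule mult_left_mono)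
            have "0 \<le> p i \<omega>" "p i \<omega> \<le> 1" by (auto simp: p_def)
            then show "\<bar>1 - p i \<omega> - q i\<bar> \<le> 1"
              using std_normal_cdf_bounds[of "s n * (x n - a n i) / s0"] unfolding q_def by linarith
          qed simp
          finally show ?thesis by simp
        qed
        have "\<bar>(\<Sum>i<N n. p i \<omega> * (1 - p i \<omega>)) - (\<Sum>i<N n. q i * (1 - q i))\<bar> \<le> (\<Sum>i<N n. \<bar>p i \<omega> - q i\<bar>)"
          unfolding sum_subtractf[symmetric] by (rule order_trans[OF sum_abs sum_mono[OF pq]])
        then have d2: "\<bar>(\<Sum>i<N n. p i \<omega> * (1 - p i \<omega>)) - (\<Sum>i<N n. q i * (1 - q i))\<bar> \<le> \<kappa> / 2 * L n"
          using dev[OF \<omega>] elim(6) by linarith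
        \<comment> \<open>The variance may be off by a small multiple of
          \<open>(L n)\<^sup>2\<close>; the estimates give \<open>L n\<close>, which is smaller
          because \<open>L n \<ge> 1\<close>.\<close>
        have "\<kappa> * L n * 1 \<le> \<kappa> * L n * L n" using L1 pos by (intro mult_left_mono) auto
        then have "\<kappa> * L n \<le> \<kappa> * (L n)\<^sup>2" by (simp add: power2_eq_square mult.assoc)
        then show "\<bar>trials_variance (N n) (X n \<omega>) - (L n)\<^sup>2 * w\<bar> \<le> \<kappa> * (L n)\<^sup>2"
          using d2 q2 elim(7) unfolding tv by linarith
      qed
    qed
  qed
  have Xind: "indep_trials (N n) (X n \<omega>)" if "\<omega> \<in> space M" for n \<omega>
    unfolding X_def using indW[OF that] by (rule indep_trials_threshold)
  \<comment> \<open>The count as a measurable function of the whole vector of estimates, so that the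
    mixture formula in \<open>conditional_trials\<close> applies to it.\<close>
  define S where "S n z = (\<Sum>i<N n. if z i \<le> x n then 1 else 0 :: real)" for n and z :: "nat \<Rightarrow> real"
  have [measurable]: "S n \<in> borel_measurable (Pi\<^sub>M UNIV (\<lambda>_. borel))" for n
    unfolding S_def by measurable
  have sets: "{z. \<tau> * real (N n) < S n z} \<in> sets (Pi\<^sub>M UNIV (\<lambda>_. borel))"
    "{z. \<tau> * real (N n) \<le> S n z} \<in> sets (Pi\<^sub>M UNIV (\<lambda>_. borel))" for n
  proof -
    have "{z\<in>space (Pi\<^sub>M UNIV (\<lambda>_. borel)). \<tau> * real (N n) < S n z} \<in> sets (Pi\<^sub>M UNIV (\<lambda>_. borel))"
      "{z\<in>space (Pi\<^sub>M UNIV (\<lambda>_. borel)). \<tau> * real (N n) \<le> S n z} \<in> sets (Pi\<^sub>M UNIV (\<lambda>_. borel))"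
      by measurable
    then show "{z. \<tau> * real (N n) < S n z} \<in> sets (Pi\<^sub>M UNIV (\<lambda>_. borel))"
      "{z. \<tau> * real (N n) \<le> S n z} \<in> sets (Pi\<^sub>M UNIV (\<lambda>_. borel))" by (simp_all add: space_PiM)
  qed
  have SX: "S n (\<lambda>i. W n \<omega> i \<omega>') = (\<Sum>i<N n. X n \<omega> i \<omega>')" for n \<omega> \<omega>'
    by (simp add: S_def X_def)
  have lm: "(\<lambda>\<omega>. prob {\<omega>'\<in>space M. \<tau> * real (N n) < (\<Sum>i<N n. X n \<omega> i \<omega>')}) \<in> borel_measurable M"
    "(\<lambda>\<omega>. prob {\<omega>'\<in>space M. \<tau> * real (N n) \<le> (\<Sum>i<N n. X n \<omega> i \<omega>')}) \<in> borel_measurable M" for n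
    using law_meas[OF sets(1)[of n], of n] law_meas[OF sets(2)[of n], of n]
    unfolding mem_Collect_eq SX by -
  have le: "prob {\<omega>\<in>space M. \<tau> * real (N n) < S n (\<lambda>i. Y n i \<omega>)}
      = expectation (\<lambda>\<omega>. prob {\<omega>'\<in>space M. \<tau> * real (N n) < (\<Sum>i<N n. X n \<omega> i \<omega>')})"
    "prob {\<omega>\<in>space M. \<tau> * real (N n) \<le> S n (\<lambda>i. Y n i \<omega>)}
      = expectation (\<lambda>\<omega>. prob {\<omega>'\<in>space M. \<tau> * real (N n) \<le> (\<Sum>i<N n. X n \<omega> i \<omega>')})" for n
    using law[OF sets(1)[of n], of n] law[OF sets(2)[of n], of n]
    unfolding mem_Collect_eq SX by -
  note lim = mixed_trials_limit[OF Xind L_inf w good lm]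
  show "(\<lambda>n. prob {\<omega>\<in>space M. \<tau> * real (N n) < (\<Sum>i<N n. if Y n i \<omega> \<le> x n then 1 else 0)})
           \<longlonglongrightarrow> std_normal_cdf (f * v / sqrt (f * s0 / sqrt pi))"
    using lim(1) unfolding le[symmetric] by (simp add: S_def w_def)
  show "(\<lambda>n. prob {\<omega>\<in>space M. \<tau> * real (N n) \<le> (\<Sum>i<N n. if Y n i \<omega> \<le> x n then 1 else 0)})
           \<longlonglongrightarrow> std_normal_cdf (f * v / sqrt (f * s0 / sqrt pi))"
    using lim(2) unfolding le[symmetric] by (simp add: S_def w_def)
qed

end

section \<open>Independence structure of the panel\<close>

lemma measurable_unit_estimate:
  fixes z :: "'b \<Rightarrow> nat \<Rightarrow> real^'k" and y :: "'b \<Rightarrow> nat \<Rightarrow> real"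
    and H :: "(nat \<Rightarrow> real \<times> (real^'k)) \<Rightarrow> real"
  assumes h: "H \<in> borel_measurable (Pi\<^sub>M {..<T} (\<lambda>_. borel))"
    and z: "\<And>t. t < T \<Longrightarrow> (\<lambda>w. z w t) \<in> borel_measurable A" and y: "\<And>t. t < T \<Longrightarrow> (\<lambda>w. y w t) \<in> borel_measurable A"
  shows "(\<lambda>w. H (unit_data T b (z w) (y w))) \<in> borel_measurable A"
  unfolding unit_data_def
proof (rule measurable_compose[OF measurable_restrict h])
  fix t assume "t \<in> {..<T}"
  then have "(\<lambda>w. z w t) \<in> borel_measurable A" "(\<lambda>w. y w t) \<in> borel_measurable A" using z y by auto
  then show "(\<lambda>w. (z w t \<bullet> b + y w t, z w t)) \<in> borel_measurable A"
    by (intro borel_measurable_Pair borel_measurable_add borel_measurable_inner) auto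
qed

lemma unit_data_cong:
  "(\<And>t. t < T \<Longrightarrow> z t = z' t) \<Longrightarrow> (\<And>t. t < T \<Longrightarrow> y t = y' t) \<Longrightarrow> unit_data T b z y = unit_data T b z' y'"
  by (auto simp: unit_data_def)

context prob_space
begin

lemma indep_vars_const:
  assumes "c \<in> space S"
  shows "indep_vars (\<lambda>_. S) (\<lambda>_ _. c) I"
  unfolding indep_vars_def2
proof (intro conjI ballI indep_setsI)
  show "(\<lambda>_. c) \<in> measurable M S" using assms by simp
  show "{(\<lambda>_. c) -` A \<inter> space M |A. A \<in> sets S} \<subseteq> events" by (auto simp: vimage_const)
  fix A J assume J: "J \<noteq> {}" "finite J" and A: "\<forall>j\<in>J. A j \<in> {(\<lambda>_. c) -` A \<inter> space M |A. A \<in> sets S}"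
  have A': "A j = {} \<or> A j = space M" if "j \<in> J" for j
  proof -
    obtain a where "A j = (\<lambda>_. c) -` a \<inter> space M" using A \<open>j \<in> J\<close> by auto
    then show ?thesis by (cases "c \<in> a") auto
  qed
  show "prob (\<Inter> (A ` J)) = (\<Prod>j\<in>J. prob (A j))"
  proof (cases "\<exists>j\<in>J. A j = {}")
    case True
    then obtain j where j: "j \<in> J" "A j = {}" by blast
    then have "prob (A j) = 0" by simp
    then have "(\<Prod>j\<in>J. prob (A j)) = 0" using J j by (intro prod_zero) blast+
    moreover have "\<Inter> (A ` J) = {}" using j by blast
    ultimately show ?thesis by simp
  next
    case False
    then have "A j = space M" if "j \<in> J" for j using A' that by auto
    then show ?thesis using J by (simp add: prob_space)
  qed
qed

text \<open>With the intercept as only coordinate every regressor is the constant 1, and constants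
  are independent. The model with \<open>K = 1\<close> therefore always falls under i.i.d.
  regressors.\<close>

lemma iid_regressors_intercept_only:
  fixes Z :: "nat \<Rightarrow> nat \<Rightarrow> 'a \<Rightarrow> real^'k"
  assumes "CARD('k) = 1" and Z: "\<And>i t \<omega>. \<omega> \<in> space M \<Longrightarrow> Z i t \<omega> $ intercept = 1"
  shows "iid_regressors M Z"
proof -
  have "UNIV = {intercept}" using assms(1) by (metis UNIV_I card_1_singletonE singletonD)
  then have "j = intercept" for j :: 'k by blast
  then have eq: "Z i t \<omega> = 1" if "\<omega> \<in> space M" for i t \<omega>
  proof -
    have "Z i t \<omega> $ j = 1 $ j" for j
      unfolding \<open>\<And>j. j = intercept\<close>[of j] using Z[OF that] by simp
    then show ?thesis by (simp add: vec_eq_iff)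
  qed
  have "indep_vars (\<lambda>_. borel) (\<lambda>(i, t). Z i t) UNIV \<longleftrightarrow> indep_vars (\<lambda>_. borel) (\<lambda>_ _. 1 :: real^'k) (UNIV :: (nat \<times> nat) set)"
  proof -
    have "(\<lambda>(i, t). Z i t) p \<in> measurable M borel" for p
      by (subst measurable_cong[of _ _ "\<lambda>_. 1"]) (auto simp: eq split: prod.split)
    moreover have "(\<lambda>(i, t). Z i t) p -` A \<inter> space M = (\<lambda>_. 1) -` A \<inter> space M" for p A
      by (auto simp: eq split: prod.splits)
    ultimately show ?thesis unfolding indep_vars_def2 by simp
  qed
  moreover have "distr M borel (case p of (i, t) \<Rightarrow> Z i t) = distr M borel (\<lambda>_. 1)" for p
    by (rule distr_cong) (auto simp: eq split: prod.split)
  ultimately show ?thesis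
    unfolding iid_regressors_def iid_family_def by (simp add: indep_vars_const)
qed

lemma indep_vars_unit_estimates_given_regressors:
  fixes e :: "nat \<Rightarrow> nat \<Rightarrow> 'a \<Rightarrow> real" and z :: "nat \<Rightarrow> nat \<Rightarrow> real^'k"
    and h :: "nat \<Rightarrow> (nat \<Rightarrow> real \<times> (real^'k)) \<Rightarrow> real"
  assumes e: "iid_innovations M e" and h: "h T \<in> borel_measurable (Pi\<^sub>M {..<T} (\<lambda>_. borel))"
  shows "indep_vars (\<lambda>_. borel) (\<lambda>i \<omega>. h T (unit_data T (b i) (z i) (\<lambda>t. e i t \<omega>))) I"
proof -
  have "indep_vars (\<lambda>_. borel) (\<lambda>(i, t). e i t) UNIV"
    using e by (simp add: iid_innovations_def iid_family_def)
  then have "indep_vars (\<lambda>_. borel) (\<lambda>i \<omega>. h T (unit_data T (b i) (z i) (\<lambda>t\<in>{..<T}. e i t \<omega>))) I"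
    by (rule indep_vars_blocks[where g = "\<lambda>i f. h T (unit_data T (b i) (z i) f)"])
       (rule measurable_unit_estimate[OF h], auto)
  moreover have "unit_data T (b i) (z i) (\<lambda>t\<in>{..<T}. e i t \<omega>) = unit_data T (b i) (z i) (\<lambda>t. e i t \<omega>)" for i \<omega>
    by (rule unit_data_cong) auto
  ultimately show ?thesis by simp
qed

lemma indep_vars_unit_estimates:
  fixes e :: "nat \<Rightarrow> nat \<Rightarrow> 'a \<Rightarrow> real" and Z :: "nat \<Rightarrow> nat \<Rightarrow> 'a \<Rightarrow> real^'k"
    and h :: "nat \<Rightarrow> (nat \<Rightarrow> real \<times> (real^'k)) \<Rightarrow> real"
  assumes e: "iid_innovations M e" and Z: "iid_regressors M Z" and ind: "innovations_indep_regressors M e Z"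
    and h: "h T \<in> borel_measurable (Pi\<^sub>M {..<T} (\<lambda>_. borel))"
  shows "indep_vars (\<lambda>_. borel) (\<lambda>i \<omega>. h T (unit_data T (b i) (\<lambda>t. Z i t \<omega>) (\<lambda>t. e i t \<omega>))) I"
proof -
  have eta: "(\<lambda>\<omega> p. (case p of (i, t) \<Rightarrow> f i t) \<omega>) = (\<lambda>\<omega>. \<lambda>(i, t). f i t \<omega>)" for f :: "nat \<Rightarrow> nat \<Rightarrow> 'a \<Rightarrow> 'c"
    by (auto simp: fun_eq_iff)
  have "indep_vars (\<lambda>_. borel \<Otimes>\<^sub>M borel) (\<lambda>p \<omega>. ((case p of (i, t) \<Rightarrow> e i t) \<omega>, (case p of (i, t) \<Rightarrow> Z i t) \<omega>)) UNIV"
    by (rule indep_vars_Pair)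
       (use e Z ind in \<open>simp_all add: iid_innovations_def iid_regressors_def iid_family_def innovations_indep_regressors_def eta\<close>)
  also have "(\<lambda>p \<omega>. ((case p of (i, t) \<Rightarrow> e i t) \<omega>, (case p of (i, t) \<Rightarrow> Z i t) \<omega>)) = (\<lambda>(i, t) \<omega>. (e i t \<omega>, Z i t \<omega>))"
    by (auto simp: fun_eq_iff)
  finally have "indep_vars (\<lambda>_. borel) (\<lambda>i \<omega>. h T (unit_data T (b i) (\<lambda>t. snd ((\<lambda>t\<in>{..<T}. (e i t \<omega>, Z i t \<omega>)) t))
      (\<lambda>t. fst ((\<lambda>t\<in>{..<T}. (e i t \<omega>, Z i t \<omega>)) t)))) I"
  proof (rule indep_vars_blocks[where U = "\<lambda>i t \<omega>. (e i t \<omega>, Z i t \<omega>)" and T = T and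
        g = "\<lambda>i f. h T (unit_data T (b i) (\<lambda>t. snd (f t)) (\<lambda>t. fst (f t)))"])
    show "(\<lambda>f. h T (unit_data T (b i) (\<lambda>t. snd (f t)) (\<lambda>t. fst (f t)))) \<in> borel_measurable (Pi\<^sub>M {..<T} (\<lambda>_. borel \<Otimes>\<^sub>M borel))"
      for i
    proof (rule measurable_unit_estimate[OF h])
      fix t assume "t < T"
      then have [measurable]: "(\<lambda>f. f t) \<in> measurable (Pi\<^sub>M {..<T} (\<lambda>_. borel \<Otimes>\<^sub>M borel)) ((borel :: real measure) \<Otimes>\<^sub>M (borel :: (real^'k) measure))"
        by (intro measurable_component_singleton) simp
      show "(\<lambda>f. snd (f t)) \<in> borel_measurable (Pi\<^sub>M {..<T} (\<lambda>_. (borel :: real measure) \<Otimes>\<^sub>M (borel :: (real^'k) measure)))"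
        "(\<lambda>f. fst (f t)) \<in> borel_measurable (Pi\<^sub>M {..<T} (\<lambda>_. (borel :: real measure) \<Otimes>\<^sub>M (borel :: (real^'k) measure)))"
        by measurable
    qed
  qed
  moreover have "unit_data T (b i) (\<lambda>t. snd ((\<lambda>t\<in>{..<T}. (e i t \<omega>, Z i t \<omega>)) t))
      (\<lambda>t. fst ((\<lambda>t\<in>{..<T}. (e i t \<omega>, Z i t \<omega>)) t)) = unit_data T (b i) (\<lambda>t. Z i t \<omega>) (\<lambda>t. e i t \<omega>)" for i \<omega>
    by (rule unit_data_cong) auto
  ultimately show ?thesis by simp
qed

text \<open>All estimates together are one measurable function of the pair of innovation array and
  regressor array, so Fubini for this independent pair expresses their law as a mixture over the
  regressors. The whole vector is treated at once because the count depends on all units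
  jointly.\<close>

lemma unit_estimates_fubini:
  fixes e :: "nat \<Rightarrow> nat \<Rightarrow> 'a \<Rightarrow> real" and Z :: "nat \<Rightarrow> nat \<Rightarrow> 'a \<Rightarrow> real^'k"
    and h :: "nat \<Rightarrow> (nat \<Rightarrow> real \<times> (real^'k)) \<Rightarrow> real"
  assumes e [measurable]: "\<And>i t. e i t \<in> borel_measurable M" and Z [measurable]: "\<And>i t. Z i t \<in> borel_measurable M"
    and ind: "innovations_indep_regressors M e Z"
    and h: "h T \<in> borel_measurable (Pi\<^sub>M {..<T} (\<lambda>_. borel))"
    and B: "B \<in> sets (Pi\<^sub>M UNIV (\<lambda>_. borel))"
  shows "(\<lambda>\<omega>. prob {\<omega>'\<in>space M. (\<lambda>i. h T (unit_data T (b i) (\<lambda>t. Z i t \<omega>) (\<lambda>t. e i t \<omega>'))) \<in> B}) \<in> borel_measurable M"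
    and "prob {\<omega>\<in>space M. (\<lambda>i. h T (unit_data T (b i) (\<lambda>t. Z i t \<omega>) (\<lambda>t. e i t \<omega>))) \<in> B}
      = expectation (\<lambda>\<omega>. prob {\<omega>'\<in>space M. (\<lambda>i. h T (unit_data T (b i) (\<lambda>t. Z i t \<omega>) (\<lambda>t. e i t \<omega>'))) \<in> B})"
proof -
  define PE where "PE = Pi\<^sub>M (UNIV :: (nat \<times> nat) set) (\<lambda>_. borel :: real measure)"
  define PZ where "PZ = Pi\<^sub>M (UNIV :: (nat \<times> nat) set) (\<lambda>_. borel :: (real^'k) measure)"
  define H where "H u = (\<lambda>i. h T (unit_data T (b i) (\<lambda>t. snd u (i, t)) (\<lambda>t. fst u (i, t))))"
    for u :: "(nat \<times> nat \<Rightarrow> real) \<times> (nat \<times> nat \<Rightarrow> real^'k)"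
  have me: "(\<lambda>\<omega>. \<lambda>(i, t). e i t \<omega>) \<in> measurable M PE"
    unfolding PE_def by (rule measurable_PiM_single') (auto simp: split_beta)
  have mZ: "(\<lambda>\<omega>. \<lambda>(i, t). Z i t \<omega>) \<in> measurable M PZ"
    unfolding PZ_def by (rule measurable_PiM_single') (auto simp: split_beta)
  have mH: "H \<in> measurable (PE \<Otimes>\<^sub>M PZ) (Pi\<^sub>M UNIV (\<lambda>_. borel))"
  proof (rule measurable_PiM_single')
    fix i :: nat
    have "(\<lambda>u. snd u (i, t)) \<in> borel_measurable (PE \<Otimes>\<^sub>M PZ)" "(\<lambda>u. fst u (i, t)) \<in> borel_measurable (PE \<Otimes>\<^sub>M PZ)" for t
      unfolding PE_def PZ_def by measurable
    then show "(\<lambda>u. H u i) \<in> borel_measurable (PE \<Otimes>\<^sub>M PZ)"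
      unfolding H_def by (intro measurable_unit_estimate[OF h])
  qed auto
  define D where "D = H -` B \<inter> space (PE \<Otimes>\<^sub>M PZ)"
  have D: "D \<in> sets (PE \<Otimes>\<^sub>M PZ)" unfolding D_def using mH B by (rule measurable_sets)
  have mem: "(\<lambda>(i, t). e i t \<omega>', \<lambda>(i, t). Z i t \<omega>) \<in> D
      \<longleftrightarrow> (\<lambda>i. h T (unit_data T (b i) (\<lambda>t. Z i t \<omega>) (\<lambda>t. e i t \<omega>'))) \<in> B" for \<omega> \<omega>'
    by (simp add: D_def H_def PE_def PZ_def space_pair_measure space_PiM)
  have "indep_set (sets (vimage_algebra (space M) (\<lambda>\<omega>. \<lambda>(i, t). e i t \<omega>) PE))
      (sets (vimage_algebra (space M) (\<lambda>\<omega>. \<lambda>(i, t). Z i t \<omega>) PZ))"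
    using ind by (simp add: innovations_indep_regressors_def PE_def PZ_def)
  note F = indep_vimage_fubini[OF me mZ this D]
  show "(\<lambda>\<omega>. prob {\<omega>'\<in>space M. (\<lambda>i. h T (unit_data T (b i) (\<lambda>t. Z i t \<omega>) (\<lambda>t. e i t \<omega>'))) \<in> B}) \<in> borel_measurable M"
    using F(1) unfolding mem .
  show "prob {\<omega>\<in>space M. (\<lambda>i. h T (unit_data T (b i) (\<lambda>t. Z i t \<omega>) (\<lambda>t. e i t \<omega>))) \<in> B}
      = expectation (\<lambda>\<omega>. prob {\<omega>'\<in>space M. (\<lambda>i. h T (unit_data T (b i) (\<lambda>t. Z i t \<omega>) (\<lambda>t. e i t \<omega>'))) \<in> B})"
    using F(2) unfolding mem .
qed

end

section \<open>From the panel model to conditional trials with a common limit scale\<close>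

lemma cdf_normal_density:
  assumes "0 < s"
  shows "cdf (density lborel (normal_density 0 s)) u = std_normal_cdf (u / s)"
proof -
  have "distributed std_normal_distribution lborel (\<lambda>x. x) std_normal_density"
    unfolding distributed_def by (auto simp: distr_id2)
  from std_normal.normal_density_affine[OF this, of s 0] assms
  have "distributed std_normal_distribution lborel (\<lambda>x. s * x) (normal_density 0 s)" by simp
  then have "density lborel (normal_density 0 s) = distr std_normal_distribution lborel (\<lambda>x. s * x)"
    by (rule distributed_distr_eq_density[symmetric])
  then have "cdf (density lborel (normal_density 0 s)) u = measure (distr std_normal_distribution lborel (\<lambda>x. s * x)) {..u}"
    by (simp add: cdf_def)
  also have "\<dots> = measure std_normal_distribution ((\<lambda>x. s * x) -` {..u} \<inter> space std_normal_distribution)"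
    by (rule measure_distr) auto
  also have "(\<lambda>x. s * x) -` {..u} \<inter> space std_normal_distribution = {..u / s}"
    using assms by (auto simp: pos_le_divide_eq mult.commute)
  finally show ?thesis by (simp add: cdf_def)
qed

lemma standardized_le_iff:
  assumes "0 < T" "0 < \<sigma> (b $ k)"
  shows "standardized h k \<sigma> T b z y \<le> sqrt (real T) * (x - b $ k) / \<sigma> (b $ k) \<longleftrightarrow> h T (unit_data T b z y) \<le> x"
  using assms by (simp add: standardized_def divide_le_cancel mult_le_cancel_left_pos)

lemma (in prob_space) common_regressors_measurable:
  assumes "common_regressors M Z"
  shows "Z i t \<in> borel_measurable M"
proof -
  have "Z 0 t \<in> borel_measurable M"
    using assms unfolding common_regressors_def iid_family_def indep_vars_def2 by force
  moreover have "Z i t \<omega> = Z 0 t \<omega>" if "\<omega> \<in> space M" for \<omega>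
    using assms that unfolding common_regressors_def by blast
  ultimately show ?thesis by (subst measurable_cong[of _ _ "Z 0 t"]) auto
qed

lemma (in prob_space) panel_environment:
  fixes e :: "nat \<Rightarrow> nat \<Rightarrow> 'a \<Rightarrow> real" and Z :: "nat \<Rightarrow> nat \<Rightarrow> 'a \<Rightarrow> real^'k"
    and \<theta> :: "nat \<Rightarrow> nat \<Rightarrow> real^'k" and h :: "nat \<Rightarrow> (nat \<Rightarrow> real \<times> (real^'k)) \<Rightarrow> real"
    and Y :: "nat \<Rightarrow> nat \<Rightarrow> 'a \<Rightarrow> real"
  assumes intercept: "\<And>i t \<omega>. \<omega> \<in> space M \<Longrightarrow> Z i t \<omega> $ intercept = 1"
    and ind: "innovations_indep_regressors M e Z" and e: "iid_innovations M e"
    and Z: "iid_regressors M Z \<or> common_regressors M Z"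
    and common: "1 < CARD('k) \<Longrightarrow> \<not> iid_regressors M Z \<Longrightarrow> conditional_cdf_close M e Z \<theta> h k \<sigma> Ns Ts"
    and h: "\<And>T. h T \<in> borel_measurable (Pi\<^sub>M {..<T} (\<lambda>_. borel))"
    and \<sigma>: "\<And>N i. i < N \<Longrightarrow> 0 < \<sigma> (\<theta> N i $ k)"
    and T: "filterlim Ts at_top sequentially"
    and Y: "\<And>n i \<omega>. Y n i \<omega> = h (Ts n) (unit_data (Ts n) (\<theta> (Ns n) i) (\<lambda>t. Z i t \<omega>) (\<lambda>t. e i t \<omega>))"
  shows "\<exists>W. conditional_trials Ns Ts Y W"
proof (cases "iid_regressors M Z")
  case True
  have "indep_vars (\<lambda>_. borel) (Y n) {..<Ns n}" for n
    unfolding Y[abs_def] by (rule indep_vars_unit_estimates[OF e True ind h])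
  moreover have "\<exists>A\<in>events. 1 - \<delta> \<le> prob A" if "0 < \<delta>" for \<delta>
    by (rule bexI[of _ "space M"]) (use that in \<open>auto simp: prob_space\<close>)
  ultimately show ?thesis
    unfolding conditional_trials_def
    by (intro exI[of _ "\<lambda>n \<omega>. Y n"]) (auto simp: prob_space intro!: exI[of _ 0] always_eventually)
next
  case False
  \<comment> \<open>A regressor consisting of the intercept alone would be i.i.d., so
    \<open>K > 1\<close> here and the closeness condition is available.\<close>
  then have "CARD('k) \<noteq> 1" using iid_regressors_intercept_only[of Z, OF _ intercept] by blast
  then have "1 < CARD('k)" using zero_less_card_finite[where 'a = 'k] by linarith
  then have close: "conditional_cdf_close M e Z \<theta> h k \<sigma> Ns Ts" using common False by blast
  have Zc: "common_regressors M Z" using Z False by blast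
  have em: "e i t \<in> borel_measurable M" for i t
    using e unfolding iid_innovations_def iid_family_def indep_vars_def2 by force
  note Zm = common_regressors_measurable[OF Zc]
  define W where "W n \<omega> i \<omega>' = h (Ts n) (unit_data (Ts n) (\<theta> (Ns n) i) (\<lambda>t. Z i t \<omega>) (\<lambda>t. e i t \<omega>'))" for n \<omega> i \<omega>'
  have 1: "indep_vars (\<lambda>_. borel) (W n \<omega>) {..<Ns n}" for n \<omega>
    unfolding W_def[abs_def] by (rule indep_vars_unit_estimates_given_regressors[OF e h])
  have 2: "(\<lambda>\<omega>. prob {\<omega>'\<in>space M. (\<lambda>i. W n \<omega> i \<omega>') \<in> B}) \<in> borel_measurable M"
    "prob {\<omega>\<in>space M. (\<lambda>i. Y n i \<omega>) \<in> B} = expectation (\<lambda>\<omega>. prob {\<omega>'\<in>space M. (\<lambda>i. W n \<omega> i \<omega>') \<in> B})"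
    if "B \<in> sets (Pi\<^sub>M UNIV (\<lambda>_. borel))" for n B
    unfolding W_def Y by (rule unit_estimates_fubini[OF em Zm ind h that])+
  have 3: "\<exists>C. \<forall>\<^sub>F n in sequentially. \<exists>A\<in>events. 1 - \<delta> \<le> prob A \<and>
      (\<forall>\<omega>\<in>A. \<forall>i<Ns n. \<forall>x. \<bar>prob {\<omega>'\<in>space M. W n \<omega> i \<omega>' \<le> x} - prob {\<omega>'\<in>space M. Y n i \<omega>' \<le> x}\<bar>
         \<le> C / sqrt (real (Ts n)))" if \<delta>: "0 < \<delta>" for \<delta>
  proof -
    obtain C where C: "\<forall>\<^sub>F n in sequentially. \<exists>A\<in>events. prob A \<ge> 1 - \<delta> \<and>
       (\<forall>\<omega>\<in>A. \<forall>i<Ns n. \<forall>x.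
         \<bar>prob {\<omega>'\<in>space M. standardized h k \<sigma> (Ts n) (\<theta> (Ns n) i) (\<lambda>t. Z i t \<omega>) (\<lambda>t. e i t \<omega>') \<le> x}
          - prob {\<omega>'\<in>space M. standardized h k \<sigma> (Ts n) (\<theta> (Ns n) i) (\<lambda>t. Z i t \<omega>') (\<lambda>t. e i t \<omega>') \<le> x}\<bar>
         \<le> C / sqrt (real (Ts n)))"
      using close \<delta> unfolding conditional_cdf_close_def by blast
    have "\<forall>\<^sub>F n in sequentially. \<exists>A\<in>events. 1 - \<delta> \<le> prob A \<and>
      (\<forall>\<omega>\<in>A. \<forall>i<Ns n. \<forall>x. \<bar>prob {\<omega>'\<in>space M. W n \<omega> i \<omega>' \<le> x} - prob {\<omega>'\<in>space M. Y n i \<omega>' \<le> x}\<bar>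
         \<le> C / sqrt (real (Ts n)))"
      using C eventually_compose_filterlim[OF eventually_gt_at_top[of 0] T]
    proof eventually_elim
      case (elim n)
      then obtain A where A: "A \<in> events" "1 - \<delta> \<le> prob A" and AC: "\<And>\<omega> i x. \<omega> \<in> A \<Longrightarrow> i < Ns n \<Longrightarrow>
         \<bar>prob {\<omega>'\<in>space M. standardized h k \<sigma> (Ts n) (\<theta> (Ns n) i) (\<lambda>t. Z i t \<omega>) (\<lambda>t. e i t \<omega>') \<le> x}
          - prob {\<omega>'\<in>space M. standardized h k \<sigma> (Ts n) (\<theta> (Ns n) i) (\<lambda>t. Z i t \<omega>') (\<lambda>t. e i t \<omega>') \<le> x}\<bar>
         \<le> C / sqrt (real (Ts n))" by blast
      show ?case
      proof (intro bexI[OF _ A(1)] conjI A(2) ballI allI impI)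
        fix \<omega> i x assume "\<omega> \<in> A" "i < Ns n"
        \<comment> \<open>The closeness condition concerns the standardized estimates; evaluated at
          the standardized threshold it speaks about the estimates themselves.\<close>
        note AC[OF this, of "sqrt (real (Ts n)) * (x - \<theta> (Ns n) i $ k) / \<sigma> (\<theta> (Ns n) i $ k)"]
        then show "\<bar>prob {\<omega>'\<in>space M. W n \<omega> i \<omega>' \<le> x} - prob {\<omega>'\<in>space M. Y n i \<omega>' \<le> x}\<bar> \<le> C / sqrt (real (Ts n))"
          unfolding standardized_le_iff[where T = "Ts n" and \<sigma> = \<sigma> and b = "\<theta> (Ns n) i" and k = k, OF elim(2) \<sigma>[OF \<open>i < Ns n\<close>]] W_def Y .
      qed
    qed
    then show ?thesis by blast
  qed
  show ?thesis unfolding conditional_trials_def using 1 2 3 by (intro exI[of _ W]) auto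
qed

text \<open>Near \<open>m\<close> the difference of squares is divided by
  \<open>\<sigma> x + \<sigma> m \<ge> \<sigma> m\<close>; at distance at least \<open>r\<close> the
  scale bound \<open>B\<close> is itself at most \<open>B / r * \<bar>x - m\<bar>\<close>. All
  comparisons are with the value at \<open>m\<close>, since the scale of every unit is going to be
  replaced by it.\<close>

lemma lipschitz_at_interior_point:
  fixes \<sigma> :: "real \<Rightarrow> real"
  assumes d: "continuously_differentiable_within (\<lambda>x. (\<sigma> x)\<^sup>2) S" and m: "m \<in> interior S"
    and pos: "\<And>x. x \<in> S \<Longrightarrow> 0 < \<sigma> x" and B: "\<sigma> m \<le> B"
  shows "\<exists>\<Lambda>\<ge>0. \<forall>x\<in>S. \<sigma> x \<le> B \<longrightarrow> \<bar>\<sigma> x - \<sigma> m\<bar> \<le> \<Lambda> * \<bar>x - m\<bar>"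
proof -
  have mS: "m \<in> S" using m interior_subset by blast
  have sm: "0 < \<sigma> m" using pos mS by blast
  obtain D where "((\<lambda>x. (\<sigma> x)\<^sup>2) has_real_derivative D) (at m within S)"
    using d mS unfolding continuously_differentiable_within_def by blast
  then have "((\<lambda>x. (\<sigma> x)\<^sup>2) has_real_derivative D) (at m)"
    using at_within_interior[OF m] by simp
  then have "(\<lambda>x. ((\<sigma> x)\<^sup>2 - (\<sigma> m)\<^sup>2) / (x - m)) \<midarrow>m\<rightarrow> D" by (simp add: has_field_derivative_iff)
  from tendstoD[OF this, of 1] obtain r where r: "r > 0"
    and rr: "\<And>x. x \<noteq> m \<Longrightarrow> \<bar>x - m\<bar> < r \<Longrightarrow> \<bar>((\<sigma> x)\<^sup>2 - (\<sigma> m)\<^sup>2) / (x - m) - D\<bar> < 1"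
    by (auto simp: eventually_at dist_real_def)
  define \<Lambda> where "\<Lambda> = max ((\<bar>D\<bar> + 1) / \<sigma> m) (B / r)"
  have \<Lambda>: "(\<bar>D\<bar> + 1) / \<sigma> m \<le> \<Lambda>" "B / r \<le> \<Lambda>" by (auto simp: \<Lambda>_def)
  have "0 \<le> (\<bar>D\<bar> + 1) / \<sigma> m" using sm by simp
  then have "0 \<le> \<Lambda>" using \<Lambda>(1) by linarith
  moreover have "\<bar>\<sigma> x - \<sigma> m\<bar> \<le> \<Lambda> * \<bar>x - m\<bar>" if x: "x \<in> S" "\<sigma> x \<le> B" for x
  proof (cases "\<bar>x - m\<bar> < r")
    case True
    show ?thesis
    proof (cases "x = m")
      case False
      have sx: "0 < \<sigma> x" using pos x by blast
      have "\<bar>((\<sigma> x)\<^sup>2 - (\<sigma> m)\<^sup>2) / (x - m)\<bar> \<le> \<bar>D\<bar> + 1" using rr[OF False True] by linarith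
      then have "\<bar>(\<sigma> x)\<^sup>2 - (\<sigma> m)\<^sup>2\<bar> \<le> (\<bar>D\<bar> + 1) * \<bar>x - m\<bar>"
        using False by (simp add: abs_divide divide_le_eq)
      moreover have "(\<sigma> x)\<^sup>2 - (\<sigma> m)\<^sup>2 = (\<sigma> x - \<sigma> m) * (\<sigma> x + \<sigma> m)"
        by (simp add: power2_eq_square algebra_simps)
      ultimately have "\<bar>\<sigma> x - \<sigma> m\<bar> * (\<sigma> x + \<sigma> m) \<le> (\<bar>D\<bar> + 1) * \<bar>x - m\<bar>"
        using sx sm by (simp add: abs_mult)
      moreover have "\<bar>\<sigma> x - \<sigma> m\<bar> * \<sigma> m \<le> \<bar>\<sigma> x - \<sigma> m\<bar> * (\<sigma> x + \<sigma> m)"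
        using sx by (intro mult_left_mono) auto
      ultimately have "\<bar>\<sigma> x - \<sigma> m\<bar> \<le> (\<bar>D\<bar> + 1) * \<bar>x - m\<bar> / \<sigma> m"
        using sm by (simp add: pos_le_divide_eq)
      also have "\<dots> = (\<bar>D\<bar> + 1) / \<sigma> m * \<bar>x - m\<bar>" by simp
      also have "\<dots> \<le> \<Lambda> * \<bar>x - m\<bar>" using \<Lambda> by (intro mult_right_mono) auto
      finally show ?thesis .
    qed simp
  next
    case False
    have "\<bar>\<sigma> x - \<sigma> m\<bar> \<le> B" using pos[OF x(1)] x(2) sm B by linarith
    also have "B = B / r * r" using r by simp
    also have "\<dots> \<le> B / r * \<bar>x - m\<bar>" using False sm B r by (intro mult_left_mono) auto
    also have "\<dots> \<le> \<Lambda> * \<bar>x - m\<bar>" using \<Lambda> by (intro mult_right_mono) auto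
    finally show ?thesis .
  qed
  ultimately show ?thesis by blast
qed

theorem theorem3p4:
  fixes M :: "'w measure"
    and e :: "nat \<Rightarrow> nat \<Rightarrow> 'w \<Rightarrow> real"
    and Z :: "nat \<Rightarrow> nat \<Rightarrow> 'w \<Rightarrow> real^'k"
    and \<theta> :: "nat \<Rightarrow> nat \<Rightarrow> real^'k"
    and intercept k :: 'k
    and h :: "nat \<Rightarrow> (nat \<Rightarrow> real \<times> (real^'k)) \<Rightarrow> real"
    and \<Theta> :: "real set"
    and \<tau> \<theta>\<tau> :: real
    and FD fD S \<sigma> :: "real \<Rightarrow> real"
    and b1 :: "real poly ^ 'm" and b2 :: "real poly ^ 'q" and b3 :: "real poly ^ ('m \<times> 'm)"
    and \<kappa>3 :: "real \<Rightarrow> real^'m" and \<kappa>4 :: "real \<Rightarrow> real^'q"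
    and Ns Ts :: "nat \<Rightarrow> nat"
    and \<theta>hat :: "nat \<Rightarrow> nat \<Rightarrow> nat \<Rightarrow> 'w \<Rightarrow> real"
    and \<theta>hat\<tau> :: "nat \<Rightarrow> 'w \<Rightarrow> real"
  assumes "prob_space M"
    and tau: "0 < \<tau>" "\<tau> < 1"

    \<comment> \<open>the model; \<open>\<theta> N i\<close> is the coefficient vector of unit \<open>i\<close> in a cross section of size \<open>N\<close>\<close>
    and regressor_intercept: "\<And>i t \<omega>. \<omega> \<in> space M \<Longrightarrow> Z i t \<omega> $ intercept = 1"
    and indep: "innovations_indep_regressors M e Z"
    and limit_cdf: "\<And>x. (\<lambda>N. empirical_cdf N (\<lambda>i. \<theta> N i $ k) x) \<longlonglongrightarrow> FD x"
    and target: "\<theta>\<tau> = quantile FD \<tau>"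

    \<comment> \<open>first step: \<open>\<theta>hat N T i\<close> estimates \<open>\<theta> N i $ k\<close>\<close>
    and step1_measurable: "\<And>T. h T \<in> borel_measurable (Pi\<^sub>M {..<T} (\<lambda>_. borel))"
    and step1: "\<And>N T i \<omega>. \<theta>hat N T i \<omega> = h T (unit_data T (\<theta> N i) (\<lambda>t. Z i t \<omega>) (\<lambda>t. e i t \<omega>))"
    and sigma_pos: "\<And>x. x \<in> \<Theta> \<Longrightarrow> 0 < \<sigma> x"
    and step1_square_integrable: "\<And>N i. i < N \<Longrightarrow>
          \<forall>\<^sub>F T in sequentially. integrable M (\<lambda>\<omega>. (\<theta>hat N T i \<omega>)\<^sup>2)"
    and sigma_limit: "\<And>N i. i < N \<Longrightarrow>
          (\<lambda>T. prob_space.variance M (\<lambda>\<omega>. sqrt (real T) * \<theta>hat N T i \<omega>)) \<longlonglongrightarrow> (\<sigma> (\<theta> N i $ k))\<^sup>2"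

    \<comment> \<open>second step\<close>
    and step2_measurable: "\<And>n. \<theta>hat\<tau> n \<in> borel_measurable M"
    and step2: "\<And>n \<omega>. \<omega> \<in> space M \<Longrightarrow>
          is_arg_min (check_objective \<tau> (Ns n) (\<lambda>i. \<theta>hat (Ns n) (Ts n) i \<omega>)) (\<lambda>_. True) (\<theta>hat\<tau> n \<omega>)"

    \<comment> \<open>(1)\<close>
    and A1_innovations: "iid_innovations M e"
    and A1_regressors: "iid_regressors M Z \<or> common_regressors M Z"
      \<comment> \<open>void for \<open>K = 1\<close> and for i.i.d. regressors; see \<open>conditional_cdf_close\<close>\<close>
    and A1_common: "1 < CARD('k) \<Longrightarrow> \<not> iid_regressors M Z \<Longrightarrow>
          conditional_cdf_close M e Z \<theta> h k \<sigma> Ns Ts"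

    \<comment> \<open>(2)\<close>
    and A2_compact: "compact \<Theta>"
    and A2_coefficients: "\<And>N i. i < N \<Longrightarrow> \<theta> N i $ k \<in> \<Theta>"
    and A2_limit: "\<And>x. (\<lambda>N. check_objective \<tau> N (\<lambda>i. \<theta> N i $ k) x) \<longlonglongrightarrow> S x"
    and A2_unique: "\<And>x. is_arg_min S (\<lambda>_. True) x \<longleftrightarrow> x = \<theta>\<tau>"
    and A2_interior: "\<theta>\<tau> \<in> interior \<Theta>"

    \<comment> \<open>(3)\<close>
    and A3_i: "\<And>\<eta>. 0 < \<eta> \<Longrightarrow>
          (\<lambda>n. measure M {\<omega>\<in>space M. \<exists>i<Ns n. \<bar>\<theta>hat (Ns n) (Ts n) i \<omega> - \<theta> (Ns n) i $ k\<bar> > \<eta>}) \<longlonglongrightarrow> 0"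
    and A3_ii: "\<exists>c>0. \<exists>C. \<forall>N. \<forall>i<N. c \<le> (\<sigma> (\<theta> N i $ k))\<^sup>2 \<and> (\<sigma> (\<theta> N i $ k))\<^sup>2 \<le> C"
    and A3_iii: "continuously_differentiable_within (\<lambda>x. (\<sigma> x)\<^sup>2) \<Theta>"
    and A3_iv_kappa_smooth: "\<exists>r>0. \<kappa>3 C1_differentiable_on ball \<theta>\<tau> r \<and> \<kappa>4 C1_differentiable_on ball \<theta>\<tau> r"
    and A3_iv_kappa_bounded: "\<exists>C. \<forall>N. \<forall>i<N. norm (\<kappa>3 (\<theta> N i $ k)) \<le> C \<and> norm (\<kappa>4 (\<theta> N i $ k)) \<le> C"
    and A3_iv_remainder: "\<And>\<eta>. 0 < \<eta> \<Longrightarrow> \<forall>\<^sub>F n in sequentially. \<forall>i<Ns n. \<forall>x.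
          \<bar>measure M {\<omega>\<in>space M. standardized h k \<sigma> (Ts n) (\<theta> (Ns n) i) (\<lambda>t. Z i t \<omega>) (\<lambda>t. e i t \<omega>) \<le> x}
           - edgeworth b1 b2 b3 (\<kappa>3 (\<theta> (Ns n) i $ k)) (\<kappa>4 (\<theta> (Ns n) i $ k)) (Ts n) x\<bar>
          \<le> \<eta> / real (Ts n)"

    \<comment> \<open>(4)\<close>
    and A4: "\<exists>r>0.
          (\<forall>x\<in>ball \<theta>\<tau> r. (FD has_real_derivative fD x) (at x)) \<and>
          fD C1_differentiable_on ball \<theta>\<tau> r \<and>
          (\<exists>C. \<forall>\<^sub>F N in sequentially. \<forall>j\<in>{1..N}.
             order_stat N (\<lambda>i. \<theta> N i $ k) j \<in> ball \<theta>\<tau> r \<longrightarrow>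
             \<bar>order_stat N (\<lambda>i. \<theta> N i $ k) j - quantile FD (real j / real N)\<bar> \<le> C / real N) \<and>
          (\<exists>C. \<forall>\<^sub>F N in sequentially. \<forall>j. 1 \<le> j \<and> j + 2 \<le> N \<longrightarrow>
             order_stat N (\<lambda>i. \<theta> N i $ k) j \<in> ball \<theta>\<tau> r \<longrightarrow>
             \<bar>spacing N (\<lambda>i. \<theta> N i $ k) j - spacing N (\<lambda>i. \<theta> N i $ k) (j + 1)\<bar> \<le> C / (real N)\<^sup>2)"
    and A4_density_pos: "0 < fD \<theta>\<tau>"

    \<comment> \<open>the joint asymptotics\<close>
    and N_infinity: "filterlim Ns at_top sequentially"
    and T_infinity: "filterlim Ts at_top sequentially"
    and rate_lower: "(\<lambda>n. sqrt (real (Ts n)) / real (Ns n)) \<longlonglongrightarrow> 0"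
    and rate_upper: "(\<lambda>n. real (Ns n) / (real (Ts n) powr (3/2) / (ln (real (Ts n)))\<^sup>2)) \<longlonglongrightarrow> 0"
  shows "weak_conv_m
           (\<lambda>n. distr M borel (\<lambda>\<omega>. sqrt (real (Ns n) * sqrt (real (Ts n))) * (\<theta>hat\<tau> n \<omega> - \<theta>\<tau>)))
           (density lborel (normal_density 0 (sqrt (\<sigma> \<theta>\<tau> / (sqrt pi * fD \<theta>\<tau>)))))"
proof -
  interpret prob_space M by fact
  define a where "a n i = \<theta> (Ns n) i $ k" for n i
  define Y where "Y n i = \<theta>hat (Ns n) (Ts n) i" for n i
  define sd where "sd n i = \<sigma> (a n i)" for n i
  define s0 where "s0 = \<sigma> \<theta>\<tau>"
  define f where "f = fD \<theta>\<tau>"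
  have m\<Theta>: "\<theta>\<tau> \<in> \<Theta>" using A2_interior interior_subset by blast
  have s0: "0 < s0" using sigma_pos m\<Theta> by (simp add: s0_def)
  have f: "0 < f" using A4_density_pos by (simp add: f_def)
  have a\<Theta>: "a n i \<in> \<Theta>" if "i < Ns n" for n i using A2_coefficients that by (simp add: a_def)
  have \<sigma>a: "0 < \<sigma> (\<theta> N i $ k)" if "i < N" for N i using sigma_pos A2_coefficients[OF that] by blast
  have Yh: "Y n i \<omega> = h (Ts n) (unit_data (Ts n) (\<theta> (Ns n) i) (\<lambda>t. Z i t \<omega>) (\<lambda>t. e i t \<omega>))" for n i \<omega>
    by (simp add: Y_def step1)
  obtain W where env: "conditional_trials Ns Ts Y W"
    using panel_environment[OF regressor_intercept indep A1_innovations A1_regressors A1_common step1_measurable \<sigma>a T_infinity Yh]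
    by blast
  obtain c1 c2 where c: "0 < c1" "\<And>N i. i < N \<Longrightarrow> c1 \<le> (\<sigma> (\<theta> N i $ k))\<^sup>2 \<and> (\<sigma> (\<theta> N i $ k))\<^sup>2 \<le> c2"
    using A3_ii by blast
  \<comment> \<open>Common bounds for all unit scales; \<open>s0\<close> is included because
    \<open>\<theta>\<tau>\<close> need not be the coefficient of any unit.\<close>
  define c0 where "c0 = min (sqrt c1) s0"
  define B where "B = max (sqrt c2) s0"
  have c0: "0 < c0" "c0 \<le> s0" "s0 \<le> B" using c(1) s0 by (auto simp: c0_def B_def)
  have sd: "c0 \<le> sd n i \<and> sd n i \<le> B" if i: "i < Ns n" for n i
  proof -
    have "sqrt c1 \<le> sd n i"
      using c(2)[OF i] \<sigma>a[OF i] by (intro real_le_lsqrt) (auto simp: sd_def a_def)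
    moreover have "sd n i \<le> sqrt c2"
      using c(2)[OF i] by (intro real_le_rsqrt) (auto simp: sd_def a_def)
    ultimately show ?thesis by (auto simp: c0_def B_def)
  qed
  obtain \<Lambda> where \<Lambda>: "0 \<le> \<Lambda>" "\<And>x. x \<in> \<Theta> \<Longrightarrow> \<sigma> x \<le> B \<Longrightarrow> \<bar>\<sigma> x - \<sigma> \<theta>\<tau>\<bar> \<le> \<Lambda> * \<bar>x - \<theta>\<tau>\<bar>"
    using lipschitz_at_interior_point[OF A3_iii A2_interior sigma_pos c0(3)[unfolded s0_def]] by blast
  have lip: "\<bar>sd n i - s0\<bar> \<le> \<Lambda> * \<bar>a n i - \<theta>\<tau>\<bar>" if i: "i < Ns n" for n i
    using \<Lambda>(2)[OF a\<Theta>[OF i]] sd[OF i] by (simp add: sd_def s0_def)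
  obtain \<kappa> where \<kappa>: "\<And>N i. i < N \<Longrightarrow> norm (\<kappa>3 (\<theta> N i $ k)) \<le> \<kappa> \<and> norm (\<kappa>4 (\<theta> N i $ k)) \<le> \<kappa>"
    using A3_iv_kappa_bounded by blast
  obtain C1 where C1: "0 \<le> C1" and ew: "\<And>c3 c4 T x. norm c3 \<le> max \<kappa> 0 \<Longrightarrow> norm c4 \<le> max \<kappa> 0 \<Longrightarrow> 1 \<le> T \<Longrightarrow>
      \<bar>edgeworth b1 b2 b3 c3 c4 T x - std_normal_cdf x\<bar> \<le> C1 * exp (- x\<^sup>2 / 4) / sqrt (real T)"
    using edgeworth_minus_normal[of "max \<kappa> 0" b1 b2 b3] by auto
  \<comment> \<open>The remainder enters with \<open>\<eta> = 1\<close>: an error of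
    \<open>1 / T\<close> per unit adds up to \<open>N / T = o(L)\<close>. The Edgeworth corrections
    go into the decaying term with constant \<open>C1\<close>.\<close>
  have edge: "\<forall>\<^sub>F n in sequentially. \<forall>i<Ns n. \<forall>x.
      \<bar>prob {\<omega>\<in>space M. Y n i \<omega> \<le> x} - std_normal_cdf (sqrt (real (Ts n)) * (x - a n i) / sd n i)\<bar>
      \<le> C1 * exp (- (sqrt (real (Ts n)) * (x - a n i) / sd n i)\<^sup>2 / 4) / sqrt (real (Ts n)) + 1 / real (Ts n)"
    using A3_iv_remainder[OF zero_less_one] eventually_compose_filterlim[OF eventually_gt_at_top[of 0] T_infinity]
  proof (eventually_elim, intro allI impI)
    fix n i x
    assume r: "\<forall>i<Ns n. \<forall>x. \<bar>prob {\<omega>\<in>space M. standardized h k \<sigma> (Ts n) (\<theta> (Ns n) i) (\<lambda>t. Z i t \<omega>) (\<lambda>t. e i t \<omega>) \<le> x}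
           - edgeworth b1 b2 b3 (\<kappa>3 (\<theta> (Ns n) i $ k)) (\<kappa>4 (\<theta> (Ns n) i $ k)) (Ts n) x\<bar> \<le> 1 / real (Ts n)"
      and T0: "0 < Ts n" and i: "i < Ns n"
    let ?x = "sqrt (real (Ts n)) * (x - a n i) / sd n i"
    have "\<bar>prob {\<omega>\<in>space M. Y n i \<omega> \<le> x}
           - edgeworth b1 b2 b3 (\<kappa>3 (\<theta> (Ns n) i $ k)) (\<kappa>4 (\<theta> (Ns n) i $ k)) (Ts n) ?x\<bar> \<le> 1 / real (Ts n)"
      using r[rule_format, OF i, of ?x] unfolding Yh
      unfolding a_def sd_def standardized_le_iff[where T = "Ts n" and \<sigma> = \<sigma> and b = "\<theta> (Ns n) i" and k = k, OF T0 \<sigma>a[OF i]] .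
    moreover have "\<bar>edgeworth b1 b2 b3 (\<kappa>3 (\<theta> (Ns n) i $ k)) (\<kappa>4 (\<theta> (Ns n) i $ k)) (Ts n) ?x - std_normal_cdf ?x\<bar>
        \<le> C1 * exp (- ?x\<^sup>2 / 4) / sqrt (real (Ts n))"
      by (rule ew) (use \<kappa>[OF i] T0 in auto)
    ultimately show "\<bar>prob {\<omega>\<in>space M. Y n i \<omega> \<le> x} - std_normal_cdf ?x\<bar>
        \<le> C1 * exp (- ?x\<^sup>2 / 4) / sqrt (real (Ts n)) + 1 / real (Ts n)" by linarith
  qed
  obtain r C' where r: "0 < r" "\<And>x. x \<in> ball \<theta>\<tau> r \<Longrightarrow> (FD has_real_derivative fD x) (at x)"
      "fD C1_differentiable_on ball \<theta>\<tau> r"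
    and os: "\<forall>\<^sub>F N in sequentially. \<forall>j\<in>{1..N}. order_stat N (\<lambda>i. \<theta> N i $ k) j \<in> ball \<theta>\<tau> r \<longrightarrow>
             \<bar>order_stat N (\<lambda>i. \<theta> N i $ k) j - quantile FD (real j / real N)\<bar> \<le> C' / real N"
    using A4 by blast
  obtain C where C: "0 \<le> C" and cdfN: "\<forall>\<^sub>F N in sequentially. \<forall>y.
      \<bar>empirical_cdf N (\<lambda>i. \<theta> N i $ k) y - \<tau> - fD \<theta>\<tau> * (y - \<theta>\<tau>)\<bar> \<le> C * ((y - \<theta>\<tau>)\<^sup>2 + 1 / real N)"
    using empirical_cdf_expansion[OF limit_cdf A2_compact A2_coefficients tau target r A4_density_pos os] by blast
  have cdf: "\<forall>\<^sub>F n in sequentially. \<forall>y.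
      \<bar>empirical_cdf (Ns n) (a n) y - \<tau> - f * (y - \<theta>\<tau>)\<bar> \<le> C * ((y - \<theta>\<tau>)\<^sup>2 + 1 / real (Ns n))"
    using eventually_compose_filterlim[OF cdfN N_infinity] by (simp add: a_def[abs_def] f_def)
  define w where "w = sqrt (s0 / (sqrt pi * f))"
  have w: "0 < w" using s0 f by (simp add: w_def)
  \<comment> \<open>Mean shift over standard deviation of the count, both in units of
    \<open>L\<close>; cancelling \<open>f\<close> leaves the standard deviation \<open>w\<close> of
    the limit law.\<close>
  have scale: "f * v / sqrt (f * s0 / sqrt pi) = v / w" for v
  proof -
    have "f * s0 / sqrt pi = f\<^sup>2 * (s0 / (sqrt pi * f))" using f by (simp add: power2_eq_square)
    then have "sqrt (f * s0 / sqrt pi) = f * w"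
      unfolding w_def by (simp only: real_sqrt_mult real_sqrt_power[symmetric]) (use f in simp)
    then show ?thesis using f by simp
  qed
  have Ym: "Y n i \<in> borel_measurable M" for n i
  proof -
    have "e i t \<in> borel_measurable M" for i t
      using A1_innovations unfolding iid_innovations_def iid_family_def indep_vars_def2 by force
    moreover have "Z i t \<in> borel_measurable M" for i t
      using A1_regressors common_regressors_measurable
      unfolding iid_regressors_def iid_family_def indep_vars_def2 by force
    ultimately show ?thesis
      unfolding Yh[abs_def] by (intro measurable_unit_estimate[OF step1_measurable])
  qed
  show ?thesis
    unfolding weak_conv_m_def weak_conv_def
  proof (intro allI impI)
    fix v
    define x where "x n = \<theta>\<tau> + v / sqrt (real (Ns n) * sqrt (real (Ts n)))" for n
    define S where "S n \<omega> = (\<Sum>i<Ns n. if Y n i \<omega> \<le> x n then 1 else 0 :: real)" for n \<omega>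
    have [measurable]: "S n \<in> borel_measurable M" for n
      unfolding S_def using Ym by measurable
    have Scard: "S n \<omega> = real (card {i\<in>{..<Ns n}. \<theta>hat (Ns n) (Ts n) i \<omega> \<le> x n})" for n \<omega>
      by (simp add: S_def Y_def sum.If_cases Int_def)
    have lim: "(\<lambda>n. prob {\<omega>\<in>space M. \<tau> * real (Ns n) < S n \<omega>}) \<longlonglongrightarrow> std_normal_cdf (v / w)"
      "(\<lambda>n. prob {\<omega>\<in>space M. \<tau> * real (Ns n) \<le> S n \<omega>}) \<longlonglongrightarrow> std_normal_cdf (v / w)"
      unfolding S_def x_def scale[symmetric]
      by (rule threshold_count_limit[OF env c0 sd \<Lambda>(1) lip C1 edge C cdf f
          N_infinity T_infinity rate_lower rate_upper]; assumption)+
    have ev: "\<forall>\<^sub>F n in sequentially. 0 < Ns n \<and> 0 < Ts n"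
      using eventually_compose_filterlim[OF eventually_gt_at_top[of 0] N_infinity]
        eventually_compose_filterlim[OF eventually_gt_at_top[of 0] T_infinity] by (rule eventually_conj)
    let ?D = "\<lambda>n. distr M borel (\<lambda>\<omega>. sqrt (real (Ns n) * sqrt (real (Ts n))) * (\<theta>hat\<tau> n \<omega> - \<theta>\<tau>))"
    have cdfD: "\<forall>\<^sub>F n in sequentially. cdf (?D n) v = prob {\<omega>\<in>space M. \<theta>hat\<tau> n \<omega> \<le> x n}"
      using ev
    proof eventually_elim
      case (elim n)
      then have p: "0 < sqrt (real (Ns n) * sqrt (real (Ts n)))" by simp
      have "cdf (?D n) v = prob ((\<lambda>\<omega>. sqrt (real (Ns n) * sqrt (real (Ts n))) * (\<theta>hat\<tau> n \<omega> - \<theta>\<tau>)) -` {..v} \<inter> space M)"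
        unfolding cdf_def by (rule measure_distr) (use step2_measurable in auto)
      also have "(\<lambda>\<omega>. sqrt (real (Ns n) * sqrt (real (Ts n))) * (\<theta>hat\<tau> n \<omega> - \<theta>\<tau>)) -` {..v} \<inter> space M
          = {\<omega>\<in>space M. \<theta>hat\<tau> n \<omega> \<le> x n}"
      proof -
        have "A * (y - \<theta>\<tau>) \<le> v \<longleftrightarrow> y \<le> \<theta>\<tau> + v / A" if "0 < A" for A y
          using pos_le_divide_eq[OF that, of "y - \<theta>\<tau>" v] by (auto simp: mult.commute)
        then show ?thesis unfolding x_def using p by auto
      qed
      finally show ?case .
    qed
    \<comment> \<open>The two bounds differ by the event that the count equals
      \<open>\<tau> N\<close> exactly, where the minimizer need not be unique. They have the same
      limit, so the choice of minimizer does not affect the result.\<close>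
    have "(\<lambda>n. cdf (?D n) v) \<longlonglongrightarrow> std_normal_cdf (v / w)"
    proof (rule tendsto_sandwich[OF _ _ lim])
      show "\<forall>\<^sub>F n in sequentially. prob {\<omega>\<in>space M. \<tau> * real (Ns n) < S n \<omega>} \<le> cdf (?D n) v"
        using cdfD
      proof eventually_elim
        case (elim n)
        have "\<theta>hat\<tau> n \<omega> \<le> x n" if "\<omega> \<in> space M" "\<tau> * real (Ns n) < S n \<omega>" for \<omega>
          using check_objective_arg_min_count(2)[OF tau step2[OF that(1)], of "x n"] that(2) unfolding Scard
          by (force simp: not_less[symmetric])
        then show ?case unfolding elim using step2_measurable by (intro finite_measure_mono) auto
      qed
      show "\<forall>\<^sub>F n in sequentially. cdf (?D n) v \<le> prob {\<omega>\<in>space M. \<tau> * real (Ns n) \<le> S n \<omega>}"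
        using cdfD
      proof eventually_elim
        case (elim n)
        have "\<tau> * real (Ns n) \<le> S n \<omega>" if "\<omega> \<in> space M" "\<theta>hat\<tau> n \<omega> \<le> x n" for \<omega>
          using check_objective_arg_min_count(1)[OF tau step2[OF that(1)] that(2)] unfolding Scard .
        then show ?case unfolding elim using step2_measurable by (intro finite_measure_mono) auto
      qed
    qed
    then show "(\<lambda>n. cdf (?D n) v) \<longlonglongrightarrow> cdf (density lborel (normal_density 0 (sqrt (\<sigma> \<theta>\<tau> / (sqrt pi * fD \<theta>\<tau>))))) v"
      using cdf_normal_density[OF w] by (simp add: w_def s0_def f_def)
  qed
qed

end
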